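(* Let $V$ be an FI-module over a field of characteristic $0$. If $V$ is finitely generated, then the sequence of characters $\chi_{V_n}$ of the $S_n$-representations $V_n$ is eventually polynomial: there exist integers $r,N$ and a character polynomial $P(X_1,\dots,X_r)$ such that $\chi_{V_n}(\sigma)=P(X_1,\dots,X_r)(\sigma)$ for all $n\ge N$ and all $\sigma\in S_n$. In particular, $\dim V_n$ is eventually polynomial in $n$ (agrees with a polynomial in $n$ for all sufficiently large $n$).
   Context: FI is the category of finite sets and injections. An FI-module over a commutative ring $k$ is a functor $V$ from FI to $k$-modules; $V_n=V(\{1,\dots,n\})$, which is a representation of $S_n=\mathrm{End}_{\mathrm{FI}}(\{1,\dots,n\})$. $V$ is finitely generated if there is a finite set $\Sigma\subset\coprod_n V_n$ such that no proper sub-FI-module (sub-functor) of $V$ contains $\Sigma$. For each $i\ge 1$ and any $n\ge 0$, $X_i\colon S_n\to\mathbb{N}$ is the class function with $X_i(\sigma)$ equal to the number of $i$-cycles in the cycle decomposition of $\sigma$. A character polynomial is a polynomial (with rational coefficients) in the variables $X_1,X_2,\dots$; it defines a class function on every $S_n$. *)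

theory Defs
  imports
    Complex_Main
    "HOL-Library.FuncSet"
    "HOL-Library.Poly_Mapping"
    "HOL-Combinatorics.Orbits"
    "HOL-Computational_Algebra.Polynomial"
begin

section \<open>FI-modules\<close>

text \<open>
  The category FI is represented by its full subcategory on the finite sets of natural numbers,
  which is equivalent to it and contains all the sets \<open>{1..n}\<close>. A morphism is an injection
  \<open>S \<rightarrow> T\<close>, represented by the function that is \<open>undefined\<close> outside \<open>S\<close>, so that equal morphisms
  are equal as HOL functions.
\<close>

definition FI_hom :: "nat set \<Rightarrow> nat set \<Rightarrow> (nat \<Rightarrow> nat) set" where
  "FI_hom S T = {f \<in> S \<rightarrow>\<^sub>E T. inj_on f S}"

lemma compose_FI_hom:
  assumes "g \<in> FI_hom T U" "f \<in> FI_hom S T"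
  shows "compose S g f \<in> FI_hom S U"
proof -
  have f: "f \<in> S \<rightarrow>\<^sub>E T" "inj_on f S" and g: "g \<in> T \<rightarrow>\<^sub>E U" "inj_on g T"
    using assms by (auto simp: FI_hom_def)
  have fT: "f x \<in> T" if "x \<in> S" for x using f(1) that by (rule PiE_mem)
  have gU: "g y \<in> U" if "y \<in> T" for y using g(1) that by (rule PiE_mem)
  have "compose S g f \<in> S \<rightarrow>\<^sub>E U"
    unfolding compose_def by (rule restrict_PiE_iff[THEN iffD2]) (use fT gU in blast)
  moreover have "inj_on (compose S g f) S"
    using f(2) g(2) fT by (intro inj_onI) (metis compose_eq inj_onD)
  ultimately show ?thesis by (simp add: FI_hom_def)
qed

text \<open>
  An FI-module over \<open>'k\<close>. The modules \<open>V S\<close> are submodules of one ambient \<open>'k\<close>-module, which may be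
  arbitrarily large (for instance a direct sum of all of them) and plays no other role. For
  \<open>f \<in> FI_hom S T\<close>, the map \<open>V S \<rightarrow> V T\<close> induced by \<open>f\<close> is \<open>act S T f\<close>; its values outside
  \<open>V S\<close> are irrelevant, as are \<open>V S\<close> for infinite \<open>S\<close> and \<open>act S T f\<close> for \<open>f \<notin> FI_hom S T\<close>.
\<close>

locale fi_module = module scale
  for scale :: "'k::comm_ring_1 \<Rightarrow> 'v::ab_group_add \<Rightarrow> 'v" +
  fixes V :: "nat set \<Rightarrow> 'v set"
    and act :: "nat set \<Rightarrow> nat set \<Rightarrow> (nat \<Rightarrow> nat) \<Rightarrow> 'v \<Rightarrow> 'v"
  assumes subspace_V: "finite S \<Longrightarrow> subspace (V S)"
    and act_in: "\<lbrakk>finite S; finite T; f \<in> FI_hom S T; v \<in> V S\<rbrakk> \<Longrightarrow> act S T f v \<in> V T"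
    and act_add: "\<lbrakk>finite S; finite T; f \<in> FI_hom S T; v \<in> V S; w \<in> V S\<rbrakk>
      \<Longrightarrow> act S T f (v + w) = act S T f v + act S T f w"
    and act_scale: "\<lbrakk>finite S; finite T; f \<in> FI_hom S T; v \<in> V S\<rbrakk>
      \<Longrightarrow> act S T f (scale c v) = scale c (act S T f v)"
    and act_id: "\<lbrakk>finite S; v \<in> V S\<rbrakk> \<Longrightarrow> act S S (\<lambda>x\<in>S. x) v = v"
    and act_compose: "\<lbrakk>finite S; finite T; finite U; f \<in> FI_hom S T; g \<in> FI_hom T U; v \<in> V S\<rbrakk>
      \<Longrightarrow> act S U (compose S g f) v = act T U g (act S T f v)"
begin

definition sub_fi_module :: "(nat set \<Rightarrow> 'v set) \<Rightarrow> bool" where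
  "sub_fi_module W \<longleftrightarrow>
     (\<forall>S. finite S \<longrightarrow> subspace (W S) \<and> W S \<subseteq> V S) \<and>
     (\<forall>S T f v. finite S \<longrightarrow> finite T \<longrightarrow> f \<in> FI_hom S T \<longrightarrow> v \<in> W S \<longrightarrow> act S T f v \<in> W T)"

text \<open>The disjoint union of the \<open>V\<^sub>n\<close> consists of the pairs \<open>(n, v)\<close> with \<open>v \<in> V {1..n}\<close>.\<close>

definition finitely_generated :: bool where
  "finitely_generated \<longleftrightarrow>
     (\<exists>\<Sigma>. finite \<Sigma> \<and> \<Sigma> \<subseteq> (SIGMA n:UNIV. V {1..n}) \<and>
        (\<forall>W. sub_fi_module W \<longrightarrow> (\<forall>(n, v)\<in>\<Sigma>. v \<in> W {1..n}) \<longrightarrow> (\<forall>S. finite S \<longrightarrow> W S = V S)))"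

end


section \<open>Traces and characters\<close>

text \<open>
  The trace of a linear map from the finite-dimensional subspace \<open>W\<close> to itself: the sum of the
  diagonal entries of its matrix with respect to some basis of \<open>W\<close>. The lemma below shows
  independence of the basis.
\<close>

definition trace_on :: "('k::field \<Rightarrow> 'v::ab_group_add \<Rightarrow> 'v) \<Rightarrow> 'v set \<Rightarrow> ('v \<Rightarrow> 'v) \<Rightarrow> 'k" where
  "trace_on scale W f =
     (let B = (SOME B. \<not> module.dependent scale B \<and> module.span scale B = W)
      in \<Sum>b\<in>B. module.representation scale B (f b) b)"

lemma (in vector_space) trace_on_eq:
  assumes B: "finite B" "independent B" "span B = W"
    and maps: "\<And>v. v \<in> W \<Longrightarrow> f v \<in> W"
    and add: "\<And>v w. v \<in> W \<Longrightarrow> w \<in> W \<Longrightarrow> f (v + w) = f v + f w"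
    and scale: "\<And>c v. v \<in> W \<Longrightarrow> f (scale c v) = scale c (f v)"
  shows "trace_on scale W f = (\<Sum>b\<in>B. representation B (f b) b)"
proof -
  define C where "C = (SOME C. independent C \<and> span C = W)"
  have C: "independent C" "span C = W"
    using someI[of "\<lambda>C. independent C \<and> span C = W" B] B(2,3) by (auto simp: C_def)
  have finC: "finite C"
    using independent_span_bound[OF B(1) C(1)] B(3) C(2) span_superset by blast
  have W: "subspace W" using B(3) subspace_span by blast
  have f_sum: "f (\<Sum>i\<in>I. scale (g i) i) = (\<Sum>i\<in>I. scale (g i) (f i))"
    if "finite I" "I \<subseteq> W" for I g
    using that
  proof (induction I rule: finite_induct)
    case empty
    have "f (scale 0 0) = scale 0 (f 0)" using W by (intro scale) (auto simp: subspace_0)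
    then show ?case by simp
  next
    case (insert i I)
    have "(\<Sum>i\<in>I. scale (g i) i) \<in> W"
      using insert.prems W by (intro subspace_sum) (auto intro: subspace_scale)
    then show ?case
      using insert W by (simp add: add scale subspace_scale)
  qed
  have *: "f b = (\<Sum>c\<in>C. scale (representation C b c) (f c))" if "b \<in> B" for b
  proof -
    have "b \<in> span C" using that B(3) C(2) span_base by blast
    then have "b = (\<Sum>c\<in>C. scale (representation C b c) c)"
      using sum_representation_eq[OF C(1) _ finC] by simp
    then have "f b = f (\<Sum>c\<in>C. scale (representation C b c) c)" by simp
    also have "\<dots> = (\<Sum>c\<in>C. scale (representation C b c) (f c))"
      using finC C(2) span_superset by (intro f_sum) auto
    finally show ?thesis .
  qed
  have fC: "f c \<in> W" if "c \<in> C" for c using maps that C(2) span_base by blast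
  have repB: "representation B (f b) b = (\<Sum>c\<in>C. representation C b c * representation B (f c) b)"
    if "b \<in> B" for b
  proof -
    have "representation B (f b) = (\<lambda>b'. \<Sum>c\<in>C. representation B (scale (representation C b c) (f c)) b')"
      unfolding *[OF that] using B(2,3) fC W
      by (intro representation_sum) (auto intro: subspace_scale)
    then show ?thesis using B(2,3) fC by (simp add: representation_scale)
  qed
  have repC: "representation C (f c) c = (\<Sum>b\<in>B. representation B (f c) b * representation C b c)"
    if "c \<in> C" for c
  proof -
    have fc: "f c = (\<Sum>b\<in>B. scale (representation B (f c) b) b)"
      using sum_representation_eq[OF B(2) _ B(1)] fC[OF that] B(3) by simp
    have BW: "b \<in> W" if "b \<in> B" for b using that B(3) span_base by blast
    have "representation C (\<Sum>b\<in>B. scale (representation B (f c) b) b) =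
        (\<lambda>c'. \<Sum>b\<in>B. representation C (scale (representation B (f c) b) b) c')"
      using C BW W by (intro representation_sum) (auto intro: subspace_scale)
    then have "representation C (\<Sum>b\<in>B. scale (representation B (f c) b) b) c =
        (\<Sum>b\<in>B. representation B (f c) b * representation C b c)"
      using C BW by (simp add: representation_scale)
    then show ?thesis using fc by simp
  qed
  have "(\<Sum>b\<in>B. representation B (f b) b) =
      (\<Sum>b\<in>B. \<Sum>c\<in>C. representation C b c * representation B (f c) b)"
    by (simp add: repB)
  also have "\<dots> = (\<Sum>c\<in>C. \<Sum>b\<in>B. representation C b c * representation B (f c) b)"
    by (rule sum.swap)
  also have "\<dots> = (\<Sum>c\<in>C. representation C (f c) c)"
    by (simp add: repC mult.commute)
  finally show ?thesis by (simp add: trace_on_def C_def Let_def)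
qed

text \<open>
  The character of the \<open>S\<^sub>n\<close>-representation \<open>V\<^sub>n = V {1..n}\<close>. A permutation \<open>\<sigma>\<close> of \<open>{1..n}\<close> is an
  endofunction of \<open>nat\<close> with \<open>\<sigma> permutes {1..n}\<close>; the endomorphism of \<open>{1..n}\<close> in FI that it
  defines is \<open>restrict \<sigma> {1..n}\<close>.
\<close>

definition fi_character ::
  "('k::field \<Rightarrow> 'v::ab_group_add \<Rightarrow> 'v) \<Rightarrow> (nat set \<Rightarrow> 'v set) \<Rightarrow>
   (nat set \<Rightarrow> nat set \<Rightarrow> (nat \<Rightarrow> nat) \<Rightarrow> 'v \<Rightarrow> 'v) \<Rightarrow> nat \<Rightarrow> (nat \<Rightarrow> nat) \<Rightarrow> 'k" where
  "fi_character scale V act n \<sigma> =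
     trace_on scale (V {1..n}) (act {1..n} {1..n} (restrict \<sigma> {1..n}))"

text \<open>
  Over a field, the spaces of a finitely generated FI-module are finite-dimensional, so that the
  values of \<^const>\<open>trace_on\<close> and \<^const>\<open>vector_space.dim\<close> on them are the genuine
  trace and dimension. More generally, the modules are finitely generated over any ring.
\<close>

lemma (in fi_module) finitely_generated_imp_finite_span:
  assumes "finitely_generated" "finite T"
  shows "\<exists>B. finite B \<and> span B = V T"
proof -
  obtain \<Sigma> where \<Sigma>: "finite \<Sigma>" "\<Sigma> \<subseteq> (SIGMA n:UNIV. V {1..n})"
    and gen: "\<And>W. sub_fi_module W \<Longrightarrow> (\<forall>(n, v)\<in>\<Sigma>. v \<in> W {1..n}) \<Longrightarrow> (\<forall>S. finite S \<longrightarrow> W S = V S)"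
    using assms(1) unfolding finitely_generated_def by metis
  define G where "G S = (\<Union>(n, v)\<in>\<Sigma>. (\<lambda>f. act {1..n} S f v) ` FI_hom {1..n} S)" for S
  have G_I: "act {1..n} S f v \<in> G S" if "(n, v) \<in> \<Sigma>" "f \<in> FI_hom {1..n} S" for n S f v
    unfolding G_def using that by blast
  have G_V: "G S \<subseteq> V S" if "finite S" for S
    using \<Sigma>(2) that by (auto simp: G_def intro!: act_in)
  have span_V: "span (G S) \<subseteq> V S" if "finite S" for S
    using G_V[OF that] subspace_V[OF that] by (rule span_minimal)
  have closed: "act S U f v \<in> span (G U)"
    if SU: "finite S" "finite U" and f: "f \<in> FI_hom S U" and v: "v \<in> span (G S)" for S U f v
  proof -
    have "v \<in> V S \<and> act S U f v \<in> span (G U)"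
      using v
    proof (induction rule: span_induct_alt)
      case base
      have "0 \<in> V S" using subspace_V[OF SU(1)] by (rule subspace_0)
      then have "act S U f (scale 0 0) = scale 0 (act S U f 0)" using SU f by (intro act_scale)
      then show ?case using \<open>0 \<in> V S\<close> by (simp add: span_zero)
    next
      case (step c x y)
      have x: "x \<in> V S" using step.hyps G_V[OF SU(1)] by blast
      have y: "y \<in> V S" using step.IH by blast
      obtain n w g where w: "(n, w) \<in> \<Sigma>" and g: "g \<in> FI_hom {1..n} S" and xe: "x = act {1..n} S g w"
        using step.hyps by (auto simp: G_def)
      have "compose {1..n} f g \<in> FI_hom {1..n} U"
        using f g by (rule compose_FI_hom)
      moreover have "act {1..n} U (compose {1..n} f g) w = act S U f x"
        unfolding xe using w \<Sigma>(2) f g SU by (intro act_compose) auto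
      ultimately have "act S U f x \<in> G U" using G_I[OF w] by metis
      moreover have "act S U f (scale c x + y) = scale c (act S U f x) + act S U f y"
        using x y SU f subspace_V[OF SU(1)] by (simp add: act_add act_scale subspace_scale)
      moreover have "scale c x + y \<in> V S"
        using x y subspace_V[OF SU(1)] by (simp add: subspace_add subspace_scale)
      ultimately show ?case using step by (simp add: span_add span_scale span_base)
    qed
    then show ?thesis ..
  qed
  have "sub_fi_module (\<lambda>S. span (G S))"
    unfolding sub_fi_module_def using span_V closed by (simp add: subspace_span)
  moreover have "\<forall>(n, v)\<in>\<Sigma>. v \<in> span (G {1..n})"
  proof clarify
    fix n v assume nv: "(n, v) \<in> \<Sigma>"
    have "(\<lambda>x\<in>{1..n}. x) \<in> FI_hom {1..n} {1..n}" by (auto simp: FI_hom_def inj_on_def)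
    moreover have "act {1..n} {1..n} (\<lambda>x\<in>{1..n}. x) v = v" using nv \<Sigma>(2) by (intro act_id) auto
    ultimately have "v \<in> G {1..n}" using G_I[OF nv] by metis
    then show "v \<in> span (G {1..n})" by (rule span_base)
  qed
  ultimately have "span (G T) = V T" using gen assms(2) by blast
  moreover have "finite (FI_hom {1..n} T)" for n
    using assms(2) by (auto simp: FI_hom_def intro!: finite_PiE)
  then have "finite (G T)" using \<Sigma>(1) by (auto simp: G_def)
  ultimately show ?thesis by blast
qed


section \<open>Character polynomials\<close>

text \<open>
  \<open>X\<^sub>i(\<sigma>)\<close> for \<open>\<sigma>\<close> in \<open>S\<^sub>n\<close>: the cycles of \<open>\<sigma>\<close>, fixed points included, correspond to its orbits
  on \<open>{1..n}\<close>.
\<close>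

definition cycle_count :: "nat \<Rightarrow> nat \<Rightarrow> (nat \<Rightarrow> nat) \<Rightarrow> nat" where
  "cycle_count i n \<sigma> = card {C \<in> orbit \<sigma> ` {1..n}. card C = i}"

text \<open>
  A polynomial over the rationals in indeterminates indexed by \<open>nat\<close>, as a finitely supported
  function from monomials to coefficients; a monomial is a finitely supported function giving the
  exponent of each indeterminate.
\<close>

type_synonym char_poly = "(nat \<Rightarrow>\<^sub>0 nat) \<Rightarrow>\<^sub>0 rat"

definition char_poly_vars :: "char_poly \<Rightarrow> nat set" where
  "char_poly_vars P = (\<Union>m\<in>Poly_Mapping.keys P. Poly_Mapping.keys m)"

definition char_poly_eval :: "char_poly \<Rightarrow> nat \<Rightarrow> (nat \<Rightarrow> nat) \<Rightarrow> rat" where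
  "char_poly_eval P n \<sigma> =
     (\<Sum>m\<in>Poly_Mapping.keys P. Poly_Mapping.lookup P m *
        (\<Prod>i\<in>Poly_Mapping.keys m. of_nat (cycle_count i n \<sigma>) ^ Poly_Mapping.lookup m i))"

end

theory Submission
  imports
    Defs
    "HOL-Library.List_Lexorder"
    "HOL-Library.Product_Lexorder"
    "HOL-Combinatorics.Cycles"
begin

text \<open>
  For a finite set \<open>S\<close> and \<open>B \<subseteq> S\<close> let \<open>boundary S B\<close> be the sum of the images in \<open>V S\<close> of the spaces
  \<open>V (S - {b})\<close> with \<open>b \<in> B\<close>. With \<open>A = S - B\<close>, the quotient \<open>V S / boundary S B\<close> is the value at \<open>A\<close>
  of the FI-module that arises from \<open>V\<close> by \<open>card B\<close> applications of the derivative, which sends \<open>V\<close>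
  to the cokernel of the map from \<open>V\<close> to its shift by one point. The proof rests on three facts
  about these quotients.

  First, they vanish as soon as \<open>card B\<close> exceeds the degrees \<open>d\<close> of the generators, because an
  injection from a small set misses a point of \<open>B\<close> (\<open>boundary_full\<close>).

  Secondly, they are torsion free once \<open>card A\<close> is at least some \<open>a\<close>: the maps that add one point to
  \<open>A\<close> are injective (\<open>torsion_vanishes\<close>). This is the Noetherian part. Every space \<open>V S\<close> is
  spanned by monomials, the images of the generators under injections. With respect to the
  lexicographic order, the leading monomials of torsion elements are carried to such leading
  monomials by strictly increasing maps, and Dickson's lemma allows no infinite sequence of
  essentially new ones. A map that is not onto kills torsion elements; so, in high degree, the
  leading monomials of torsion elements are redundant in a spanning set, and the torsion is zero.

  Thirdly, if \<open>card A\<close> is at least \<open>a\<close>, lifts of bases of the quotients for \<open>A \<union> B\<close> and \<open>B\<close>, where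
  \<open>B\<close> ranges over the subsets of \<open>Y\<close>, form a basis of \<open>V (A \<union> Y)\<close> (\<open>cube_basis\<close>). A permutation
  \<open>\<sigma>\<close> that preserves \<open>A\<close> and \<open>Y\<close> permutes the blocks of this basis modulo the blocks of smaller
  \<open>B\<close>. Hence its trace on \<open>V (A \<union> Y)\<close> is the sum of its traces on the quotients with
  \<open>\<sigma> ` B = B\<close> (\<open>trace_cube\<close>).

  The trace formula is applied twice to the trace of \<open>\<sigma> \<in> S\<^sub>n\<close> on \<open>V\<^sub>n\<^sub>+\<^sub>t\<close>, where \<open>\<sigma>\<close> fixes the \<open>t\<close> new
  points. If \<open>A\<close> consists of the \<open>t \<ge> a\<close> new points and \<open>Y = {1..n}\<close>, it expresses the trace as a sum
  over the invariant subsets of \<open>{1..n}\<close> of size at most \<open>d\<close> of a class function. Counting invariant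
  subsets of a given cycle type yields products of binomial coefficients in the numbers of
  cycles of \<open>\<sigma>\<close>, so that the trace is a character polynomial for all \<open>n\<close>. If \<open>A = {1..n}\<close> with
  \<open>n \<ge> a\<close>, and \<open>Y\<close> consists of the new points, the formula shows that the trace is a polynomial of
  degree at most \<open>d\<close> in \<open>t\<close>. Such a polynomial is determined by its values at the \<open>t \<ge> a\<close>; therefore
  the value at \<open>t = 0\<close>, which is the character of \<open>V\<^sub>n\<close>, is a character polynomial for \<open>n \<ge> a\<close>
  (\<open>char_poly_descent\<close>).

  The coefficients are rational since the trace of a permutation on a representation of a
  symmetric group is rational: summing over the powers of \<open>\<sigma>\<close> gives an integer, the powers that
  generate the same cyclic group are conjugate to \<open>\<sigma>\<close>, and the others have smaller order. The
  dimension is the character at the identity, for which \<open>X\<^sub>1 = n\<close> and all other \<open>X\<^sub>i\<close> vanish.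
\<close>

section \<open>Bases modulo a subspace and traces\<close>

locale lin_space = vector_space scale
  for scale :: "'a::field \<Rightarrow> 'b::ab_group_add \<Rightarrow> 'b"
begin

definition lin_on :: "'b set \<Rightarrow> 'b set \<Rightarrow> ('b \<Rightarrow> 'b) \<Rightarrow> bool" where
  "lin_on W W' f \<longleftrightarrow> (\<forall>v\<in>W. f v \<in> W') \<and> (\<forall>v\<in>W. \<forall>w\<in>W. f (v + w) = f v + f w) \<and>
     (\<forall>c. \<forall>v\<in>W. f (scale c v) = scale c (f v))"

definition fin_dim :: "'b set \<Rightarrow> bool" where
  "fin_dim W \<longleftrightarrow> (\<exists>B. finite B \<and> span B = W)"

text \<open>
  The family \<open>e\<close>, indexed by \<open>I\<close>, is a basis of \<open>W\<close> modulo \<open>U\<close>. Such a relative basis stands for a basis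
  of the quotient space \<open>W / U\<close>; families are used because the basis vectors built below come
  with natural indices, while their distinctness is part of what has to be proved.
\<close>

definition rel_basis :: "'i set \<Rightarrow> ('i \<Rightarrow> 'b) \<Rightarrow> 'b set \<Rightarrow> 'b set \<Rightarrow> bool" where
  "rel_basis I e U W \<longleftrightarrow> finite I \<and> subspace U \<and> subspace W \<and> U \<subseteq> W \<and> (\<forall>i\<in>I. e i \<in> W) \<and>
     (\<forall>w\<in>W. \<exists>c. w - (\<Sum>i\<in>I. scale (c i) (e i)) \<in> U) \<and>
     (\<forall>c. (\<Sum>i\<in>I. scale (c i) (e i)) \<in> U \<longrightarrow> (\<forall>i\<in>I. c i = 0))"

lemma lin_on_in: "lin_on W W' f \<Longrightarrow> v \<in> W \<Longrightarrow> f v \<in> W'"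
  by (simp add: lin_on_def)

lemma lin_on_add: "lin_on W W' f \<Longrightarrow> v \<in> W \<Longrightarrow> w \<in> W \<Longrightarrow> f (v + w) = f v + f w"
  by (simp add: lin_on_def)

lemma lin_on_scale: "lin_on W W' f \<Longrightarrow> v \<in> W \<Longrightarrow> f (scale c v) = scale c (f v)"
  by (simp add: lin_on_def)

lemma lin_on_0: "lin_on W W' f \<Longrightarrow> subspace W \<Longrightarrow> f 0 = 0"
  using lin_on_scale[of W W' f 0 0] by (simp add: subspace_0)

lemma lin_on_diff:
  assumes "lin_on W W' f" "subspace W" "v \<in> W" "w \<in> W"
  shows "f (v - w) = f v - f w"
  using lin_on_add[OF assms(1), of "v - w" w] assms by (simp add: subspace_diff)

lemma lin_on_sum:
  assumes f: "lin_on W W' f" and W: "subspace W" and e: "\<And>i. i \<in> I \<Longrightarrow> e i \<in> W"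
  shows "f (\<Sum>i\<in>I. e i) = (\<Sum>i\<in>I. f (e i))"
  using e
proof (induction I rule: infinite_finite_induct)
  case (insert x F)
  then have "(\<Sum>i\<in>F. e i) \<in> W" using W by (intro subspace_sum) auto
  then show ?case using insert lin_on_add[OF f] by simp
qed (simp_all add: lin_on_0[OF f W])

lemma lin_on_comb:
  assumes f: "lin_on W W' f" and W: "subspace W" and e: "\<And>i. i \<in> I \<Longrightarrow> e i \<in> W"
  shows "f (\<Sum>i\<in>I. scale (c i) (e i)) = (\<Sum>i\<in>I. scale (c i) (f (e i)))"
proof -
  have "f (\<Sum>i\<in>I. scale (c i) (e i)) = (\<Sum>i\<in>I. f (scale (c i) (e i)))"
    using e W by (intro lin_on_sum[OF f W]) (auto intro: subspace_scale)
  then show ?thesis using e lin_on_scale[OF f] by simp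
qed

lemma comb_in: "subspace W \<Longrightarrow> (\<And>i. i \<in> I \<Longrightarrow> e i \<in> W) \<Longrightarrow> (\<Sum>i\<in>I. scale (c i) (e i)) \<in> W"
  by (intro subspace_sum subspace_scale) auto

lemma lin_on_subspace_image:
  assumes f: "lin_on W W' f" and W: "subspace W"
  shows "subspace (f ` W)"
proof (rule subspaceI)
  show "0 \<in> f ` W" using lin_on_0[OF f W] subspace_0[OF W] by (metis imageI)
next
  fix x y assume "x \<in> f ` W" "y \<in> f ` W"
  then obtain v w where vw: "v \<in> W" "w \<in> W" "x = f v" "y = f w" by blast
  then show "x + y \<in> f ` W" using lin_on_add[OF f vw(1,2)] subspace_add[OF W vw(1,2)] by (metis imageI)
next
  fix c x assume "x \<in> f ` W"
  then obtain v where v: "v \<in> W" "x = f v" by blast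
  then show "scale c x \<in> f ` W" using lin_on_scale[OF f v(1)] subspace_scale[OF W v(1)] by (metis imageI)
qed

lemma lin_on_subset: "lin_on W W' f \<Longrightarrow> U \<subseteq> W \<Longrightarrow> (\<And>v. v \<in> U \<Longrightarrow> f v \<in> U') \<Longrightarrow> lin_on U U' f"
  unfolding lin_on_def by blast

lemma lin_on_span_subset:
  assumes f: "lin_on W W' f" and W: "subspace W" and X: "X \<subseteq> W"
    and fX: "\<And>x. x \<in> X \<Longrightarrow> f x \<in> U" and U: "subspace U" and v: "v \<in> span X"
  shows "f v \<in> U"
proof -
  have XW: "span X \<subseteq> W" using X W by (rule span_minimal)
  have "v \<in> W \<and> f v \<in> U" using v
  proof (induction rule: span_induct_alt)
    case base
    then show ?case using subspace_0 W U lin_on_0[OF f W] by simp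
  next
    case (step c x y)
    then have "x \<in> W" using X by blast
    then have "f (scale c x + y) = scale c (f x) + f y" "scale c x + y \<in> W"
      using step W lin_on_add[OF f, of "scale c x" y] lin_on_scale[OF f]
      by (auto intro: subspace_scale subspace_add)
    then show ?case using step U fX by (auto intro: subspace_scale subspace_add)
  qed
  then show ?thesis ..
qed

lemma independent_in_fin_dim:
  assumes "fin_dim W" "independent B" "B \<subseteq> W"
  shows "finite B"
  using assms independent_span_bound unfolding fin_dim_def by blast

lemma fin_dim_subspace:
  assumes "fin_dim W" "subspace U" "U \<subseteq> W"
  shows "fin_dim U"
proof -
  obtain B where B: "B \<subseteq> U" "independent B" "U \<subseteq> span B" by (rule maximal_independent_subset)
  then have "span B = U" using assms(2) by (simp add: span_subspace)
  moreover have "finite B" using independent_in_fin_dim[OF assms(1) B(2)] B(1) assms(3) by blast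
  ultimately show ?thesis unfolding fin_dim_def by blast
qed

lemma rel_basisD:
  assumes "rel_basis I e U W"
  shows "finite I" "subspace U" "subspace W" "U \<subseteq> W" "\<And>i. i \<in> I \<Longrightarrow> e i \<in> W"
    "\<And>w. w \<in> W \<Longrightarrow> \<exists>c. w - (\<Sum>i\<in>I. scale (c i) (e i)) \<in> U"
    "\<And>c i. (\<Sum>i\<in>I. scale (c i) (e i)) \<in> U \<Longrightarrow> i \<in> I \<Longrightarrow> c i = 0"
  using assms unfolding rel_basis_def by auto

lemma rel_basis_exists:
  assumes W: "fin_dim W" and U: "subspace U" "U \<subseteq> W"
  shows "\<exists>L. L \<subseteq> W \<and> rel_basis L (\<lambda>x. x) U W"
proof -
  have sW: "subspace W" using W unfolding fin_dim_def by auto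
  obtain A where A: "A \<subseteq> U" "independent A" "U \<subseteq> span A" by (rule maximal_independent_subset)
  have AU: "span A = U" using A U by (simp add: span_subspace)
  obtain B where B: "A \<subseteq> B" "B \<subseteq> W" "independent B" "W \<subseteq> span B"
    using maximal_independent_subset_extend[of A W] A U by blast
  have finB: "finite B" using independent_in_fin_dim[OF W B(3,2)] .
  then have finA: "finite A" using B(1) finite_subset by blast
  have "\<exists>c. w - (\<Sum>i\<in>B - A. scale (c i) i) \<in> U" if w: "w \<in> W" for w
  proof -
    obtain c where "w = (\<Sum>i\<in>B. scale (c i) i)" using w B(4) span_finite[OF finB] by (metis (no_types, lifting) rangeE subsetD)
    also have "\<dots> = (\<Sum>i\<in>B - A. scale (c i) i) + (\<Sum>i\<in>A. scale (c i) i)"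
      using finB B(1) by (rule sum.subset_diff[rotated])
    finally have "w - (\<Sum>i\<in>B - A. scale (c i) i) = (\<Sum>i\<in>A. scale (c i) i)" by simp
    moreover have "(\<Sum>i\<in>A. scale (c i) i) \<in> U"
      unfolding AU[symmetric] by (intro span_sum span_scale span_base)
    ultimately show ?thesis by metis
  qed
  moreover have "\<forall>i\<in>B - A. c i = 0" if U': "(\<Sum>i\<in>B - A. scale (c i) i) \<in> U" for c
  proof -
    obtain c' where c': "(\<Sum>i\<in>B - A. scale (c i) i) = (\<Sum>i\<in>A. scale (c' i) i)"
      using U' AU span_finite[OF finA] by auto
    define d where "d i = (if i \<in> A then - c' i else c i)" for i
    have "(\<Sum>i\<in>B. scale (d i) i) = (\<Sum>i\<in>B - A. scale (d i) i) + (\<Sum>i\<in>A. scale (d i) i)"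
      using finB B(1) by (rule sum.subset_diff[rotated])
    also have "\<dots> = 0" using c' by (simp add: d_def sum_negf)
    finally have "\<forall>i\<in>B. d i = 0" using independentD[OF B(3) finB] by blast
    then show ?thesis by (metis DiffD1 DiffD2 d_def)
  qed
  ultimately have "rel_basis (B - A) (\<lambda>x. x) U W"
    unfolding rel_basis_def using finB U sW B(2) by auto
  then show ?thesis using B(2) by blast
qed

lemma rel_basis_chain:
  assumes 1: "rel_basis I e U W" and 2: "rel_basis J e W Z" and disj: "I \<inter> J = {}"
  shows "rel_basis (I \<union> J) e U Z"
proof -
  note 11 = rel_basisD[OF 1] and 22 = rel_basisD[OF 2]
  have sum: "(\<Sum>i\<in>I \<union> J. scale (c i) (e i)) = (\<Sum>i\<in>I. scale (c i) (e i)) + (\<Sum>i\<in>J. scale (c i) (e i))" for c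
    using 11(1) 22(1) disj by (rule sum.union_disjoint)
  have "\<exists>c. z - (\<Sum>i\<in>I \<union> J. scale (c i) (e i)) \<in> U" if z: "z \<in> Z" for z
  proof -
    obtain c where c: "z - (\<Sum>i\<in>J. scale (c i) (e i)) \<in> W" using 22(6)[OF z] by blast
    obtain c' where c': "z - (\<Sum>i\<in>J. scale (c i) (e i)) - (\<Sum>i\<in>I. scale (c' i) (e i)) \<in> U"
      using 11(6)[OF c] by blast
    define d where "d i = (if i \<in> I then c' i else c i)" for i
    have "(\<Sum>i\<in>I. scale (d i) (e i)) = (\<Sum>i\<in>I. scale (c' i) (e i))" by (simp add: d_def)
    moreover have "(\<Sum>i\<in>J. scale (d i) (e i)) = (\<Sum>i\<in>J. scale (c i) (e i))"
      using disj by (intro sum.cong) (auto simp: d_def)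
    ultimately have "z - (\<Sum>i\<in>I \<union> J. scale (d i) (e i)) \<in> U"
      using c' by (simp add: sum algebra_simps)
    then show ?thesis by blast
  qed
  moreover have "\<forall>i\<in>I \<union> J. c i = 0" if U: "(\<Sum>i\<in>I \<union> J. scale (c i) (e i)) \<in> U" for c
  proof -
    have I: "(\<Sum>i\<in>I. scale (c i) (e i)) \<in> W" using 11 by (intro comb_in)
    have "(\<Sum>i\<in>I \<union> J. scale (c i) (e i)) - (\<Sum>i\<in>I. scale (c i) (e i)) \<in> W"
      using U I 11 by (intro subspace_diff) auto
    then have "(\<Sum>i\<in>J. scale (c i) (e i)) \<in> W" by (simp add: sum)
    then have J: "\<forall>i\<in>J. c i = 0" using 22(7)[of c] by blast
    then have "(\<Sum>i\<in>J. scale (c i) (e i)) = 0" by (intro sum.neutral) simp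
    then have "(\<Sum>i\<in>I. scale (c i) (e i)) \<in> U" using U by (simp add: sum)
    then have "\<forall>i\<in>I. c i = 0" using 11(7)[of c] by blast
    then show ?thesis using J by blast
  qed
  ultimately show ?thesis
    unfolding rel_basis_def using 11(1-5) 22(1-5) by blast
qed

text \<open>
  If \<open>g\<close> induces an injection from \<open>W / U\<close> to \<open>Z / U'\<close>, then it carries a relative basis to a relative
  basis of its image.
\<close>

lemma rel_basis_push:
  assumes b: "rel_basis I e U W" and g: "lin_on W Z g" and Z: "subspace Z"
    and U': "subspace U'" "U' \<subseteq> Z" and iff: "\<And>w. w \<in> W \<Longrightarrow> g w \<in> U' \<longleftrightarrow> w \<in> U"
    and Z': "\<And>z. z \<in> Z' \<longleftrightarrow> (\<exists>w\<in>W. z - g w \<in> U')"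
  shows "rel_basis I (\<lambda>i. g (e i)) U' Z'"
proof -
  note bb = rel_basisD[OF b]
  have comb: "g (\<Sum>i\<in>I. scale (c i) (e i)) = (\<Sum>i\<in>I. scale (c i) (g (e i)))" for c
    using g bb(3,5) by (rule lin_on_comb)
  have subZ': "subspace Z'"
  proof (rule subspaceI)
    show "0 \<in> Z'" unfolding Z' using subspace_0[OF bb(3)] subspace_0[OF U'(1)] lin_on_0[OF g bb(3)] by force
  next
    fix x y assume "x \<in> Z'" "y \<in> Z'"
    then obtain v w where vw: "v \<in> W" "w \<in> W" "x - g v \<in> U'" "y - g w \<in> U'" unfolding Z' by blast
    then have "x + y - g (v + w) = (x - g v) + (y - g w)" using lin_on_add[OF g vw(1,2)] by simp
    then show "x + y \<in> Z'" unfolding Z' using vw subspace_add[OF bb(3) vw(1,2)] subspace_add[OF U'(1) vw(3,4)] by metis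
  next
    fix c x assume "x \<in> Z'"
    then obtain v where v: "v \<in> W" "x - g v \<in> U'" unfolding Z' by blast
    then have "scale c x - g (scale c v) = scale c (x - g v)" using lin_on_scale[OF g v(1)]
      by (simp add: scale_right_diff_distrib)
    then show "scale c x \<in> Z'" unfolding Z' using subspace_scale[OF bb(3) v(1)] subspace_scale[OF U'(1) v(2)] by metis
  qed
  have "U' \<subseteq> Z'" unfolding Z' using subspace_0[OF bb(3)] lin_on_0[OF g bb(3)] by (metis diff_zero subsetI Z')
  moreover have "g (e i) \<in> Z'" if "i \<in> I" for i
    unfolding Z' using bb(5)[OF that] subspace_0[OF U'(1)] by (metis diff_self)
  moreover have "\<exists>c. z - (\<Sum>i\<in>I. scale (c i) (g (e i))) \<in> U'" if z: "z \<in> Z'" for z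
  proof -
    obtain w where w: "w \<in> W" "z - g w \<in> U'" using z unfolding Z' by blast
    obtain c where c: "w - (\<Sum>i\<in>I. scale (c i) (e i)) \<in> U" using bb(6)[OF w(1)] by blast
    have in_W: "(\<Sum>i\<in>I. scale (c i) (e i)) \<in> W" using bb by (intro comb_in)
    then have "g (w - (\<Sum>i\<in>I. scale (c i) (e i))) \<in> U'" using c iff w(1) bb(3) by (simp add: subspace_diff)
    then have "g w - (\<Sum>i\<in>I. scale (c i) (g (e i))) \<in> U'"
      using lin_on_diff[OF g bb(3) w(1) in_W] comb by simp
    from subspace_add[OF U'(1) w(2) this] show ?thesis by auto
  qed
  moreover have "\<forall>i\<in>I. c i = 0" if "(\<Sum>i\<in>I. scale (c i) (g (e i))) \<in> U'" for c
  proof -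
    have "(\<Sum>i\<in>I. scale (c i) (e i)) \<in> W" using bb by (intro comb_in)
    then have "(\<Sum>i\<in>I. scale (c i) (e i)) \<in> U" using that iff comb by metis
    then show ?thesis using bb(7)[of c] by blast
  qed
  ultimately show ?thesis unfolding rel_basis_def using bb(1) U'(1) subZ' by blast
qed

lemma rel_basis_reindex:
  assumes "rel_basis I (\<lambda>i. e (p i)) U W" "inj_on p I"
  shows "rel_basis (p ` I) e U W"
proof -
  note bb = rel_basisD[OF assms(1)]
  have sum: "(\<Sum>i\<in>p ` I. scale (c i) (e i)) = (\<Sum>i\<in>I. scale (c (p i)) (e (p i)))" for c
    using assms(2) by (simp add: sum.reindex)
  have "\<exists>c. w - (\<Sum>i\<in>p ` I. scale (c i) (e i)) \<in> U" if w: "w \<in> W" for w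
  proof -
    obtain c where c: "w - (\<Sum>i\<in>I. scale (c i) (e (p i))) \<in> U" using bb(6)[OF w] by blast
    have "(\<Sum>i\<in>I. scale (c (the_inv_into I p (p i))) (e (p i))) = (\<Sum>i\<in>I. scale (c i) (e (p i)))"
      using assms(2) by (intro sum.cong) (auto simp: the_inv_into_f_f)
    then show ?thesis using c by (intro exI[of _ "\<lambda>i. c (the_inv_into I p i)"]) (simp add: sum)
  qed
  moreover have "\<forall>i\<in>p ` I. c i = 0" if "(\<Sum>i\<in>p ` I. scale (c i) (e i)) \<in> U" for c
    using bb(7)[of "\<lambda>i. c (p i)"] that by (auto simp: sum)
  ultimately show ?thesis unfolding rel_basis_def using bb by blast
qed

lemma rel_basis_cong:
  assumes "rel_basis I e U W" "\<And>i. i \<in> I \<Longrightarrow> e i = e' i"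
  shows "rel_basis I e' U W"
proof -
  have "(\<Sum>i\<in>I. scale (c i) (e i)) = (\<Sum>i\<in>I. scale (c i) (e' i))" for c
    using assms(2) by (intro sum.cong) auto
  then show ?thesis using assms unfolding rel_basis_def by simp
qed

lemma rel_basis_zero_span:
  assumes b: "rel_basis I e {0} W"
  shows "inj_on e I" "independent (e ` I)" "span (e ` I) = W"
proof -
  note bb = rel_basisD[OF b]
  have zero: "\<And>c i. (\<Sum>i\<in>I. scale (c i) (e i)) = 0 \<Longrightarrow> i \<in> I \<Longrightarrow> c i = 0" using bb(7) by blast
  show inj: "inj_on e I"
  proof (rule inj_onI, rule ccontr)
    fix i j assume ij: "i \<in> I" "j \<in> I" "e i = e j" "i \<noteq> j"
    define c :: "'c \<Rightarrow> 'a" where "c k = (if k = i then 1 else if k = j then -1 else 0)" for k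
    have "(\<Sum>k\<in>I. scale (c k) (e k)) = (\<Sum>k\<in>{i, j}. scale (c k) (e k))"
      using ij bb(1) by (intro sum.mono_neutral_right) (auto simp: c_def)
    also have "\<dots> = 0" using ij by (simp add: c_def)
    finally have "c i = 0" using zero ij(1) by blast
    then show False by (simp add: c_def)
  qed
  show "independent (e ` I)"
  proof
    assume "dependent (e ` I)"
    then obtain u where u: "\<exists>v\<in>e ` I. u v \<noteq> 0" "(\<Sum>v\<in>e ` I. scale (u v) v) = 0"
      using dependent_finite[of "e ` I"] bb(1) by auto
    have "(\<Sum>i\<in>I. scale (u (e i)) (e i)) = 0" using u(2) inj by (simp add: sum.reindex)
    then have "\<forall>i\<in>I. u (e i) = 0" using zero[of "\<lambda>i. u (e i)"] by blast
    then show False using u(1) by blast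
  qed
  show "span (e ` I) = W"
  proof (rule span_subspace)
    show "e ` I \<subseteq> W" using bb(5) by blast
    show "subspace W" by (rule bb(3))
    show "W \<subseteq> span (e ` I)"
    proof
      fix w assume "w \<in> W"
      then obtain c where c: "w = (\<Sum>i\<in>I. scale (c i) (e i))" using bb(6) by fastforce
      show "w \<in> span (e ` I)" unfolding c by (intro span_sum span_scale span_base imageI)
    qed
  qed
qed

lemma trace_on_basis:
  assumes b: "rel_basis I e {0} W" and f: "lin_on W W f"
    and M: "\<And>i. i \<in> I \<Longrightarrow> f (e i) = (\<Sum>j\<in>I. scale (M i j) (e j))"
  shows "trace_on scale W f = (\<Sum>i\<in>I. M i i)"
proof -
  note s = rel_basis_zero_span[OF b] and bb = rel_basisD[OF b]
  let ?R = "representation (e ` I)"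
  have "trace_on scale W f = (\<Sum>b\<in>e ` I. ?R (f b) b)"
    using s bb(1) f by (intro trace_on_eq) (auto simp: lin_on_def)
  also have "\<dots> = (\<Sum>i\<in>I. ?R (f (e i)) (e i))" using s(1) by (simp add: sum.reindex)
  also have "\<dots> = (\<Sum>i\<in>I. M i i)"
  proof (rule sum.cong[OF refl])
    fix i assume i: "i \<in> I"
    have "?R (f (e i)) = (\<lambda>b. \<Sum>j\<in>I. ?R (scale (M i j) (e j)) b)"
      unfolding M[OF i] using s(2) by (intro representation_sum) (auto intro: span_scale span_base)
    then have "?R (f (e i)) (e i) = (\<Sum>j\<in>I. M i j * ?R (e j) (e i))"
      using s(2) by (simp add: representation_scale span_base)
    also have "\<dots> = (\<Sum>j\<in>I. if j = i then M i j else 0)"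
      using s(1,2) i by (intro sum.cong) (auto simp: representation_basis dest: inj_onD)
    finally show "?R (f (e i)) (e i) = M i i" using i bb(1) by simp
  qed
  finally show ?thesis .
qed

lemma fin_dim_basis:
  assumes "fin_dim W"
  obtains B where "rel_basis B (\<lambda>x. x) {0} W"
proof -
  have "{0} \<subseteq> W" using assms span_zero unfolding fin_dim_def by auto
  then show thesis using rel_basis_exists[OF assms subspace_single_0] that by blast
qed

lemma rel_basis_coords:
  assumes "rel_basis I e {0} W"
  shows "\<exists>c. \<forall>w\<in>W. w = (\<Sum>i\<in>I. scale (c w i) (e i))"
proof (rule bchoice, rule ballI)
  fix w assume "w \<in> W"
  then obtain c where "w - (\<Sum>i\<in>I. scale (c i) (e i)) \<in> {0}" using rel_basisD(6)[OF assms] by blast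
  then show "\<exists>c. w = (\<Sum>i\<in>I. scale (c i) (e i))" by auto
qed

text \<open>
  A basis of \<open>U\<close> together with the \<open>e i\<close> is a basis of \<open>W\<close> with respect to which \<open>f\<close> is block
  triangular, with \<open>M\<close> as the block for the quotient.
\<close>

lemma trace_on_rel_basis:
  assumes b: "rel_basis I e U W" and U: "fin_dim U"
    and fW: "lin_on W W f" and fU: "lin_on U U f"
    and M: "\<And>i. i \<in> I \<Longrightarrow> f (e i) - (\<Sum>j\<in>I. scale (M i j) (e j)) \<in> U"
  shows "trace_on scale W f = trace_on scale U f + (\<Sum>i\<in>I. M i i)"
proof -
  obtain B where B: "rel_basis B (\<lambda>x. x) {0} U" using fin_dim_basis[OF U] .
  define E where "E = (\<lambda>x. case x of Inl b \<Rightarrow> b | Inr i \<Rightarrow> e i)"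
  have "rel_basis (Inl ` B) E {0} U"
    using rel_basis_reindex[of B E Inl] B by (simp add: E_def)
  moreover have "rel_basis (Inr ` I) E U W"
    using rel_basis_reindex[of I E Inr] b by (simp add: E_def)
  ultimately have E: "rel_basis (Inl ` B \<union> Inr ` I) E {0} W"
    by (rule rel_basis_chain) auto
  have finB: "finite B" "finite I" using rel_basisD(1)[OF B] rel_basisD(1)[OF b] by auto
  obtain c where c: "\<And>u. u \<in> U \<Longrightarrow> u = (\<Sum>b\<in>B. scale (c u b) b)"
    using rel_basis_coords[OF B] by blast
  define N where "N = (\<lambda>x y. case x of Inl b \<Rightarrow> (case y of Inl b' \<Rightarrow> c (f b) b' | Inr j \<Rightarrow> 0)
     | Inr i \<Rightarrow> (case y of Inl b' \<Rightarrow> c (f (e i) - (\<Sum>j\<in>I. scale (M i j) (e j))) b' | Inr j \<Rightarrow> M i j))"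
  have sum: "(\<Sum>y\<in>Inl ` B \<union> Inr ` I. scale (h y) (E y)) =
      (\<Sum>b\<in>B. scale (h (Inl b)) b) + (\<Sum>i\<in>I. scale (h (Inr i)) (e i))" for h
    using finB by (subst sum.union_disjoint) (auto simp: sum.reindex E_def)
  have "trace_on scale W f = (\<Sum>x\<in>Inl ` B \<union> Inr ` I. N x x)"
  proof (rule trace_on_basis[OF E fW, of N])
    fix x assume "x \<in> Inl ` B \<union> Inr ` I"
    then show "f (E x) = (\<Sum>y\<in>Inl ` B \<union> Inr ` I. scale (N x y) (E y))"
    proof
      assume "x \<in> Inl ` B"
      then obtain b where b: "b \<in> B" "x = Inl b" by blast
      then have "f b \<in> U" using rel_basisD(5)[OF B] fU lin_on_in by blast
      then show ?thesis unfolding sum by (simp add: N_def E_def b c[symmetric])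
    next
      assume "x \<in> Inr ` I"
      then obtain i where i: "i \<in> I" "x = Inr i" by blast
      show ?thesis unfolding sum by (simp add: N_def E_def i c[OF M[OF i(1)], symmetric])
    qed
  qed
  also have "\<dots> = (\<Sum>b\<in>B. N (Inl b) (Inl b)) + (\<Sum>i\<in>I. N (Inr i) (Inr i))"
    using finB by (subst sum.union_disjoint) (auto simp: sum.reindex)
  also have "(\<Sum>b\<in>B. N (Inl b) (Inl b)) = trace_on scale U f"
    using c rel_basisD(5)[OF B] fU unfolding N_def
    by (subst trace_on_basis[OF B fU, of "\<lambda>b. c (f b)"]) (auto dest: lin_on_in)
  finally show ?thesis by (simp add: N_def)
qed

lemma trace_on_conj:
  assumes W: "fin_dim W" and g: "lin_on W W' g" "bij_betw g W W'"
    and f: "lin_on W W f" and f': "lin_on W' W' f'"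
    and eq: "\<And>w. w \<in> W \<Longrightarrow> f' (g w) = g (f w)"
  shows "trace_on scale W' f' = trace_on scale W f"
proof -
  obtain B where B: "rel_basis B (\<lambda>x. x) {0} W" using fin_dim_basis[OF W] .
  note bb = rel_basisD[OF B]
  obtain c where c: "\<And>u. u \<in> W \<Longrightarrow> u = (\<Sum>b\<in>B. scale (c u b) b)"
    using rel_basis_coords[OF B] by blast
  have W'_eq: "g ` W = W'" using g(2) by (rule bij_betw_imp_surj_on)
  have subW': "subspace W'" using lin_on_subspace_image[OF g(1) bb(3)] W'_eq by simp
  have B': "rel_basis B g {0} W'"
  proof (rule rel_basis_push[OF B g(1) subW' subspace_single_0])
    show "{0} \<subseteq> W'" using subspace_0[OF subW'] by simp
    fix w assume "w \<in> W"
    then show "g w \<in> {0} \<longleftrightarrow> w \<in> {0}"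
      using bij_betw_imp_inj_on[OF g(2)] lin_on_0[OF g(1) bb(3)] subspace_0[OF bb(3)]
      by (metis inj_onD singletonD singletonI)
  next
    show "\<And>z. z \<in> W' \<longleftrightarrow> (\<exists>w\<in>W. z - g w \<in> {0})" using W'_eq by auto
  qed
  have "trace_on scale W' f' = (\<Sum>b\<in>B. c (f b) b)"
  proof (rule trace_on_basis[OF B' f', of "\<lambda>b. c (f b)"])
    fix b assume b: "b \<in> B"
    have "f b \<in> W" using bb(5)[OF b] f lin_on_in by blast
    then have "g (f b) = g (\<Sum>b'\<in>B. scale (c (f b) b') b')" by (intro arg_cong[of _ _ g] c)
    also have "\<dots> = (\<Sum>b'\<in>B. scale (c (f b) b') (g b'))"
      using bb(5) by (intro lin_on_comb[OF g(1) bb(3)]) auto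
    finally show "f' (g b) = (\<Sum>b'\<in>B. scale (c (f b) b') (g b'))" using eq bb(5)[OF b] by simp
  qed
  also have "\<dots> = trace_on scale W f"
    using bb(5) f lin_on_in by (intro trace_on_basis[OF B f, of "\<lambda>b. c (f b)", symmetric] c) blast
  finally show ?thesis .
qed

lemma trace_on_id:
  assumes "fin_dim W" "\<And>w. w \<in> W \<Longrightarrow> f w = w"
  shows "trace_on scale W f = of_nat (dim W)"
proof -
  obtain B where B: "rel_basis B (\<lambda>x. x) {0} W" using fin_dim_basis[OF assms(1)] .
  note s = rel_basis_zero_span[OF B] and bb = rel_basisD[OF B]
  have "trace_on scale W f = (\<Sum>b\<in>B. (if b = b then 1 else 0))"
    using assms(2) bb(1,5)
    by (intro trace_on_basis[OF B, of f "\<lambda>b b'. if b = b' then 1 else 0"])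
       (auto simp: lin_on_def bb(3) subspace_add subspace_scale if_distrib[of "\<lambda>x. scale x _"] cong: if_cong)
  also have "\<dots> = of_nat (card B)" by simp
  also have "card B = dim W" using s(2,3) by (metis dim_span dim_eq_card_independent image_ident)
  finally show ?thesis .
qed

lemma trace_on_sum:
  assumes W: "fin_dim W" and f: "\<And>k. k \<in> K \<Longrightarrow> lin_on W W (f k)"
  shows "trace_on scale W (\<lambda>v. \<Sum>k\<in>K. f k v) = (\<Sum>k\<in>K. trace_on scale W (f k))"
proof -
  obtain B where B: "rel_basis B (\<lambda>x. x) {0} W" using fin_dim_basis[OF W] .
  note bb = rel_basisD[OF B]
  obtain c where c: "\<And>u. u \<in> W \<Longrightarrow> u = (\<Sum>b\<in>B. scale (c u b) b)"
    using rel_basis_coords[OF B] by blast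
  have lin: "lin_on W W (\<lambda>v. \<Sum>k\<in>K. f k v)"
    unfolding lin_on_def
  proof (intro conjI ballI allI)
    show "(\<Sum>k\<in>K. f k v) \<in> W" if "v \<in> W" for v
      using bb(3) lin_on_in[OF f that] by (rule subspace_sum)
    show "(\<Sum>k\<in>K. f k (v + w)) = (\<Sum>k\<in>K. f k v) + (\<Sum>k\<in>K. f k w)" if "v \<in> W" "w \<in> W" for v w
      using lin_on_add[OF f that] by (simp add: sum.distrib)
    show "(\<Sum>k\<in>K. f k (scale c v)) = scale c (\<Sum>k\<in>K. f k v)" if "v \<in> W" for c v
      using lin_on_scale[OF f that] by (simp add: scale_sum_right)
  qed
  have "trace_on scale W (\<lambda>v. \<Sum>k\<in>K. f k v) = (\<Sum>b\<in>B. \<Sum>k\<in>K. c (f k b) b)"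
  proof (rule trace_on_basis[OF B lin, of "\<lambda>b b'. \<Sum>k\<in>K. c (f k b) b'"])
    fix b assume b: "b \<in> B"
    have "(\<Sum>k\<in>K. f k b) = (\<Sum>k\<in>K. \<Sum>b'\<in>B. scale (c (f k b) b') b')"
      using lin_on_in[OF f bb(5)[OF b]] by (intro sum.cong refl c)
    also have "\<dots> = (\<Sum>b'\<in>B. scale (\<Sum>k\<in>K. c (f k b) b') b')"
      by (subst sum.swap) (simp add: scale_sum_left)
    finally show "(\<Sum>k\<in>K. f k b) = (\<Sum>b'\<in>B. scale (\<Sum>k\<in>K. c (f k b) b') b')" .
  qed
  also have "\<dots> = (\<Sum>k\<in>K. \<Sum>b\<in>B. c (f k b) b)" by (rule sum.swap)
  also have "\<dots> = (\<Sum>k\<in>K. trace_on scale W (f k))"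
  proof (rule sum.cong[OF refl])
    fix k assume k: "k \<in> K"
    show "(\<Sum>b\<in>B. c (f k b) b) = trace_on scale W (f k)"
      using bb(5) lin_on_in[OF f[OF k]]
      by (intro trace_on_basis[OF B f[OF k], of "\<lambda>b. c (f k b)", symmetric] c) blast
  qed
  finally show ?thesis .
qed

text \<open>
  The map \<open>q\<close> is multiplication by \<open>m\<close> on its image and sends everything else into the image, so that its
  trace is \<open>m\<close> times the dimension of the image. In the application, \<open>q\<close> is a sum over the powers of a
  permutation, not yet divided by their number \<open>m\<close>.
\<close>

lemma trace_on_idempotent:
  assumes W: "fin_dim W" and q: "lin_on W W q" and idem: "\<And>w. w \<in> W \<Longrightarrow> q (q w) = scale m (q w)"
  shows "\<exists>d::nat. trace_on scale W q = m * of_nat d"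
proof -
  have sW: "subspace W" using W unfolding fin_dim_def by auto
  have U: "subspace (q ` W)" "q ` W \<subseteq> W" using lin_on_subspace_image[OF q sW] q lin_on_in by blast+
  have finU: "fin_dim (q ` W)" using fin_dim_subspace[OF W U] .
  obtain L where L: "rel_basis L (\<lambda>x. x) (q ` W) W" using rel_basis_exists[OF W U] by blast
  obtain B where B: "rel_basis B (\<lambda>x. x) {0} (q ` W)" using fin_dim_basis[OF finU] .
  have qU: "lin_on (q ` W) (q ` W) q" using U(2) by (intro lin_on_subset[OF q]) auto
  have "trace_on scale W q = trace_on scale (q ` W) q + (\<Sum>i\<in>L. 0)"
    using rel_basisD(5)[OF L] by (intro trace_on_rel_basis[OF L finU q qU, of "\<lambda>_ _. 0"]) simp
  also have "trace_on scale (q ` W) q = (\<Sum>b\<in>B. if b = b then m else 0)"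
  proof (rule trace_on_basis[OF B qU, of "\<lambda>b b'. if b = b' then m else 0"])
    fix b assume b: "b \<in> B"
    have "q b = scale m b" using rel_basisD(5)[OF B b] idem by auto
    also have "\<dots> = (\<Sum>b'\<in>B. if b = b' then scale m b' else 0)" using b rel_basisD(1)[OF B] by simp
    also have "\<dots> = (\<Sum>b'\<in>B. scale (if b = b' then m else 0) b')" by (intro sum.cong) auto
    finally show "q b = (\<Sum>b'\<in>B. scale (if b = b' then m else 0) b')" .
  qed
  also have "(\<Sum>b\<in>B. if b = b then m else 0) = m * of_nat (card B)" by simp
  finally have "trace_on scale W q = m * of_nat (card B)" by simp
  then show ?thesis ..
qed

text \<open>
  Coordinates with a prescribed support: they are needed to see that certain diagonal entries of a
  matrix vanish.
\<close>

lemma span_image_coords: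
  assumes I: "finite I" "J \<subseteq> I" and x: "x \<in> span (e ` J)"
  shows "\<exists>c. x = (\<Sum>i\<in>I. scale (c i) (e i)) \<and> (\<forall>i. c i \<noteq> 0 \<longrightarrow> i \<in> J)"
  using x
proof (induction rule: span_induct_alt)
  case base
  show ?case by (rule exI[of _ "\<lambda>_. 0"]) simp
next
  case (step a x y)
  then obtain c j where c: "y = (\<Sum>i\<in>I. scale (c i) (e i))" "\<And>i. c i \<noteq> 0 \<Longrightarrow> i \<in> J"
    and j: "j \<in> J" "x = e j" by blast
  define c' where "c' i = (if i = j then a else 0) + c i" for i
  have "(\<Sum>i\<in>I. scale (if i = j then a else 0) (e i)) = (\<Sum>i\<in>I. if i = j then scale a (e j) else 0)"
    by (intro sum.cong) auto
  also have "\<dots> = scale a x" using I j by auto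
  finally have "scale a x + y = (\<Sum>i\<in>I. scale (c' i) (e i))"
    unfolding c'_def c(1) by (simp add: scale_left_distrib sum.distrib)
  moreover have "\<forall>i. c' i \<noteq> 0 \<longrightarrow> i \<in> J" unfolding c'_def using c(2) j(1) by auto
  ultimately show ?case by blast
qed

end

section \<open>Induced maps and boundaries\<close>

locale fi_space = lin_space scale + fi_module scale V act
  for scale :: "'k::field \<Rightarrow> 'v::ab_group_add \<Rightarrow> 'v" and V act
begin

text \<open>
  The map induced by an injection on \<open>S\<close>, whatever values the function takes outside \<open>S\<close>; this
  avoids restrictions in compositions.
\<close>

definition push :: "nat set \<Rightarrow> nat set \<Rightarrow> (nat \<Rightarrow> nat) \<Rightarrow> 'v \<Rightarrow> 'v" where
  "push S T f v = act S T (restrict f S) v"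

lemma push_eq_act: "push S T f = act S T (restrict f S)"
  by (simp add: push_def fun_eq_iff)

lemma restrict_FI_hom: "inj_on f S \<Longrightarrow> f ` S \<subseteq> T \<Longrightarrow> restrict f S \<in> FI_hom S T"
  by (auto simp: FI_hom_def inj_on_def)

lemma push_lin:
  assumes "finite S" "finite T" "inj_on f S" "f ` S \<subseteq> T"
  shows "lin_on (V S) (V T) (push S T f)"
  unfolding lin_on_def push_def using restrict_FI_hom[OF assms(3,4)] assms
  by (simp add: act_in act_add act_scale)

lemmas push_in = lin_on_in[OF push_lin]

lemma push_comp:
  assumes "finite S" "finite T" "finite U" "inj_on f S" "f ` S \<subseteq> T" "inj_on g T" "g ` T \<subseteq> U" "v \<in> V S"
  shows "push T U g (push S T f v) = push S U (\<lambda>x. g (f x)) v"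
proof -
  have "compose S (restrict g T) (restrict f S) = restrict (\<lambda>x. g (f x)) S"
    using assms(5) by (auto simp: compose_def fun_eq_iff)
  then show ?thesis unfolding push_def
    using act_compose[OF assms(1-3) restrict_FI_hom[OF assms(4,5)] restrict_FI_hom[OF assms(6,7)] assms(8)]
    by simp
qed

lemma push_cong:
  assumes "\<And>x. x \<in> S \<Longrightarrow> f x = g x"
  shows "push S T f = push S T g"
  unfolding push_def using assms by (metis restrict_ext)

lemma push_id:
  assumes "finite S" "v \<in> V S" "\<And>x. x \<in> S \<Longrightarrow> f x = x"
  shows "push S S f v = v"
proof -
  have "restrict f S = (\<lambda>x\<in>S. x)" using assms(3) by (auto simp: restrict_def)
  then show ?thesis unfolding push_def using act_id[OF assms(1,2)] by simp
qed

abbreviation incl :: "nat set \<Rightarrow> nat set \<Rightarrow> 'v \<Rightarrow> 'v" where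
  "incl S T \<equiv> push S T (\<lambda>x. x)"

definition boundary :: "nat set \<Rightarrow> nat set \<Rightarrow> 'v set" where
  "boundary S B = span (\<Union>b\<in>B. incl (S - {b}) S ` V (S - {b}))"

lemma boundary_subspace [simp]: "subspace (boundary S B)"
  by (simp add: boundary_def)

lemma boundary_gens_V:
  assumes "finite S"
  shows "(\<Union>b\<in>B. incl (S - {b}) S ` V (S - {b})) \<subseteq> V S"
  using assms by (auto intro!: push_in)

lemma boundary_sub: "finite S \<Longrightarrow> boundary S B \<subseteq> V S"
  unfolding boundary_def using boundary_gens_V subspace_V by (intro span_minimal)

lemma boundary_empty [simp]: "boundary S {} = {0}"
  by (simp add: boundary_def)

lemma boundary_incl: "b \<in> B \<Longrightarrow> v \<in> V (S - {b}) \<Longrightarrow> incl (S - {b}) S v \<in> boundary S B"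
  unfolding boundary_def by (intro span_base) blast

lemma push_boundary:
  assumes S: "finite S" "finite T" and f: "inj_on f S" "f ` S \<subseteq> T" and B: "B \<subseteq> S"
    and v: "v \<in> boundary S B"
  shows "push S T f v \<in> boundary T (f ` B)"
proof (rule lin_on_span_subset[OF push_lin[OF S f] subspace_V[OF S(1)] boundary_gens_V[OF S(1)] _ boundary_subspace v[unfolded boundary_def]])
  fix x assume "x \<in> (\<Union>b\<in>B. incl (S - {b}) S ` V (S - {b}))"
  then obtain b w where b: "b \<in> B" and w: "w \<in> V (S - {b})" and x: "x = incl (S - {b}) S w" by blast
  have inj: "inj_on f (S - {b})" using f(1) by (rule inj_on_subset) blast
  have im: "f ` (S - {b}) \<subseteq> T - {f b}" using f b B by (auto dest: inj_onD)
  have "push S T f x = push (S - {b}) T f w"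
    unfolding x using S f w by (intro push_comp) auto
  also have "\<dots> = incl (T - {f b}) T (push (S - {b}) (T - {f b}) f w)"
    using S inj im w by (intro push_comp[symmetric]) auto
  finally show "push S T f x \<in> boundary T (f ` B)"
    using b push_in[OF _ _ inj im w] S by (auto intro!: boundary_incl)
qed

lemma boundary_insert:
  assumes "finite S" "x \<notin> S"
  shows "z \<in> boundary (insert x S) (insert x B) \<longleftrightarrow> (\<exists>w\<in>V S. z - incl S (insert x S) w \<in> boundary (insert x S) B)"
proof -
  let ?X = "\<Union>b\<in>B. incl (insert x S - {b}) (insert x S) ` V (insert x S - {b})"
  have sub: "subspace (incl S (insert x S) ` V S)"
    using assms by (intro lin_on_subspace_image[OF push_lin] subspace_V) auto
  have "insert x S - {x} = S" using assms by auto
  then have "boundary (insert x S) (insert x B) = span (incl S (insert x S) ` V S \<union> ?X)"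
    by (simp add: boundary_def)
  also have "\<dots> = {a + b |a b. a \<in> span (incl S (insert x S) ` V S) \<and> b \<in> span ?X}"
    by (rule span_Un)
  also have "\<dots> = {a + b |a b. a \<in> incl S (insert x S) ` V S \<and> b \<in> boundary (insert x S) B}"
    unfolding boundary_def span_eq_iff[THEN iffD2, OF sub] by (rule refl)
  finally have eq: "boundary (insert x S) (insert x B) =
    {a + b |a b. a \<in> incl S (insert x S) ` V S \<and> b \<in> boundary (insert x S) B}" .
  show ?thesis
  proof
    assume "z \<in> boundary (insert x S) (insert x B)"
    then show "\<exists>w\<in>V S. z - incl S (insert x S) w \<in> boundary (insert x S) B" unfolding eq by force
  next
    assume "\<exists>w\<in>V S. z - incl S (insert x S) w \<in> boundary (insert x S) B"
    then obtain w where w: "w \<in> V S" "z - incl S (insert x S) w \<in> boundary (insert x S) B" by blast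
    have "z = incl S (insert x S) w + (z - incl S (insert x S) w)" by simp
    then show "z \<in> boundary (insert x S) (insert x B)" unfolding eq using w by blast
  qed
qed

text \<open>
  The images of the generators span a sub-FI-module. The generators are listed because monomials
  will be ordered by the position of their generator first.
\<close>

lemma fin_gen_spanning:
  assumes "finitely_generated"
  obtains gs :: "(nat \<times> 'v) list"
  where "\<And>m g. (m, g) \<in> set gs \<Longrightarrow> g \<in> V {1..m}"
    and "\<And>S. finite S \<Longrightarrow>
      V S = span {push {1..m} S f g |m g f. (m, g) \<in> set gs \<and> inj_on f {1..m} \<and> f ` {1..m} \<subseteq> S}"
proof -
  obtain \<Sigma> where \<Sigma>: "finite \<Sigma>" "\<Sigma> \<subseteq> (SIGMA n:UNIV. V {1..n})"
    and gen: "\<And>W. sub_fi_module W \<Longrightarrow> (\<forall>(n, v)\<in>\<Sigma>. v \<in> W {1..n}) \<Longrightarrow> (\<forall>S. finite S \<longrightarrow> W S = V S)"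
    using assms unfolding finitely_generated_def by metis
  obtain gs where gs: "set gs = \<Sigma>" using finite_list[OF \<Sigma>(1)] by blast
  define G where "G S = {push {1..m} S f g |m g f. (m, g) \<in> set gs \<and> inj_on f {1..m} \<and> f ` {1..m} \<subseteq> S}" for S
  have gV: "g \<in> V {1..m}" if "(m, g) \<in> set gs" for m g using that gs \<Sigma>(2) by blast
  have G_V: "G S \<subseteq> V S" if "finite S" for S
    unfolding G_def using gV that by (auto intro!: push_in)
  have closed: "act S U f v \<in> span (G U)"
    if SU: "finite S" "finite U" and f: "f \<in> FI_hom S U" and v: "v \<in> span (G S)" for S U f v
  proof -
    have f': "inj_on f S" "f ` S \<subseteq> U" "restrict f S = f"
      using f by (auto simp: FI_hom_def)
    have "push S U f v \<in> span (G U)"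
    proof (rule lin_on_span_subset[OF push_lin[OF SU f'(1,2)] subspace_V[OF SU(1)] G_V[OF SU(1)] _ subspace_span v])
      fix x assume "x \<in> G S"
      then obtain m g h where h: "(m, g) \<in> set gs" "inj_on h {1..m}" "h ` {1..m} \<subseteq> S" "x = push {1..m} S h g"
        unfolding G_def by blast
      have "push S U f x = push {1..m} U (\<lambda>y. f (h y)) g"
        unfolding h(4) using SU h f' gV[OF h(1)] by (intro push_comp) auto
      moreover have "inj_on (\<lambda>y. f (h y)) {1..m}"
        using comp_inj_on[OF h(2) inj_on_subset[OF f'(1) h(3)]] by (simp add: comp_def)
      moreover have "(\<lambda>y. f (h y)) ` {1..m} \<subseteq> U" using h f' by blast
      ultimately have "push S U f x \<in> G U" unfolding G_def using h(1) by blast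
      then show "push S U f x \<in> span (G U)" by (rule span_base)
    qed
    then show ?thesis by (simp add: push_def f')
  qed
  have "sub_fi_module (\<lambda>S. span (G S))"
    unfolding sub_fi_module_def using closed span_minimal[OF G_V subspace_V] by simp
  moreover have "v \<in> span (G {1..n})" if nv: "(n, v) \<in> \<Sigma>" for n v
  proof -
    have "v = push {1..n} {1..n} (\<lambda>x. x) v" using gV nv gs by (intro push_id[symmetric]) auto
    then have "v \<in> G {1..n}" unfolding G_def using nv gs by (force simp: inj_on_def)
    then show ?thesis by (rule span_base)
  qed
  ultimately have "V S = span (G S)" if "finite S" for S using gen that by blast
  then show thesis using that gV unfolding G_def by blast
qed

end

section \<open>Dickson's lemma and stretching maps\<close>

lemma incseq_subseq_nat:
  fixes f :: "nat \<Rightarrow> nat"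
  shows "\<exists>r. strict_mono r \<and> incseq (\<lambda>n. f (r n))"
proof -
  obtain r where r: "strict_mono r" "monoseq (\<lambda>n. f (r n))" using seq_monosub[of f] by blast
  show ?thesis
  proof (cases "incseq (\<lambda>n. f (r n))")
    case False
    then have dec: "decseq (\<lambda>n. f (r n))" using r(2) by (simp add: monoseq_iff)
    obtain k where k: "\<And>n. f (r k) \<le> f (r n)"
      using ex_has_least_nat[of "\<lambda>_. True" 0 "\<lambda>n. f (r n)"] by blast
    have "f (r (n + k)) = f (r k)" for n
      using k[of "n + k"] decseqD[OF dec, of k "n + k"] by simp
    then show ?thesis using r(1)
      by (intro exI[of _ "\<lambda>n. r (n + k)"]) (auto simp: incseq_def strict_mono_def)
  qed (use r in blast)
qed

text \<open>
  A form of Dickson's lemma: in a sequence of points with finitely many statistics in the natural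
  numbers, all statistics become increasing along some subsequence.
\<close>

lemma dickson_subseq:
  fixes x :: "nat \<Rightarrow> 'a"
  assumes "finite \<Phi>"
  shows "\<exists>r. strict_mono r \<and> (\<forall>\<phi>\<in>\<Phi>. incseq (\<lambda>n. \<phi> (x (r n)) :: nat))"
  using assms
proof (induction \<Phi> rule: finite_induct)
  case empty
  show ?case by (rule exI[of _ "\<lambda>n. n"]) (simp add: strict_mono_def)
next
  case (insert \<phi> \<Phi>)
  then obtain r where r: "strict_mono r" "\<And>\<psi>. \<psi> \<in> \<Phi> \<Longrightarrow> incseq (\<lambda>n. \<psi> (x (r n)))" by blast
  obtain s where s: "strict_mono s" "incseq (\<lambda>n. \<phi> (x (r (s n))))"
    using incseq_subseq_nat[of "\<lambda>n. \<phi> (x (r n))"] by blast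
  have "strict_mono (\<lambda>n. r (s n))" using r(1) s(1) by (simp add: strict_mono_def)
  moreover have "incseq (\<lambda>n. \<psi> (x (r (s n))))" if "\<psi> \<in> \<Phi>" for \<psi>
    using r(2)[OF that] s(1) by (auto simp: incseq_def strict_mono_less_eq)
  ultimately show ?case using s(2) by (intro exI[of _ "\<lambda>n. r (s n)"]) auto
qed

text \<open>
  A point is shifted by the largest displacement \<open>q' u - q u\<close> of the marked points at or before it, so
  that \<open>h\<close> is strictly increasing. The \<open>Suc\<close> in the gap condition distinguishes \<open>q u \<le> q v\<close> from
  \<open>q u > q v\<close> in spite of truncated subtraction; in particular it makes marked points that coincide
  move together.
\<close>

lemma stretch_exists:
  fixes q q' :: "nat \<Rightarrow> nat"
  assumes N: "N \<le> N'"
    and q: "\<And>u. u < p \<Longrightarrow> q u \<in> {1..N}" and q': "\<And>u. u < p \<Longrightarrow> q' u \<in> {1..N'}"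
    and left: "\<And>u. u < p \<Longrightarrow> q u \<le> q' u" and right: "\<And>u. u < p \<Longrightarrow> N - q u \<le> N' - q' u"
    and gap: "\<And>u v. u < p \<Longrightarrow> v < p \<Longrightarrow> Suc (q v) - q u \<le> Suc (q' v) - q' u"
  shows "\<exists>h. strict_mono_on {1..N} h \<and> h ` {1..N} \<subseteq> {1..N'} \<and> (\<forall>u<p. h (q u) = q' u)"
proof -
  define D where "D x = insert 0 ((\<lambda>u. q' u - q u) ` {u. u < p \<and> q u \<le> x})" for x
  define h where "h x = x + Max (D x)" for x
  have D: "finite (D x)" "D x \<noteq> {}" for x by (auto simp: D_def)
  have "strict_mono_on {1..N} h"
  proof (rule strict_mono_onI)
    fix x y :: nat assume "x < y"
    then have "D x \<subseteq> D y" by (auto simp: D_def)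
    then have "Max (D x) \<le> Max (D y)" using D by (intro Max_mono)
    then show "h x < h y" using \<open>x < y\<close> by (simp add: h_def)
  qed
  moreover have "h ` {1..N} \<subseteq> {1..N'}"
  proof clarify
    fix x assume x: "x \<in> {1..N}"
    have "Max (D x) \<in> D x" using D by (rule Max_in)
    then have "Max (D x) = 0 \<or> (\<exists>u. u < p \<and> q u \<le> x \<and> Max (D x) = q' u - q u)"
      by (subst (asm) (2) D_def) blast
    then consider "Max (D x) = 0" | u where "u < p" "q u \<le> x" "Max (D x) = q' u - q u"
      by metis
    then show "h x \<in> {1..N'}"
    proof cases
      case 1
      then show ?thesis using x N by (simp add: h_def)
    next
      case 2
      then show ?thesis using x left[OF 2(1)] right[OF 2(1)] q[OF 2(1)] q'[OF 2(1)]
        by (simp add: h_def) linarith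
    qed
  qed
  moreover have "h (q u) = q' u" if u: "u < p" for u
  proof -
    have "Max (D (q u)) = q' u - q u"
    proof (rule Max_eqI[OF D(1)])
      fix y assume "y \<in> D (q u)"
      then consider "y = 0" | v where "v < p" "q v \<le> q u" "y = q' v - q v" unfolding D_def by blast
      then show "y \<le> q' u - q u"
      proof cases
        case 2
        then show ?thesis using gap[OF 2(1) u] left[OF u] left[OF 2(1)] by linarith
      qed simp
    next
      show "q' u - q u \<in> D (q u)" using u by (auto simp: D_def)
    qed
    then show ?thesis using left[OF u] by (simp add: h_def)
  qed
  ultimately show ?thesis by blast
qed

lemma map_strict_mono_less:
  fixes xs ys :: "nat list"
  assumes "strict_mono_on A h" "set xs \<subseteq> A" "set ys \<subseteq> A" "xs < ys"
  shows "map h xs < map h ys"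
  using assms(2-)
proof (induction xs arbitrary: ys)
  case Nil
  then show ?case by (cases ys) auto
next
  case (Cons a xs)
  then obtain b ys' where ys: "ys = b # ys'" by (cases ys) auto
  then show ?case using Cons strict_mono_onD[OF assms(1), of a b] by auto
qed

section \<open>Leading monomials and the vanishing of torsion\<close>

context fi_space
begin

text \<open>
  The monomial \<open>(j, l)\<close> is the image of the \<open>j\<close>-th generator under the injection \<open>i \<mapsto> l ! (i - 1)\<close>.
  Monomials are compared lexicographically, and strictly increasing maps preserve this order.
\<close>

definition monomials :: "(nat \<times> 'v) list \<Rightarrow> nat set \<Rightarrow> (nat \<times> nat list) set" where
  "monomials gs S = {(j, l). j < length gs \<and> length l = fst (gs ! j) \<and> distinct l \<and> set l \<subseteq> S}"

definition monomial_vec :: "(nat \<times> 'v) list \<Rightarrow> nat set \<Rightarrow> nat \<times> nat list \<Rightarrow> 'v" where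
  "monomial_vec gs S m = push {1..fst (gs ! fst m)} S (\<lambda>i. snd m ! (i - 1)) (snd (gs ! fst m))"

text \<open>
  The monomial \<open>m\<close> is redundant modulo the boundary if its vector lies in this subspace.
\<close>

definition lower_span :: "(nat \<times> 'v) list \<Rightarrow> nat \<Rightarrow> nat \<Rightarrow> nat \<times> nat list \<Rightarrow> 'v set" where
  "lower_span gs k N m = span (boundary {1..N} {1..k} \<union> monomial_vec gs {1..N} ` {m' \<in> monomials gs {1..N}. m' < m})"

definition torsion :: "nat \<Rightarrow> nat \<Rightarrow> 'v set" where
  "torsion k N = {v \<in> V {1..N}. incl {1..N} {1..Suc N} v \<in> boundary {1..Suc N} {1..k}}"

lemma monomials_fun:
  assumes "(j, l) \<in> monomials gs S"
  shows "inj_on (\<lambda>i. l ! (i - 1)) {1..fst (gs ! j)}" "(\<lambda>i. l ! (i - 1)) ` {1..fst (gs ! j)} \<subseteq> S"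
proof -
  have l: "length l = fst (gs ! j)" "distinct l" "set l \<subseteq> S" using assms by (auto simp: monomials_def)
  show "inj_on (\<lambda>i. l ! (i - 1)) {1..fst (gs ! j)}"
  proof (rule inj_onI)
    fix x y assume xy: "x \<in> {1..fst (gs ! j)}" "y \<in> {1..fst (gs ! j)}" "l ! (x - 1) = l ! (y - 1)"
    then have "x - 1 = y - 1" using l nth_eq_iff_index_eq[of l "x - 1" "y - 1"] by auto
    then show "x = y" using xy by auto
  qed
  show "(\<lambda>i. l ! (i - 1)) ` {1..fst (gs ! j)} \<subseteq> S"
    using l by (auto intro!: subsetD[OF l(3)] nth_mem)
qed

lemma finite_monomials:
  assumes "finite S"
  shows "finite (monomials gs S)"
proof (rule finite_subset)
  show "monomials gs S \<subseteq> (\<Union>j<length gs. {j} \<times> {l. set l \<subseteq> S \<and> length l = fst (gs ! j)})"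
    by (auto simp: monomials_def)
qed (use assms finite_lists_length_eq in blast)

end

locale fi_gen = fi_space scale V act
  for scale :: "'k::field \<Rightarrow> 'v::ab_group_add \<Rightarrow> 'v" and V act +
  fixes gs :: "(nat \<times> 'v) list"
  assumes gens_V: "\<And>m g. (m, g) \<in> set gs \<Longrightarrow> g \<in> V {1..m}"
    and gens_span: "\<And>S. finite S \<Longrightarrow>
      V S = span {push {1..m} S f g |m g f. (m, g) \<in> set gs \<and> inj_on f {1..m} \<and> f ` {1..m} \<subseteq> S}"
begin

lemma gens_V': "j < length gs \<Longrightarrow> snd (gs ! j) \<in> V {1..fst (gs ! j)}"
  using gens_V[of "fst (gs ! j)" "snd (gs ! j)"] by simp

lemma monomial_vec_V: "finite S \<Longrightarrow> m \<in> monomials gs S \<Longrightarrow> monomial_vec gs S m \<in> V S"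
  unfolding monomial_vec_def using monomials_fun[of "fst m" "snd m" gs S] gens_V'[of "fst m"]
  by (intro push_in) (auto simp: monomials_def)

lemma V_span_monomial_vec:
  assumes "finite S"
  shows "V S = span (monomial_vec gs S ` monomials gs S)"
proof -
  have "{push {1..m} S f g |m g f. (m, g) \<in> set gs \<and> inj_on f {1..m} \<and> f ` {1..m} \<subseteq> S}
      \<subseteq> monomial_vec gs S ` monomials gs S"
  proof clarify
    fix m g f assume g: "(m, g) \<in> set gs" and f: "inj_on f {1..m}" "f ` {1..m} \<subseteq> S"
    obtain j where j: "j < length gs" "gs ! j = (m, g)" using g by (auto simp: in_set_conv_nth)
    have "(j, map f [1..<Suc m]) \<in> monomials gs S"
      using j f by (auto simp: monomials_def distinct_map atLeastLessThanSuc_atLeastAtMost simp del: upt_Suc)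
    moreover have "monomial_vec gs S (j, map f [1..<Suc m]) = push {1..m} S f g"
      unfolding monomial_vec_def using j by (simp del: upt_Suc) (intro fun_cong[OF push_cong], auto simp del: upt_Suc)
    ultimately show "push {1..m} S f g \<in> monomial_vec gs S ` monomials gs S" by force
  qed
  then have "V S \<subseteq> span (monomial_vec gs S ` monomials gs S)"
    unfolding gens_span[OF assms] by (rule span_mono)
  moreover have "span (monomial_vec gs S ` monomials gs S) \<subseteq> V S"
    using assms monomial_vec_V subspace_V by (intro span_minimal) auto
  ultimately show ?thesis by blast
qed

lemma push_monomial_vec:
  assumes "finite S" "finite T" "inj_on h S" "h ` S \<subseteq> T" "(j, l) \<in> monomials gs S"
  shows "(j, map h l) \<in> monomials gs T" "push S T h (monomial_vec gs S (j, l)) = monomial_vec gs T (j, map h l)"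
proof -
  have l: "j < length gs" "length l = fst (gs ! j)" "distinct l" "set l \<subseteq> S" using assms(5) by (auto simp: monomials_def)
  show "(j, map h l) \<in> monomials gs T"
    using l assms(3,4) by (auto simp: monomials_def distinct_map intro: inj_on_subset)
  have "push S T h (monomial_vec gs S (j, l)) = push {1..fst (gs ! j)} T (\<lambda>x. h (l ! (x - 1))) (snd (gs ! j))"
    unfolding monomial_vec_def fst_conv snd_conv
    using assms monomials_fun[OF assms(5)] gens_V'[OF l(1)] by (intro push_comp) auto
  also have "\<dots> = monomial_vec gs T (j, map h l)"
    unfolding monomial_vec_def fst_conv snd_conv using l(2) by (intro fun_cong[OF push_cong]) auto
  finally show "push S T h (monomial_vec gs S (j, l)) = monomial_vec gs T (j, map h l)" .
qed

lemma push_lower_span: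
  assumes kN: "k \<le> N" and h: "strict_mono_on {1..N} h" "h ` {1..N} \<subseteq> {1..N'}"
    and fixk: "\<And>i. i \<in> {1..k} \<Longrightarrow> h i = i" and m: "(j, l) \<in> monomials gs {1..N}" and x: "x \<in> lower_span gs k N (j, l)"
  shows "push {1..N} {1..N'} h x \<in> lower_span gs k N' (j, map h l)"
proof -
  have inj: "inj_on h {1..N}" using h(1) by (rule strict_mono_on_imp_inj_on)
  have hk: "h ` {1..k} = {1..k}" using fixk by force
  show ?thesis
  proof (rule lin_on_span_subset[OF push_lin[OF _ _ inj h(2)] subspace_V _ _ _ x[unfolded lower_span_def]])
    show "boundary {1..N} {1..k} \<union> monomial_vec gs {1..N} ` {m' \<in> monomials gs {1..N}. m' < (j, l)} \<subseteq> V {1..N}"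
      using boundary_sub[of "{1..N}"] monomial_vec_V by auto
    show "subspace (lower_span gs k N' (j, map h l))" by (simp add: lower_span_def)
    fix y assume "y \<in> boundary {1..N} {1..k} \<union> monomial_vec gs {1..N} ` {m' \<in> monomials gs {1..N}. m' < (j, l)}"
    then show "push {1..N} {1..N'} h y \<in> lower_span gs k N' (j, map h l)"
    proof
      assume "y \<in> boundary {1..N} {1..k}"
      then have "push {1..N} {1..N'} h y \<in> boundary {1..N'} (h ` {1..k})"
        using kN inj h(2) by (intro push_boundary) auto
      then show ?thesis unfolding lower_span_def hk by (intro span_base) blast
    next
      assume "y \<in> monomial_vec gs {1..N} ` {m' \<in> monomials gs {1..N}. m' < (j, l)}"
      then obtain j' l' where m': "(j', l') \<in> monomials gs {1..N}" "(j', l') < (j, l)" "y = monomial_vec gs {1..N} (j', l')"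
        by auto
      have "(j', map h l') < (j, map h l)"
        using m' m map_strict_mono_less[OF h(1), of l' l] by (auto simp: less_prod_def' monomials_def)
      then show ?thesis
        using push_monomial_vec[OF _ _ inj h(2) m'(1)] unfolding m'(3) lower_span_def by (intro span_base) auto
    qed
  qed auto
qed

text \<open>
  A map that is not onto extends to one more point, and hence factors through the map that kills
  torsion elements modulo the boundary.
\<close>

lemma push_torsion:
  assumes kN: "k \<le> N" "N < N'" and h: "inj_on h {1..N}" "h ` {1..N} \<subseteq> {1..N'}"
    and fixk: "\<And>i. i \<in> {1..k} \<Longrightarrow> h i = i" and x: "x \<in> torsion k N"
  shows "push {1..N} {1..N'} h x \<in> boundary {1..N'} {1..k}"
proof -
  have "card (h ` {1..N}) < card {1..N'}" using card_image[OF h(1)] kN by simp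
  then obtain z where z: "z \<in> {1..N'}" "z \<notin> h ` {1..N}"
    by (metis finite_atLeastAtMost finite_imageI linorder_not_less card_mono subsetI)
  define h' where "h' = h(Suc N := z)"
  have Suc_N: "{1..Suc N} = insert (Suc N) {1..N}" by auto
  have h'_eq: "h' y = h y" if "y \<in> {1..N}" for y using that by (simp add: h'_def)
  have "inj_on h' {1..N}" using h(1) by (subst inj_on_cong[OF h'_eq]) auto
  moreover have "h' ` {1..N} = h ` {1..N}" using h'_eq by (intro image_cong) auto
  ultimately have h': "inj_on h' {1..Suc N}" "h' ` {1..Suc N} \<subseteq> {1..N'}"
    using h(2) z unfolding Suc_N by (auto simp: h'_def)
  have im: "h' ` {1..k} = {1..k}" using fixk kN by (force simp: h'_def)
  have "push {1..Suc N} {1..N'} h' (incl {1..N} {1..Suc N} x) \<in> boundary {1..N'} (h' ` {1..k})"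
    using x h' kN by (intro push_boundary) (auto simp: torsion_def)
  moreover have "push {1..Suc N} {1..N'} h' (incl {1..N} {1..Suc N} x) = push {1..N} {1..N'} h' x"
    using x h' by (intro push_comp) (auto simp: torsion_def)
  moreover have "push {1..N} {1..N'} h' = push {1..N} {1..N'} h"
    by (intro push_cong) (auto simp: h'_def)
  ultimately show ?thesis unfolding im by simp
qed

text \<open>
  A leading monomial of a torsion element need not be redundant, but this can happen only in
  bounded degree. Otherwise Dickson's lemma, applied to infinitely many exceptions, gives two of
  them such that a strictly increasing map \<open>h\<close>, which fixes \<open>{1..k}\<close> and is not onto, carries the first
  to the second. It kills the torsion element \<open>x\<close> modulo the boundary and respects the order; the relation that shows the
  first monomial to be leading is thus carried to one that shows the second to be redundant.
\<close>

lemma leading_monomials_stable: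
  "\<exists>e. \<forall>N\<ge>e. k \<le> N \<longrightarrow> (\<forall>m\<in>monomials gs {1..N}. \<forall>x\<in>torsion k N.
     monomial_vec gs {1..N} m - x \<in> lower_span gs k N m \<longrightarrow> monomial_vec gs {1..N} m \<in> lower_span gs k N m)"
proof (rule ccontr)
  define bad where "bad N j l \<longleftrightarrow> k \<le> N \<and> (j, l) \<in> monomials gs {1..N} \<and> monomial_vec gs {1..N} (j, l) \<notin> lower_span gs k N (j, l) \<and>
      (\<exists>x\<in>torsion k N. monomial_vec gs {1..N} (j, l) - x \<in> lower_span gs k N (j, l))" for N j l
  assume neg: "\<not> ?thesis"
  have "\<exists>y. e \<le> fst y \<and> bad (fst y) (fst (snd y)) (snd (snd y))" for e
  proof -
    obtain N m x where "e \<le> N" "k \<le> N" "m \<in> monomials gs {1..N}" "x \<in> torsion k N"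
      "monomial_vec gs {1..N} m - x \<in> lower_span gs k N m" "monomial_vec gs {1..N} m \<notin> lower_span gs k N m"
      using neg by blast
    then show ?thesis by (intro exI[of _ "(N, m)"]) (auto simp: bad_def)
  qed
  then obtain y where y: "\<And>e. e \<le> fst (y e)" "\<And>e. bad (fst (y e)) (fst (snd (y e))) (snd (snd (y e)))"
    by metis
  define D where "D = Max (insert 0 (fst ` set gs))"
  \<comment> \<open>The marked points are the positions in the monomial and also those in \<open>{1..k}\<close>, which have to stay
    fixed.\<close>
  define q where "q u t = ([1..<Suc k] @ snd (snd t)) ! u" for u and t :: "nat \<times> nat \<times> nat list"
  define \<Phi> where "\<Phi> = {fst, \<lambda>t. fst (snd t), \<lambda>t. length gs - fst (snd t)}
     \<union> q ` {..<k + D} \<union> (\<lambda>u t. fst t - q u t) ` {..<k + D}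
     \<union> (\<lambda>(u, v) t. Suc (q v t) - q u t) ` ({..<k + D} \<times> {..<k + D})"
  have "finite \<Phi>" by (simp add: \<Phi>_def)
  from dickson_subseq[OF this, of y] obtain r where r: "strict_mono r"
    "\<And>\<phi>. \<phi> \<in> \<Phi> \<Longrightarrow> incseq (\<lambda>n. \<phi> (y (r n)))" by blast
  define n where "n = Suc (fst (y (r 0)))"
  obtain N j l where t: "y (r 0) = (N, j, l)" by (cases "y (r 0)")
  obtain N' j' l' where t': "y (r n) = (N', j', l')" by (cases "y (r n)")
  have le: "\<phi> (N, j, l) \<le> \<phi> (N', j', l')" if "\<phi> \<in> \<Phi>" for \<phi>
    using r(2)[OF that] unfolding t[symmetric] t'[symmetric] incseq_def by simp
  have bad: "bad N j l" "bad N' j' l'" using y(2)[of "r 0"] y(2)[of "r n"] t t' by auto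
  have "n \<le> r n" using r(1) by (rule strict_mono_imp_increasing)
  then have NN': "N < N'" using y(1)[of "r n"] t t' by (simp add: n_def)
  have jlen: "j < length gs" "j' < length gs" using bad by (auto simp: bad_def monomials_def)
  have "j \<le> j'" "length gs - j \<le> length gs - j'"
    using le[of "\<lambda>t. fst (snd t)"] le[of "\<lambda>t. length gs - fst (snd t)"] by (auto simp: \<Phi>_def)
  then have j': "j' = j" using jlen by linarith
  have len: "length l = fst (gs ! j)" "length l' = length l" and sub: "set l \<subseteq> {1..N}" "set l' \<subseteq> {1..N'}"
    and kN: "k \<le> N" and m: "(j, l) \<in> monomials gs {1..N}"
    using bad j' by (auto simp: bad_def monomials_def)
  have "length l \<le> D" unfolding D_def len using jlen by (intro Max_ge) auto
  then have uD: "u < k + D" if "u < k + length l" for u using that by simp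
  have "\<exists>h. strict_mono_on {1..N} h \<and> h ` {1..N} \<subseteq> {1..N'} \<and>
      (\<forall>u<k + length l. h (q u (N, j, l)) = q u (N', j', l'))"
  proof (rule stretch_exists)
    show "N \<le> N'" using NN' by simp
    fix u assume u: "u < k + length l"
    have "q u (N, j, l) \<in> set ([1..<Suc k] @ l)" "q u (N', j', l') \<in> set ([1..<Suc k] @ l')"
      unfolding q_def snd_conv using u len by (auto intro!: nth_mem simp del: upt_Suc set_append)
    moreover have "set ([1..<Suc k] @ l) \<subseteq> {1..N}" "set ([1..<Suc k] @ l') \<subseteq> {1..N'}"
      using sub kN NN' by auto
    ultimately show "q u (N, j, l) \<in> {1..N}" "q u (N', j', l') \<in> {1..N'}" by blast+
    show "q u (N, j, l) \<le> q u (N', j', l')" using uD[OF u] by (intro le) (auto simp: \<Phi>_def)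
    show "N - q u (N, j, l) \<le> N' - q u (N', j', l')"
      using le[of "\<lambda>t. fst t - q u t"] uD[OF u] by (auto simp: \<Phi>_def)
    fix v assume v: "v < k + length l"
    have "(\<lambda>t. Suc (q v t) - q u t) \<in> (\<lambda>(u, v) t. Suc (q v t) - q u t) ` ({..<k + D} \<times> {..<k + D})"
      using uD[OF u] uD[OF v] by (intro image_eqI[of _ _ "(u, v)"]) auto
    then show "Suc (q v (N, j, l)) - q u (N, j, l) \<le> Suc (q v (N', j', l')) - q u (N', j', l')"
      by (intro le[of "\<lambda>t. Suc (q v t) - q u t"]) (simp add: \<Phi>_def)
  qed
  then obtain h where h: "strict_mono_on {1..N} h" "h ` {1..N} \<subseteq> {1..N'}"
    "\<And>u. u < k + length l \<Longrightarrow> h (q u (N, j, l)) = q u (N', j', l')" by blast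
  have inj: "inj_on h {1..N}" using h(1) by (rule strict_mono_on_imp_inj_on)
  have fixk: "h i = i" if "i \<in> {1..k}" for i
  proof -
    have "i - 1 < k" "[1..<Suc k] ! (i - 1) = i" using that by (auto simp del: upt_Suc)
    then show ?thesis using h(3)[of "i - 1"] by (simp add: q_def nth_append del: upt_Suc)
  qed
  have map: "map h l = l'"
  proof (rule nth_equalityI)
    fix i assume "i < length (map h l)"
    then show "map h l ! i = l' ! i"
      using h(3)[of "k + i"] by (auto simp: q_def nth_append simp del: upt_Suc)
  qed (simp add: len)
  obtain x where x: "x \<in> torsion k N" "monomial_vec gs {1..N} (j, l) - x \<in> lower_span gs k N (j, l)"
    using bad(1) by (auto simp: bad_def)
  have xV: "x \<in> V {1..N}" using x(1) by (simp add: torsion_def)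
  have "push {1..N} {1..N'} h (monomial_vec gs {1..N} (j, l) - x) \<in> lower_span gs k N' (j, l')"
    using push_lower_span[OF kN h(1,2) fixk m x(2)] map by simp
  moreover have "push {1..N} {1..N'} h (monomial_vec gs {1..N} (j, l) - x) =
      monomial_vec gs {1..N'} (j, l') - push {1..N} {1..N'} h x"
    using lin_on_diff[OF push_lin[OF _ _ inj h(2)] subspace_V monomial_vec_V[OF _ m] xV] push_monomial_vec(2)[OF _ _ inj h(2) m] map
    by simp
  moreover have "push {1..N} {1..N'} h x \<in> lower_span gs k N' (j, l')"
    using push_torsion[OF kN NN' inj h(2) fixk x(1)] unfolding lower_span_def by (intro span_base) blast
  ultimately have "(monomial_vec gs {1..N'} (j, l') - push {1..N} {1..N'} h x) + push {1..N} {1..N'} h x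
      \<in> lower_span gs k N' (j, l')"
    unfolding lower_span_def by (intro span_add) simp_all
  then have "monomial_vec gs {1..N'} (j, l') \<in> lower_span gs k N' (j, l')" by simp
  then show False using bad(2) j' by (simp add: bad_def)
qed

text \<open>
  A torsion element is a combination of monomials modulo the boundary. Its leading monomial is
  redundant in high degree, so it can be removed until no monomial is left.
\<close>

lemma torsion_std: "\<exists>e. \<forall>N\<ge>e. k \<le> N \<longrightarrow> torsion k N \<subseteq> boundary {1..N} {1..k}"
proof -
  obtain e where e: "\<And>N m x. e \<le> N \<Longrightarrow> k \<le> N \<Longrightarrow> m \<in> monomials gs {1..N} \<Longrightarrow> x \<in> torsion k N \<Longrightarrow>
     monomial_vec gs {1..N} m - x \<in> lower_span gs k N m \<Longrightarrow> monomial_vec gs {1..N} m \<in> lower_span gs k N m"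
    using leading_monomials_stable[of k] by blast
  have "torsion k N \<subseteq> boundary {1..N} {1..k}" if N: "e \<le> N" "k \<le> N" for N
  proof -
    let ?R = "boundary {1..N} {1..k}" and ?M = "monomials gs {1..N}" and ?v = "monomial_vec gs {1..N}"
    have scaleK: "scale c x \<in> torsion k N" if "x \<in> torsion k N" for c x
    proof -
      have "incl {1..N} {1..Suc N} (scale c x) = scale c (incl {1..N} {1..Suc N} x)"
        using that by (intro lin_on_scale[OF push_lin]) (auto simp: torsion_def)
      then show ?thesis using that by (auto simp: torsion_def subspace_scale subspace_V)
    qed
    \<comment> \<open>The sets \<open>D\<close> are initial segments of the monomials, so that all the monomials below the largest
      element of \<open>D\<close> are available in \<open>D\<close>.\<close>
    have main: "x \<in> ?R"
      if "finite D" "D \<subseteq> ?M" "\<And>m m'. m \<in> D \<Longrightarrow> m' \<in> ?M \<Longrightarrow> m' < m \<Longrightarrow> m' \<in> D"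
        "x \<in> torsion k N" "x \<in> span (?R \<union> ?v ` D)" for D x
      using that
    proof (induction "card D" arbitrary: D)
      case 0
      then have "D = {}" by simp
      then show ?case using 0 by (simp add: span_eq_iff[THEN iffD2, OF boundary_subspace])
    next
      case (Suc n)
      then have D: "D \<noteq> {}" "finite D" by auto
      define m where "m = Max D"
      have m: "m \<in> D" "\<And>m'. m' \<in> D \<Longrightarrow> m' \<le> m" using D by (auto simp: m_def)
      define D' where "D' = D - {m}"
      have D': "card D' = n" "finite D'" "D' \<subseteq> ?M"
        using Suc m by (auto simp: D'_def)
      have down: "m'' \<in> D'" if "m' \<in> D'" "m'' \<in> ?M" "m'' < m'" for m' m''
        using that Suc.prems(3)[of m' m''] m(2)[of m'] by (auto simp: D'_def)
      have "?R \<union> ?v ` D = insert (?v m) (?R \<union> ?v ` D')" using m(1) by (auto simp: D'_def)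
      then obtain c where c: "x - scale c (?v m) \<in> span (?R \<union> ?v ` D')"
        using Suc.prems(5) span_breakdown_eq by auto
      have eq: "span (?R \<union> ?v ` D') = lower_span gs k N m"
      proof -
        have "D' = {m' \<in> ?M. m' < m}"
        proof (intro subset_antisym subsetI)
          fix m' assume "m' \<in> D'"
          then show "m' \<in> {m' \<in> ?M. m' < m}"
            using Suc.prems(2) m(2)[of m'] by (auto simp: D'_def simp del: less_prod_simp)
        next
          fix m' assume "m' \<in> {m' \<in> ?M. m' < m}"
          then show "m' \<in> D'" using Suc.prems(3)[OF m(1), of m'] by (simp add: D'_def) blast
        qed
        then show ?thesis by (simp add: lower_span_def)
      qed
      have "x \<in> span (?R \<union> ?v ` D')"
      proof (cases "c = 0")
        case False
        have "scale (- inverse c) (x - scale c (?v m)) \<in> lower_span gs k N m"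
          using c unfolding eq unfolding lower_span_def by (rule span_scale)
        moreover have "scale (- inverse c) (x - scale c (?v m)) = ?v m - scale (inverse c) x"
          using False by (simp add: scale_right_diff_distrib)
        ultimately have "?v m \<in> lower_span gs k N m"
          using e[OF N _ scaleK[OF Suc.prems(4)], of m "inverse c"] m(1) Suc.prems(2) by auto
        then have "scale c (?v m) \<in> span (?R \<union> ?v ` D')" unfolding eq[symmetric] by (rule span_scale)
        then show ?thesis using c span_add by fastforce
      qed (use c in simp)
      then show ?case using Suc.hyps(1)[of D'] D' down Suc.prems(4) by auto
    qed
    show ?thesis
    proof
      fix x assume x: "x \<in> torsion k N"
      then have "x \<in> span (?v ` ?M)" using V_span_monomial_vec[of "{1..N}"] by (simp add: torsion_def)
      then have "x \<in> span (?R \<union> ?v ` ?M)" using span_mono[of "?v ` ?M" "?R \<union> ?v ` ?M"] by blast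
      then show "x \<in> ?R" using main[of ?M x] x finite_monomials by blast
    qed
  qed
  then show ?thesis by blast
qed

definition gen_degree :: nat where
  "gen_degree = Max (insert 0 (fst ` set gs))"

text \<open>
  The image of an injection from \<open>{1..m}\<close> with \<open>m < card B\<close> misses some \<open>b \<in> B\<close>.
\<close>

lemma boundary_full:
  assumes "finite S" "B \<subseteq> S" "gen_degree < card B"
  shows "boundary S B = V S"
proof
  show "boundary S B \<subseteq> V S" using assms(1) by (rule boundary_sub)
  show "V S \<subseteq> boundary S B"
    unfolding gens_span[OF assms(1)]
  proof (rule span_minimal[OF _ boundary_subspace], clarify)
    fix m g f assume g: "(m, g) \<in> set gs" and f: "inj_on f {1..m}" "f ` {1..m} \<subseteq> S"
    have "m \<le> gen_degree" unfolding gen_degree_def using g by (intro Max_ge) force+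
    then have "card (f ` {1..m}) < card B" using card_image[OF f(1)] assms(3) by simp
    then obtain b where b: "b \<in> B" "b \<notin> f ` {1..m}"
      by (metis finite_atLeastAtMost finite_imageI linorder_not_less card_mono subsetI)
    have "push {1..m} S f g = incl (S - {b}) S (push {1..m} (S - {b}) f g)"
      using assms f b gens_V[OF g] by (intro push_comp[symmetric]) auto
    moreover have "push {1..m} (S - {b}) f g \<in> V (S - {b})"
      using assms f b gens_V[OF g] by (intro push_in) auto
    ultimately show "push {1..m} S f g \<in> boundary S B" using boundary_incl[OF b(1)] by simp
  qed
qed

text \<open>
  The bound is uniform in \<open>B\<close>, since for \<open>B\<close> larger than the degrees of the generators the quotient by
  the boundary is zero. The general case follows from that of \<open>S = {1..N}\<close> and \<open>B = {1..k}\<close> by a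
  bijection that sends the new point to \<open>Suc N\<close>.
\<close>

lemma torsion_vanishes:
  "\<exists>a. \<forall>S B x v. finite S \<longrightarrow> B \<subseteq> S \<longrightarrow> x \<notin> S \<longrightarrow> a \<le> card (S - B) \<longrightarrow> v \<in> V S \<longrightarrow>
     incl S (insert x S) v \<in> boundary (insert x S) B \<longrightarrow> v \<in> boundary S B"
proof -
  obtain e where e: "\<And>k N. e k \<le> N \<Longrightarrow> k \<le> N \<Longrightarrow> torsion k N \<subseteq> boundary {1..N} {1..k}"
    using torsion_std by metis
  define a where "a = Max (e ` {..gen_degree})"
  have "v \<in> boundary S B"
    if S: "finite S" "B \<subseteq> S" "x \<notin> S" "a \<le> card (S - B)" and v: "v \<in> V S"
      and t: "incl S (insert x S) v \<in> boundary (insert x S) B" for S B x v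
  proof (cases "gen_degree < card B")
    case True
    then show ?thesis using boundary_full S v by simp
  next
    case False
    define N k where "N = card S" and "k = card B"
    have kN: "k \<le> N" unfolding N_def k_def using S by (intro card_mono)
    have "e k \<le> a" unfolding a_def using False by (intro Max_ge) (auto simp: k_def)
    moreover have "card (S - B) \<le> N" unfolding N_def using S by (intro card_mono) auto
    ultimately have eN: "e k \<le> N" using S by simp
    have finB: "finite B" using finite_subset[OF S(2,1)] .
    have "\<exists>g1. bij_betw g1 B {1..k}"
      using finB by (rule finite_same_card_bij) (simp_all add: k_def)
    then obtain g1 where g1: "bij_betw g1 B {1..k}" by (rule exE)
    have "\<exists>g2. bij_betw g2 (S - B) {Suc k..N}"
      using S(1) card_Diff_subset[OF finB S(2)] by (intro finite_same_card_bij) (simp_all add: k_def N_def)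
    then obtain g2 where g2: "bij_betw g2 (S - B) {Suc k..N}" by (rule exE)
    define g where "g y = (if y \<in> B then g1 y else if y \<in> S then g2 y else Suc N)" for y
    have gB: "g ` B = {1..k}" using g1 by (simp add: g_def bij_betw_def)
    have "bij_betw g B {1..k}" using g1 by (subst bij_betw_cong[of _ g g1]) (auto simp: g_def)
    moreover have "bij_betw g (S - B) {Suc k..N}" using g2 by (subst bij_betw_cong[of _ g g2]) (auto simp: g_def)
    ultimately have "bij_betw g (B \<union> (S - B)) ({1..k} \<union> {Suc k..N})"
      by (rule bij_betw_combine) auto
    moreover have "B \<union> (S - B) = S" using S by blast
    moreover have "{1..k} \<union> {Suc k..N} = {1..N}" using kN by auto
    ultimately have gS: "bij_betw g S {1..N}" by simp
    have gx: "g x = Suc N" using S by (auto simp: g_def)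
    have gS': "bij_betw g (insert x S) {1..Suc N}"
    proof -
      have "bij_betw g {x} {Suc N}" using gx by simp
      then have "bij_betw g (S \<union> {x}) ({1..N} \<union> {Suc N})" by (intro bij_betw_combine[OF gS]) auto
      moreover have "{1..N} \<union> {Suc N} = {1..Suc N}" by auto
      ultimately show ?thesis by simp
    qed
    have 1: "inj_on g S" "g ` S \<subseteq> {1..N}" "inj_on g (insert x S)" "g ` insert x S \<subseteq> {1..Suc N}"
      using gS gS' unfolding bij_betw_def by blast+
    define v' where "v' = push S {1..N} g v"
    have "incl {1..N} {1..Suc N} v' = push S {1..Suc N} g v"
      unfolding v'_def using S v 1 by (intro push_comp) auto
    also have "\<dots> = push (insert x S) {1..Suc N} g (incl S (insert x S) v)"
      using S v 1 by (intro push_comp[symmetric]) auto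
    also have "\<dots> \<in> boundary {1..Suc N} (g ` B)"
      using S t 1(3,4) by (intro push_boundary) auto
    finally have "v' \<in> torsion k N"
      unfolding torsion_def gB using S v 1 by (auto simp: v'_def intro!: push_in)
    then have v': "v' \<in> boundary {1..N} {1..k}" using e[OF eN kN] by blast
    define h where "h = the_inv_into S g"
    have h: "bij_betw h {1..N} S" unfolding h_def using gS by (rule bij_betw_the_inv_into)
    have hg: "h (g y) = y" if "y \<in> S" for y unfolding h_def using 1(1) that by (rule the_inv_into_f_f)
    have hk: "h ` {1..k} = B"
    proof -
      have "h ` g ` B = B" using hg S by force
      then show ?thesis by (simp add: gB)
    qed
    have hi: "inj_on h {1..N}" "h ` {1..N} \<subseteq> S" using h unfolding bij_betw_def by blast+
    have "push {1..N} S h v' \<in> boundary S (h ` {1..k})"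
      using v' S hi kN by (intro push_boundary) auto
    moreover have "push {1..N} S h v' = push S S (\<lambda>y. h (g y)) v"
      unfolding v'_def using S v hi 1 by (intro push_comp) auto
    moreover have "push S S (\<lambda>y. h (g y)) v = v" using S v hg by (intro push_id) auto
    ultimately show ?thesis unfolding hk by simp
  qed
  then show ?thesis by blast
qed

end

section \<open>Traces on cubes of subsets\<close>

context fi_space
begin

text \<open>
  The trace on the quotient \<open>V S / boundary S B\<close>, as a difference of traces on subspaces.
\<close>

definition quot_trace :: "nat set \<Rightarrow> nat set \<Rightarrow> (nat \<Rightarrow> nat) \<Rightarrow> 'k" where
  "quot_trace S B \<sigma> = trace_on scale (V S) (push S S \<sigma>) - trace_on scale (boundary S B) (push S S \<sigma>)"

lemma boundary_lin:
  assumes "finite S" "finite T" "inj_on f S" "f ` S \<subseteq> T" "B \<subseteq> S" "f ` B = C"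
  shows "lin_on (boundary S B) (boundary T C) (push S T f)"
  using assms push_boundary[OF assms(1-5)] by (intro lin_on_subset[OF push_lin[OF assms(1-4)] boundary_sub]) auto

lemma push_bij:
  assumes "finite S" "finite T" "bij_betw h S T" "B \<subseteq> S"
  shows "bij_betw (push S T h) (V S) (V T)" "bij_betw (push S T h) (boundary S B) (boundary T (h ` B))"
proof -
  define g where "g = the_inv_into S h"
  have g: "bij_betw g T S" unfolding g_def using assms(3) by (rule bij_betw_the_inv_into)
  have inj: "inj_on h S" "h ` S \<subseteq> T" "inj_on g T" "g ` T \<subseteq> S"
    using assms(3) g unfolding bij_betw_def by blast+
  have gh: "g (h x) = x" if "x \<in> S" for x unfolding g_def using inj(1) that by (rule the_inv_into_f_f)
  have hg: "h (g y) = y" if "y \<in> T" for y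
    unfolding g_def using assms(3) that by (rule f_the_inv_into_f_bij_betw)
  have 1: "push T S g (push S T h v) = v" if "v \<in> V S" for v
    using push_comp[OF assms(1,2,1) inj that] push_id[OF assms(1) that gh] by simp
  have 2: "push S T h (push T S g v) = v" if "v \<in> V T" for v
    using push_comp[OF assms(2,1,2) inj(3,4,1,2) that] push_id[OF assms(2) that hg] by simp
  show "bij_betw (push S T h) (V S) (V T)"
    using assms inj 1 2 push_in by (intro bij_betw_byWitness[where f' = "push T S g"]) auto
  have "g ` h ` B = B" using gh assms(4) by force
  moreover have "h ` B \<subseteq> T" using assms(4) inj(2) by blast
  ultimately show "bij_betw (push S T h) (boundary S B) (boundary T (h ` B))"
    using 1[OF subsetD[OF boundary_sub[OF assms(1)]]] 2[OF subsetD[OF boundary_sub[OF assms(2)]]]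
      push_boundary[OF assms(1,2) inj(1,2) assms(4)] push_boundary[OF assms(2,1) inj(3,4), of "h ` B"]
    by (intro bij_betw_byWitness[where f' = "push T S g"]) auto
qed

lemma quot_trace_conj:
  assumes S: "finite S" "B \<subseteq> S" "fin_dim (V S)" and h: "bij_betw h S S'" and B': "h ` B = B'"
    and \<sigma>: "inj_on \<sigma> S" "\<sigma> ` S \<subseteq> S" "\<sigma> ` B = B" and \<sigma>': "inj_on \<sigma>' S'" "\<sigma>' ` S' \<subseteq> S'" "\<sigma>' ` B' = B'"
    and eq: "\<And>x. x \<in> S \<Longrightarrow> \<sigma>' (h x) = h (\<sigma> x)"
  shows "quot_trace S' B' \<sigma>' = quot_trace S B \<sigma>"
proof -
  have S': "finite S'" using h S(1) bij_betw_finite by blast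
  have hi: "inj_on h S" "h ` S \<subseteq> S'" using h unfolding bij_betw_def by blast+
  have BS': "B' \<subseteq> S'" using B' S(2) hi(2) by blast
  have comm: "push S' S' \<sigma>' (push S S' h w) = push S S' h (push S S \<sigma> w)" if "w \<in> V S" for w
  proof -
    have "push S' S' \<sigma>' (push S S' h w) = push S S' (\<lambda>x. \<sigma>' (h x)) w"
      by (rule push_comp[OF S(1) S' S' hi \<sigma>'(1,2) that])
    also have "\<dots> = push S S' (\<lambda>x. h (\<sigma> x)) w" using eq by (intro fun_cong[OF push_cong])
    also have "\<dots> = push S S' h (push S S \<sigma> w)" by (rule push_comp[OF S(1,1) S' \<sigma>(1,2) hi that, symmetric])
    finally show ?thesis .
  qed
  note b = push_bij[OF S(1) S' h S(2), unfolded B']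
  have "trace_on scale (V S') (push S' S' \<sigma>') = trace_on scale (V S) (push S S \<sigma>)"
    using S' S \<sigma> \<sigma>' hi comm by (intro trace_on_conj[OF S(3) _ b(1)] push_lin) auto
  moreover have "trace_on scale (boundary S' B') (push S' S' \<sigma>') = trace_on scale (boundary S B) (push S S \<sigma>)"
  proof (rule trace_on_conj[OF _ _ b(2)])
    show "fin_dim (boundary S B)" using S by (intro fin_dim_subspace[OF S(3)] boundary_sub) auto
    show "lin_on (boundary S B) (boundary S' B') (push S S' h)" using S S' hi B' by (intro boundary_lin)
    show "lin_on (boundary S B) (boundary S B) (push S S \<sigma>)" using S \<sigma> by (intro boundary_lin)
    show "lin_on (boundary S' B') (boundary S' B') (push S' S' \<sigma>')" using S' BS' \<sigma>' by (intro boundary_lin)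
    show "push S' S' \<sigma>' (push S S' h w) = push S S' h (push S S \<sigma> w)" if "w \<in> boundary S B" for w
      using comm that boundary_sub[OF S(1)] by blast
  qed
  ultimately show ?thesis by (simp add: quot_trace_def)
qed

text \<open>
  Vectors of \<open>V S\<close> that represent a basis of \<open>V S / boundary S B\<close>.
\<close>

definition lifted_basis :: "nat set \<Rightarrow> nat set \<Rightarrow> 'v set" where
  "lifted_basis S B = (SOME L. L \<subseteq> V S \<and> rel_basis L (\<lambda>x. x) (boundary S B) (V S))"

definition torsion_free_from :: "nat \<Rightarrow> bool" where
  "torsion_free_from a \<longleftrightarrow>
     (\<forall>S B x v. finite S \<longrightarrow> B \<subseteq> S \<longrightarrow> x \<notin> S \<longrightarrow> a \<le> card (S - B) \<longrightarrow> v \<in> V S \<longrightarrow>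
        incl S (insert x S) v \<in> boundary (insert x S) B \<longrightarrow> v \<in> boundary S B)"

end

text \<open>
  What the trace formula uses of a finitely generated FI-module.
\<close>

locale fi_stable = fi_space scale V act
  for scale :: "'k::field \<Rightarrow> 'v::ab_group_add \<Rightarrow> 'v" and V act +
  fixes a :: nat
  assumes torsion_free: "torsion_free_from a"
    and fin_dim_V: "finite S \<Longrightarrow> fin_dim (V S)"
begin

lemma fin_dim_boundary: "finite S \<Longrightarrow> fin_dim (boundary S B)"
  by (rule fin_dim_subspace[OF fin_dim_V boundary_subspace boundary_sub])

lemma lifted_basis_rel_basis:
  assumes "finite S"
  shows "rel_basis (lifted_basis S B) (\<lambda>x. x) (boundary S B) (V S)"
  using someI_ex[OF rel_basis_exists[OF fin_dim_V[OF assms] boundary_subspace boundary_sub[OF assms]]]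
  unfolding lifted_basis_def by blast

lemma lifted_basis_V: "finite S \<Longrightarrow> y \<in> lifted_basis S B \<Longrightarrow> y \<in> V S"
  using rel_basisD(5)[OF lifted_basis_rel_basis] by blast

text \<open>
  Induction on \<open>Y\<close>. When \<open>x\<close> is added to \<open>S = A \<union> B0 \<union> Y\<close>, the space \<open>V (insert x S)\<close> modulo
  \<open>boundary (insert x S) B0\<close> has the subspace given by \<open>boundary (insert x S) (insert x B0)\<close>. This
  subspace is the image of \<open>V S\<close>, and by torsion-freeness it is a copy of \<open>V S / boundary S B0\<close>; it accounts
  for the sets \<open>B\<close> without \<open>x\<close>. The remaining quotient accounts for the sets \<open>B\<close> that contain \<open>x\<close>. This is
  why \<open>B0\<close>, which is empty in the application, is needed in the induction.
\<close>

lemma cube_basis: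
  assumes "finite Y" "finite A" "finite B0" "A \<inter> Y = {}" "B0 \<inter> Y = {}" "A \<inter> B0 = {}" "a \<le> card A"
  shows "rel_basis (SIGMA B:Pow Y. lifted_basis (A \<union> B0 \<union> B) (B0 \<union> B))
     (\<lambda>(B, y). incl (A \<union> B0 \<union> B) (A \<union> B0 \<union> Y) y) (boundary (A \<union> B0 \<union> Y) B0) (V (A \<union> B0 \<union> Y))"
  using assms
proof (induction Y arbitrary: B0 rule: finite_induct)
  case empty
  let ?S = "A \<union> B0"
  have S: "finite ?S" using empty by simp
  let ?e = "\<lambda>(B, y). incl (?S \<union> B) (?S \<union> {}) y"
  have "rel_basis (lifted_basis ?S B0) (\<lambda>y. ?e ((\<lambda>y. ({}, y)) y)) (boundary ?S B0) (V ?S)"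
    using push_id[OF S] lifted_basis_V[OF S] by (intro rel_basis_cong[OF lifted_basis_rel_basis[OF S]]) auto
  from rel_basis_reindex[of "lifted_basis ?S B0" ?e "\<lambda>y. ({}, y)", OF this] have "rel_basis ((\<lambda>y. ({}, y)) ` lifted_basis ?S B0) ?e (boundary ?S B0) (V ?S)"
    by (auto simp: inj_on_def)
  moreover have "(\<lambda>y. ({}, y)) ` lifted_basis ?S B0 = (SIGMA B:Pow {}. lifted_basis (?S \<union> B) (B0 \<union> B))" by auto
  ultimately show ?case by simp
next
  case (insert x Y)
  define S where "S = A \<union> B0 \<union> Y"
  define S' where "S' = insert x S"
  have fin: "finite S" "finite S'" "finite Y" using insert by (auto simp: S_def S'_def)
  have x: "x \<notin> S" using insert by (auto simp: S_def)
  have S': "A \<union> insert x B0 \<union> Y = S'" "A \<union> B0 \<union> insert x Y = S'" by (auto simp: S_def S'_def)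
  let ?I = "SIGMA B:Pow Y. lifted_basis (A \<union> B0 \<union> B) (B0 \<union> B)"
  let ?e = "\<lambda>(B, y). incl (A \<union> B0 \<union> B) S' y"
  have B0: "B0 \<subseteq> S" by (auto simp: S_def)
  have "A \<subseteq> S - B0" using insert.prems by (auto simp: S_def)
  then have "card A \<le> card (S - B0)" using fin(1) by (intro card_mono) auto
  then have ca: "a \<le> card (S - B0)" using insert.prems by simp
  have inclL: "lin_on (V S) (V S') (incl S S')" using fin by (intro push_lin) (auto simp: S'_def)
  have 1: "rel_basis ?I (\<lambda>(B, y). incl (A \<union> B0 \<union> B) S y) (boundary S B0) (V S)"
    unfolding S_def using insert by (intro insert.IH) auto
  have 1: "rel_basis ?I (\<lambda>i. incl S S' ((\<lambda>(B, y). incl (A \<union> B0 \<union> B) S y) i)) (boundary S' B0) (boundary S' (insert x B0))"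
  proof (rule rel_basis_push[OF 1 inclL subspace_V[OF fin(2)] boundary_subspace boundary_sub[OF fin(2)]])
    show "incl S S' w \<in> boundary S' B0 \<longleftrightarrow> w \<in> boundary S B0" if w: "w \<in> V S" for w
    proof
      assume "incl S S' w \<in> boundary S' B0"
      then show "w \<in> boundary S B0"
        using torsion_free fin(1) B0 x ca w unfolding torsion_free_from_def S'_def by blast
    next
      assume "w \<in> boundary S B0"
      then show "incl S S' w \<in> boundary S' B0"
        using push_boundary[of S S' "\<lambda>x. x" B0 w] fin B0 by (auto simp: S'_def)
    qed
    show "z \<in> boundary S' (insert x B0) \<longleftrightarrow> (\<exists>w\<in>V S. z - incl S S' w \<in> boundary S' B0)" for z
      unfolding S'_def using fin(1) x by (rule boundary_insert)
  qed
  have 1: "rel_basis ?I ?e (boundary S' B0) (boundary S' (insert x B0))"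
  proof (rule rel_basis_cong[OF 1])
    fix i assume "i \<in> ?I"
    then obtain B y where i: "i = (B, y)" "B \<subseteq> Y" "y \<in> lifted_basis (A \<union> B0 \<union> B) (B0 \<union> B)" by auto
    have "finite B" using i(2) fin(3) finite_subset by blast
    then have fB: "finite (A \<union> B0 \<union> B)" using insert by auto
    have "incl S S' (incl (A \<union> B0 \<union> B) S y) = incl (A \<union> B0 \<union> B) S' y"
      using fB fin i lifted_basis_V[OF fB i(3)] by (intro push_comp) (auto simp: S_def S'_def)
    then show "incl S S' (case i of (B, y) \<Rightarrow> incl (A \<union> B0 \<union> B) S y) =
        (case i of (B, y) \<Rightarrow> incl (A \<union> B0 \<union> B) S' y)" using i by simp
  qed
  let ?I2 = "SIGMA B:Pow Y. lifted_basis (A \<union> insert x B0 \<union> B) (insert x B0 \<union> B)"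
  let ?p = "\<lambda>(B, y). (insert x B, y)"
  have 2: "rel_basis ?I2 (\<lambda>(B, y). incl (A \<union> insert x B0 \<union> B) S' y) (boundary S' (insert x B0)) (V S')"
    using insert.IH[of "insert x B0"] insert unfolding S' by auto
  have 2: "rel_basis ?I2 (\<lambda>i. ?e (?p i)) (boundary S' (insert x B0)) (V S')"
    by (rule rel_basis_cong[OF 2]) auto
  have injp: "inj_on ?p ?I2" using insert.hyps(2) by (fastforce simp: inj_on_def insert_ident)
  have 2: "rel_basis (?p ` ?I2) ?e (boundary S' (insert x B0)) (V S')"
    by (rule rel_basis_reindex[OF 2 injp])
  have "?I \<inter> ?p ` ?I2 = {}" using insert.hyps(2) by auto
  from rel_basis_chain[OF 1 2 this]
  have "rel_basis (?I \<union> ?p ` ?I2) ?e (boundary S' B0) (V S')" .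
  moreover have "?I \<union> ?p ` ?I2 = (SIGMA B:Pow (insert x Y). lifted_basis (A \<union> B0 \<union> B) (B0 \<union> B))"
  proof -
    have "?p ` ?I2 = (SIGMA B:insert x ` Pow Y. lifted_basis (A \<union> B0 \<union> B) (B0 \<union> B))"
      by (auto simp: image_iff Un_assoc)
    then show ?thesis by (auto simp: Pow_insert)
  qed
  ultimately show ?case unfolding S' by simp
qed

text \<open>
  In the basis of \<open>cube_basis\<close>, the vector with index \<open>(B, y)\<close> is mapped by \<open>\<sigma>\<close> into the image of
  \<open>V (A \<union> \<sigma> ` B)\<close>, which involves only indices \<open>(D, z)\<close> with \<open>D \<subseteq> \<sigma> ` B\<close>. As \<open>B\<close> and \<open>\<sigma> ` B\<close> have the same
  size, a nonzero diagonal entry requires \<open>\<sigma> ` B = B\<close>, and then the block of \<open>B\<close> is the matrix of \<open>\<sigma>\<close> on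
  the quotient.
\<close>

lemma trace_cube:
  assumes A: "finite A" "finite Y" "A \<inter> Y = {}" "a \<le> card A"
    and \<sigma>: "inj_on \<sigma> (A \<union> Y)" "\<sigma> ` A = A" "\<sigma> ` Y = Y"
  shows "trace_on scale (V (A \<union> Y)) (push (A \<union> Y) (A \<union> Y) \<sigma>) =
    (\<Sum>B\<in>{B \<in> Pow Y. \<sigma> ` B = B}. quot_trace (A \<union> B) B \<sigma>)"
proof -
  define S where "S = A \<union> Y"
  define I where "I = (SIGMA B:Pow Y. lifted_basis (A \<union> B) B)"
  define e where "e = (\<lambda>(B, y). incl (A \<union> B) S y)"
  have S: "finite S" using A by (simp add: S_def)
  have finB: "finite (A \<union> B)" "finite B" if "B \<subseteq> Y" for B
    using A that finite_subset[OF that] by auto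
  have basis: "rel_basis I e {0} (V S)"
    using cube_basis[of Y A "{}"] A by (simp add: I_def e_def S_def)
  note bb = rel_basisD[OF basis]
  have \<sigma>S: "\<sigma> ` S \<subseteq> S" "inj_on \<sigma> S" using \<sigma> by (auto simp: S_def)
  have supp: "incl (A \<union> C) S w \<in> span (e ` {i \<in> I. fst i \<subseteq> C})" if C: "C \<subseteq> Y" and w: "w \<in> V (A \<union> C)" for C w
  proof -
    let ?J = "SIGMA B:Pow C. lifted_basis (A \<union> B) B"
    have b: "rel_basis ?J (\<lambda>(B, y). incl (A \<union> B) (A \<union> C) y) {0} (V (A \<union> C))"
      using cube_basis[of C A "{}"] A C finB[OF C] by auto
    have "w \<in> span ((\<lambda>(B, y). incl (A \<union> B) (A \<union> C) y) ` ?J)"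
      using rel_basis_zero_span(3)[OF b] w by simp
    then show ?thesis
    proof (rule lin_on_span_subset[OF push_lin subspace_V _ _ subspace_span, rotated -1])
      show "finite (A \<union> C)" "finite (A \<union> C)" "finite S" "inj_on (\<lambda>x. x) (A \<union> C)"
        "(\<lambda>x. x) ` (A \<union> C) \<subseteq> S" using finB[OF C] S C by (auto simp: S_def)
      show "(\<lambda>(B, y). incl (A \<union> B) (A \<union> C) y) ` ?J \<subseteq> V (A \<union> C)" using rel_basisD(5)[OF b] by blast
      fix z assume "z \<in> (\<lambda>(B, y). incl (A \<union> B) (A \<union> C) y) ` ?J"
      then obtain B y where z: "B \<subseteq> C" "y \<in> lifted_basis (A \<union> B) B" "z = incl (A \<union> B) (A \<union> C) y" by auto
      then have BY: "B \<subseteq> Y" using C by blast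
      have "incl (A \<union> C) S z = incl (A \<union> B) S y"
        unfolding z(3) using finB[OF BY] finB[OF C] S z C lifted_basis_V[OF finB(1)[OF BY] z(2)]
        by (intro push_comp) (auto simp: S_def)
      also have "\<dots> = e (B, y)" by (simp add: e_def)
      finally show "incl (A \<union> C) S z \<in> span (e ` {i \<in> I. fst i \<subseteq> C})"
        using z BY by (intro span_base image_eqI[of _ _ "(B, y)"]) (auto simp: I_def)
    qed
  qed
  have supp_boundary: "incl (A \<union> C) S u \<in> span (e ` {i \<in> I. fst i \<subset> C})"
    if C: "C \<subseteq> Y" and u: "u \<in> boundary (A \<union> C) C" for C u
  proof (rule lin_on_span_subset[OF push_lin subspace_V boundary_gens_V _ subspace_span u[unfolded boundary_def]])
    show "finite (A \<union> C)" "finite (A \<union> C)" "finite (A \<union> C)" "finite S" "inj_on (\<lambda>x. x) (A \<union> C)"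
      "(\<lambda>x. x) ` (A \<union> C) \<subseteq> S" using finB[OF C] S C by (auto simp: S_def)
    fix x assume "x \<in> (\<Union>b\<in>C. incl (A \<union> C - {b}) (A \<union> C) ` V (A \<union> C - {b}))"
    then obtain b w where b: "b \<in> C" "w \<in> V (A \<union> C - {b})" "x = incl (A \<union> C - {b}) (A \<union> C) w" by blast
    have eq: "A \<union> C - {b} = A \<union> (C - {b})" using b(1) C A(3) by blast
    have "incl (A \<union> C) S x = incl (A \<union> (C - {b})) S w"
      unfolding b(3) eq using finB[OF C] S C b(2) unfolding eq by (intro push_comp) (auto simp: S_def)
    also have "\<dots> \<in> span (e ` {i \<in> I. fst i \<subseteq> C - {b}})"
      using supp[of "C - {b}" w] C b(2) unfolding eq by blast
    also have "\<dots> \<subseteq> span (e ` {i \<in> I. fst i \<subset> C})"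
      using b(1) by (intro span_mono image_mono) auto
    finally show "incl (A \<union> C) S x \<in> span (e ` {i \<in> I. fst i \<subset> C})" .
  qed
  define wt where "wt = (\<lambda>(B, y). push (A \<union> B) (A \<union> \<sigma> ` B) \<sigma> y)"
  \<comment> \<open>The coordinates \<open>c\<close> of the image of a basis vector with index \<open>(B, y)\<close>: their support, and their values
    on the block of \<open>\<sigma> ` B\<close>, which are the coordinates modulo the boundary.\<close>
  define good where "good = (\<lambda>(B, y) c. push S S \<sigma> (e (B, y)) = (\<Sum>i\<in>I. scale (c i) (e i)) \<and>
      (\<forall>i. c i \<noteq> 0 \<longrightarrow> fst i \<subseteq> \<sigma> ` B) \<and>
      wt (B, y) - (\<Sum>z\<in>lifted_basis (A \<union> \<sigma> ` B) (\<sigma> ` B). scale (c (\<sigma> ` B, z)) z) \<in> boundary (A \<union> \<sigma> ` B) (\<sigma> ` B))"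
  have "\<exists>c. good i c" if i: "i \<in> I" for i
  proof -
    obtain B y where By: "i = (B, y)" "B \<subseteq> Y" "y \<in> lifted_basis (A \<union> B) B" using i by (auto simp: I_def)
    define C where "C = \<sigma> ` B"
    have C: "C \<subseteq> Y" using By(2) \<sigma>(3) by (auto simp: C_def)
    have yV: "y \<in> V (A \<union> B)" using lifted_basis_V finB By by blast
    have \<sigma>B: "inj_on \<sigma> (A \<union> B)" "\<sigma> ` (A \<union> B) \<subseteq> A \<union> C"
      using \<sigma> By(2) by (auto simp: C_def intro: inj_on_subset[OF \<sigma>(1)])
    define w where "w = push (A \<union> B) (A \<union> C) \<sigma> y"
    have wV: "w \<in> V (A \<union> C)" unfolding w_def using finB[OF By(2)] finB[OF C] \<sigma>B yV by (intro push_in)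
    have \<sigma>e: "push S S \<sigma> (e i) = incl (A \<union> C) S w"
    proof -
      have "push S S \<sigma> (e i) = push (A \<union> B) S \<sigma> y"
        unfolding By(1) e_def prod.case using finB[OF By(2)] S \<sigma>S yV By(2) by (intro push_comp) (auto simp: S_def)
      also have "\<dots> = incl (A \<union> C) S w"
        unfolding w_def using finB[OF By(2)] finB[OF C] S \<sigma>B yV C
        by (intro push_comp[symmetric]) (auto simp: S_def)
      finally show ?thesis .
    qed
    let ?L = "lifted_basis (A \<union> C) C"
    note L = lifted_basis_rel_basis[OF finB(1)[OF C], of C]
    obtain d where d: "w - (\<Sum>z\<in>?L. scale (d z) z) \<in> boundary (A \<union> C) C" using rel_basisD(6)[OF L wV] by blast
    have dV: "(\<Sum>z\<in>?L. scale (d z) z) \<in> V (A \<union> C)" using rel_basisD(3,5)[OF L] by (intro comb_in)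
    have inclC: "lin_on (V (A \<union> C)) (V S) (incl (A \<union> C) S)"
      using finB[OF C] S C by (intro push_lin) (auto simp: S_def)
    have "incl (A \<union> C) S (w - (\<Sum>z\<in>?L. scale (d z) z)) \<in> span (e ` {i \<in> I. fst i \<subset> C})"
      using supp_boundary[OF C d] .
    then obtain c where c: "incl (A \<union> C) S (w - (\<Sum>z\<in>?L. scale (d z) z)) = (\<Sum>i\<in>I. scale (c i) (e i))"
      "\<And>i. c i \<noteq> 0 \<Longrightarrow> i \<in> I \<and> fst i \<subset> C"
      using span_image_coords[OF bb(1), of "{i \<in> I. fst i \<subset> C}"] by blast
    define c' where "c' i = (if fst i = C \<and> snd i \<in> ?L then d (snd i) else c i)" for i
    have inj: "inj_on (Pair C) ?L" by (simp add: inj_on_def)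
    have LI: "Pair C ` ?L \<subseteq> I" using C by (auto simp: I_def)
    have LI': "Pair C ` ?L = {i. fst i = C \<and> snd i \<in> ?L}" by force
    have c0: "c i = 0" if "i \<in> Pair C ` ?L" for i
    proof (rule ccontr)
      assume "c i \<noteq> 0"
      then have "fst i \<subset> C" using c(2) by blast
      then show False using that by auto
    qed
    have "push S S \<sigma> (e i) = incl (A \<union> C) S ((w - (\<Sum>z\<in>?L. scale (d z) z)) + (\<Sum>z\<in>?L. scale (d z) z))"
      using \<sigma>e by simp
    also have "\<dots> = incl (A \<union> C) S (w - (\<Sum>z\<in>?L. scale (d z) z)) + incl (A \<union> C) S (\<Sum>z\<in>?L. scale (d z) z)"
      using wV dV rel_basisD(3)[OF L] by (intro lin_on_add[OF inclC] subspace_diff)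
    also have "incl (A \<union> C) S (\<Sum>z\<in>?L. scale (d z) z) = (\<Sum>z\<in>?L. scale (d z) (incl (A \<union> C) S z))"
      using rel_basisD(3,5)[OF L] by (intro lin_on_comb[OF inclC])
    also have "\<dots> = (\<Sum>i\<in>Pair C ` ?L. scale (c' i) (e i))"
      using inj by (simp add: sum.reindex c'_def e_def)
    also have "(incl (A \<union> C) S (w - (\<Sum>z\<in>?L. scale (d z) z))) = (\<Sum>i\<in>I - Pair C ` ?L. scale (c' i) (e i))"
    proof -
      have "(\<Sum>i\<in>I. scale (c i) (e i)) = (\<Sum>i\<in>I - Pair C ` ?L. scale (c i) (e i))"
        using bb(1) c0 by (intro sum.mono_neutral_right) auto
      also have "\<dots> = (\<Sum>i\<in>I - Pair C ` ?L. scale (c' i) (e i))"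
        by (intro sum.cong) (auto simp: c'_def LI')
      finally show ?thesis using c(1) by simp
    qed
    also have "(\<Sum>i\<in>I - Pair C ` ?L. scale (c' i) (e i)) + (\<Sum>i\<in>Pair C ` ?L. scale (c' i) (e i)) =
        (\<Sum>i\<in>I. scale (c' i) (e i))"
      using bb(1) LI by (intro sum.subset_diff[symmetric])
    finally have "push S S \<sigma> (e i) = (\<Sum>i\<in>I. scale (c' i) (e i))" .
    moreover have "fst i \<subseteq> C" if "c' i \<noteq> 0" for i using that c(2)[of i] by (auto simp: c'_def split: if_splits)
    moreover have "(\<Sum>z\<in>?L. scale (c' (C, z)) z) = (\<Sum>z\<in>?L. scale (d z) z)"
      by (intro sum.cong) (auto simp: c'_def)
    ultimately have "good i c'"
      unfolding good_def By(1) prod.case wt_def C_def[symmetric] using d by (simp add: w_def)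
    then show ?thesis by blast
  qed
  then obtain M where M: "\<And>i. i \<in> I \<Longrightarrow> good i (M i)" by metis
  have "trace_on scale (V S) (push S S \<sigma>) = (\<Sum>i\<in>I. M i i)"
    using M S \<sigma>S by (intro trace_on_basis[OF basis] push_lin) (fastforce simp: good_def)+
  also have "\<dots> = (\<Sum>B\<in>Pow Y. \<Sum>y\<in>lifted_basis (A \<union> B) B. M (B, y) (B, y))"
    unfolding I_def using A(2) rel_basisD(1)[OF lifted_basis_rel_basis[OF finB(1)]] by (subst sum.Sigma) auto
  also have "\<dots> = (\<Sum>B\<in>{B \<in> Pow Y. \<sigma> ` B = B}. \<Sum>y\<in>lifted_basis (A \<union> B) B. M (B, y) (B, y))"
  proof (rule sum.mono_neutral_right)
    show "\<forall>B\<in>Pow Y - {B \<in> Pow Y. \<sigma> ` B = B}. (\<Sum>y\<in>lifted_basis (A \<union> B) B. M (B, y) (B, y)) = 0"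
    proof
      fix B assume B: "B \<in> Pow Y - {B \<in> Pow Y. \<sigma> ` B = B}"
      show "(\<Sum>y\<in>lifted_basis (A \<union> B) B. M (B, y) (B, y)) = 0"
      proof (rule sum.neutral, rule ballI, rule ccontr)
        fix y assume y: "y \<in> lifted_basis (A \<union> B) B" "M (B, y) (B, y) \<noteq> 0"
        have "(B, y) \<in> I" using B y by (auto simp: I_def)
        then have sub: "B \<subseteq> \<sigma> ` B" using M[of "(B, y)"] y(2) by (fastforce simp: good_def)
        have "inj_on \<sigma> B" using \<sigma>(1) B by (auto intro: inj_on_subset)
        then have "card (\<sigma> ` B) = card B" by (rule card_image)
        then have "B = \<sigma> ` B" using sub finB(2)[of B] B by (intro card_subset_eq) auto
        then show False using B by auto
      qed
    qed
  qed (use A in auto)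
  also have "\<dots> = (\<Sum>B\<in>{B \<in> Pow Y. \<sigma> ` B = B}. quot_trace (A \<union> B) B \<sigma>)"
  proof (rule sum.cong[OF refl])
    fix B assume B: "B \<in> {B \<in> Pow Y. \<sigma> ` B = B}"
    then have BY: "B \<subseteq> Y" and \<sigma>B: "\<sigma> ` B = B" by auto
    have inj: "inj_on \<sigma> (A \<union> B)" "\<sigma> ` (A \<union> B) \<subseteq> A \<union> B"
      using \<sigma> \<sigma>B BY by (auto intro: inj_on_subset[OF \<sigma>(1)])
    have "trace_on scale (V (A \<union> B)) (push (A \<union> B) (A \<union> B) \<sigma>) =
        trace_on scale (boundary (A \<union> B) B) (push (A \<union> B) (A \<union> B) \<sigma>) + (\<Sum>y\<in>lifted_basis (A \<union> B) B. M (B, y) (B, y))"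
    proof (rule trace_on_rel_basis[where M = "\<lambda>y z. M (B, y) (B, z)", OF lifted_basis_rel_basis fin_dim_boundary push_lin boundary_lin])
      fix y assume "y \<in> lifted_basis (A \<union> B) B"
      then have "(B, y) \<in> I" using BY by (auto simp: I_def)
      from M[OF this] show "push (A \<union> B) (A \<union> B) \<sigma> y -
          (\<Sum>z\<in>lifted_basis (A \<union> B) B. scale (M (B, y) (B, z)) z) \<in> boundary (A \<union> B) B"
        by (simp add: good_def wt_def \<sigma>B)
    qed (use finB[OF BY] inj \<sigma>B in auto)
    then show "(\<Sum>y\<in>lifted_basis (A \<union> B) B. M (B, y) (B, y)) = quot_trace (A \<union> B) B \<sigma>" by (simp add: quot_trace_def)
  qed
  finally show ?thesis by (simp add: S_def)
qed

end

section \<open>Orbits and cycle types\<close>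

lemma orbit_self_in:
  assumes "\<sigma> permutes B" "finite B" shows "x \<in> orbit \<sigma> x"
  using assms by (intro permutation_self_in_orbit) (auto simp: permutation_permutes)

lemma orbit_eq:
  assumes "\<sigma> permutes B" "finite B" "y \<in> orbit \<sigma> x" shows "orbit \<sigma> y = orbit \<sigma> x"
  using assms by (intro orbit_cyclic_eq3 cyclic_on_orbit) (auto simp: permutation_permutes)

lemma finite_orbit_permutes:
  assumes "\<sigma> permutes B" "finite B" shows "finite (orbit \<sigma> x)"
  using orbit_self_in[OF assms] by (rule finite_orbit)

lemma orbits_disjoint:
  assumes "\<sigma> permutes B" "finite B" "z \<in> orbit \<sigma> x" "z \<in> orbit \<sigma> y" shows "orbit \<sigma> x = orbit \<sigma> y"
  using orbit_eq[OF assms(1,2,3)] orbit_eq[OF assms(1,2,4)] by simp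

lemma orbit_enum:
  assumes "x \<in> orbit f x"
  shows "bij_betw (\<lambda>n. (f ^^ n) x) {0..<card (orbit f x)} (orbit f x)"
    and "(f ^^ card (orbit f x)) x = x"
proof -
  let ?p = "funpow_dist1 f x x"
  have 1: "orbit f x = (\<lambda>n. (f ^^ n) x) ` {0..<?p}" using assms by (rule orbit_conv_funpow_dist1)
  have 2: "inj_on (\<lambda>n. (f ^^ n) x) {0..<?p}" using assms by (rule inj_on_funpow_dist1)
  have p: "card (orbit f x) = ?p" using card_image[OF 2] by (subst 1) simp
  show "bij_betw (\<lambda>n. (f ^^ n) x) {0..<card (orbit f x)} (orbit f x)"
    unfolding p using 1 2 by (simp add: bij_betw_def)
  show "(f ^^ card (orbit f x)) x = x" unfolding p using assms by (rule funpow_dist1_prop)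
qed

text \<open>
  Both orbits are enumerated by iterating from the chosen points, with the same period.
\<close>

lemma orbit_equivariant_bij:
  assumes x: "x \<in> orbit f x" and x': "x' \<in> orbit f' x'" and card: "card (orbit f x) = card (orbit f' x')"
    and fin: "finite (orbit f x)"
  shows "\<exists>h. bij_betw h (orbit f x) (orbit f' x') \<and> (\<forall>y\<in>orbit f x. h (f y) = f' (h y))"
proof -
  define p where "p = card (orbit f x)"
  define e where "e n = (f ^^ n) x" for n
  define e' where "e' n = (f' ^^ n) x'" for n
  have e: "bij_betw e {0..<p} (orbit f x)" "e p = x"
    using orbit_enum[OF x] unfolding p_def e_def by auto
  have e': "bij_betw e' {0..<p} (orbit f' x')" "e' p = x'"
    using orbit_enum[OF x'] unfolding p_def e'_def card by auto
  define h where "h y = e' (the_inv_into {0..<p} e y)" for y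
  have he: "h (e n) = e' n" if "n < p" for n
    unfolding h_def using bij_betw_imp_inj_on[OF e(1)] that by (simp add: the_inv_into_f_f)
  have "p > 0" using fin x by (auto simp: p_def card_gt_0_iff)
  have "bij_betw h (orbit f x) (orbit f' x')"
    unfolding h_def using bij_betw_trans[OF bij_betw_the_inv_into[OF e(1)] e'(1)] by (simp add: comp_def)
  moreover have "h (f y) = f' (h y)" if "y \<in> orbit f x" for y
  proof -
    obtain n where n: "n < p" "y = e n"
      using \<open>y \<in> orbit f x\<close> bij_betw_imp_surj_on[OF e(1)] by fastforce
    have f: "f y = e (Suc n)" "f' (e' n) = e' (Suc n)" using n by (simp_all add: e_def e'_def)
    show ?thesis
    proof (cases "Suc n < p")
      case True
      then show ?thesis using he n f by simp
    next
      case False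
      then have "Suc n = p" using n by simp
      then have "f y = e 0" "f' (e' n) = e' 0" using f e(2) e'(2) by (simp_all add: e_def e'_def)
      then show ?thesis using he[of 0] he[OF n(1)] n \<open>p > 0\<close> by simp
    qed
  qed
  ultimately show ?thesis by blast
qed

lemma bij_betw_equal_fibers:
  assumes fin: "finite F" "finite F'"
    and eq: "\<And>i. card {a \<in> F. c a = i} = card {a \<in> F'. c' a = i}"
  shows "\<exists>\<beta>. bij_betw \<beta> F F' \<and> (\<forall>a\<in>F. c' (\<beta> a) = c a)"
proof -
  have "\<exists>b. bij_betw b {a \<in> F. c a = i} {a \<in> F'. c' a = i}" for i
    using fin eq by (intro finite_same_card_bij) auto
  then have "\<exists>b. \<forall>i. bij_betw (b i) {a \<in> F. c a = i} {a \<in> F'. c' a = i}" by (intro choice allI)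
  then obtain b where b: "\<And>i. bij_betw (b i) {a \<in> F. c a = i} {a \<in> F'. c' a = i}" by blast
  define \<beta> where "\<beta> a = b (c a) a" for a
  have \<beta>: "\<beta> a \<in> F'" "c' (\<beta> a) = c a" if "a \<in> F" for a
    using bij_betwE[OF b[of "c a"]] that by (auto simp: \<beta>_def)
  have "inj_on \<beta> F"
  proof (rule inj_onI)
    fix x y assume xy: "x \<in> F" "y \<in> F" "\<beta> x = \<beta> y"
    then have "c x = c y" using \<beta> by metis
    then show "x = y" using xy bij_betw_imp_inj_on[OF b[of "c x"]] by (auto simp: \<beta>_def dest: inj_onD)
  qed
  moreover have "F' \<subseteq> \<beta> ` F"
  proof
    fix z assume "z \<in> F'"
    then have "z \<in> b (c' z) ` {a \<in> F. c a = c' z}" using bij_betw_imp_surj_on[OF b[of "c' z"]] by auto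
    then obtain a where "a \<in> F" "c a = c' z" "z = b (c a) a" by auto
    then show "z \<in> \<beta> ` F" by (auto simp: \<beta>_def)
  qed
  ultimately have "bij_betw \<beta> F F'" using \<beta>(1) by (auto simp: bij_betw_def)
  then show ?thesis using \<beta>(2) by blast
qed

text \<open>
  As \<^const>\<open>cycle_count\<close>, for permutations of an arbitrary finite set.
\<close>

definition cycles_of_length :: "(nat \<Rightarrow> nat) \<Rightarrow> nat set \<Rightarrow> nat \<Rightarrow> nat" where
  "cycles_of_length \<sigma> B i = card {C \<in> orbit \<sigma> ` B. card C = i}"

text \<open>
  Orbits of equal size are matched, and matched orbits are identified equivariantly.
\<close>

lemma equal_cycle_type_conj:
  assumes \<sigma>: "\<sigma> permutes B" "finite B" and \<tau>: "\<tau> permutes B'" "finite B'"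
    and eq: "\<And>i. cycles_of_length \<sigma> B i = cycles_of_length \<tau> B' i"
  shows "\<exists>h. bij_betw h B B' \<and> (\<forall>x\<in>B. h (\<sigma> x) = \<tau> (h x))"
proof -
  obtain \<beta> where \<beta>: "bij_betw \<beta> (orbit \<sigma> ` B) (orbit \<tau> ` B')"
    "\<And>C. C \<in> orbit \<sigma> ` B \<Longrightarrow> card (\<beta> C) = card C"
    using bij_betw_equal_fibers[of "orbit \<sigma> ` B" "orbit \<tau> ` B'" card card] \<sigma>(2) \<tau>(2) eq
    unfolding cycles_of_length_def by auto
  have "\<exists>h. bij_betw h C (\<beta> C) \<and> (\<forall>y\<in>C. h (\<sigma> y) = \<tau> (h y))" if C: "C \<in> orbit \<sigma> ` B" for C
  proof -
    obtain x where x: "x \<in> B" "C = orbit \<sigma> x" using C by blast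
    obtain x' where x': "x' \<in> B'" "\<beta> C = orbit \<tau> x'" using bij_betwE[OF \<beta>(1)] C by blast
    show ?thesis
      unfolding x'(2) unfolding x(2)
      using orbit_self_in[OF \<sigma>] orbit_self_in[OF \<tau>] finite_orbit_permutes[OF \<sigma>] \<beta>(2)[OF C] x x'
      by (intro orbit_equivariant_bij) auto
  qed
  then obtain H where H: "\<And>C. C \<in> orbit \<sigma> ` B \<Longrightarrow> bij_betw (H C) C (\<beta> C)"
    "\<And>C y. C \<in> orbit \<sigma> ` B \<Longrightarrow> y \<in> C \<Longrightarrow> H C (\<sigma> y) = \<tau> (H C y)" by metis
  define h where "h x = H (orbit \<sigma> x) x" for x
  have hx: "h x \<in> \<beta> (orbit \<sigma> x)" if "x \<in> B" for x
    unfolding h_def using bij_betwE[OF H(1)] orbit_self_in[OF \<sigma>] that by blast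
  have \<beta>B: "\<exists>x'\<in>B'. \<beta> (orbit \<sigma> x) = orbit \<tau> x'" if "x \<in> B" for x
    using bij_betwE[OF \<beta>(1)] that by blast
  have "inj_on h B"
  proof (rule inj_onI)
    fix x y assume xy: "x \<in> B" "y \<in> B" "h x = h y"
    have "\<beta> (orbit \<sigma> x) = \<beta> (orbit \<sigma> y)"
      using \<beta>B[OF xy(1)] \<beta>B[OF xy(2)] hx[OF xy(1)] hx[OF xy(2)] orbits_disjoint[OF \<tau>] xy(3) by metis
    then have o: "orbit \<sigma> x = orbit \<sigma> y" using bij_betw_imp_inj_on[OF \<beta>(1)] xy by (auto dest: inj_onD)
    then show "x = y" using xy(3) bij_betw_imp_inj_on[OF H(1)[of "orbit \<sigma> x"]] xy orbit_self_in[OF \<sigma>]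
      unfolding h_def by (metis imageI inj_onD)
  qed
  moreover have "h ` B \<subseteq> B'"
  proof clarify
    fix x assume "x \<in> B"
    then show "h x \<in> B'" using hx \<beta>B permutes_orbit_subset[OF \<tau>(1)] by fastforce
  qed
  moreover have "B' \<subseteq> h ` B"
  proof
    fix z assume z: "z \<in> B'"
    then have "orbit \<tau> z \<in> \<beta> ` orbit \<sigma> ` B" using bij_betw_imp_surj_on[OF \<beta>(1)] by blast
    then obtain x where x: "x \<in> B" "\<beta> (orbit \<sigma> x) = orbit \<tau> z" by (clarsimp simp: image_iff)
    then have "z \<in> H (orbit \<sigma> x) ` orbit \<sigma> x"
      using bij_betw_imp_surj_on[OF H(1)[of "orbit \<sigma> x"]] orbit_self_in[OF \<tau>] by auto
    then obtain y where y: "y \<in> orbit \<sigma> x" "z = H (orbit \<sigma> x) y" by blast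
    have "y \<in> B" using y(1) permutes_orbit_subset[OF \<sigma>(1) x(1)] by blast
    moreover have "z = h y" unfolding h_def using y orbit_eq[OF \<sigma> y(1)] by simp
    ultimately show "z \<in> h ` B" by blast
  qed
  moreover have "h (\<sigma> x) = \<tau> (h x)" if "x \<in> B" for x
  proof -
    have "orbit \<sigma> (\<sigma> x) = orbit \<sigma> x" using orbit_eq[OF \<sigma> orbit.base] .
    then show ?thesis unfolding h_def using H(2)[of "orbit \<sigma> x" x] that orbit_self_in[OF \<sigma>] by simp
  qed
  ultimately show ?thesis unfolding bij_betw_def by blast
qed

lemma card_cycles_sum:
  assumes \<sigma>: "\<sigma> permutes B" "finite B" and d: "\<And>C. C \<in> T \<Longrightarrow> card C \<in> {1..d}" and T: "T \<subseteq> orbit \<sigma> ` B"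
  shows "card (\<Union>T) = (\<Sum>i\<in>{1..d}. i * card {C \<in> T. card C = i})"
proof -
  have finT: "finite T" using T \<sigma>(2) finite_subset by blast
  have "card (\<Union>T) = (\<Sum>C\<in>T. card C)"
  proof (rule card_Union_disjoint)
    show "pairwise disjnt T"
    proof (rule pairwiseI)
      fix C D assume "C \<in> T" "D \<in> T" "C \<noteq> D"
      moreover from this obtain x y where "C = orbit \<sigma> x" "D = orbit \<sigma> y" using T by blast
      ultimately show "disjnt C D" unfolding disjnt_iff using orbits_disjoint[OF \<sigma>] by metis
    qed
    show "\<And>C. C \<in> T \<Longrightarrow> finite C" using T finite_orbit_permutes[OF \<sigma>] by blast
  qed
  also have "\<dots> = (\<Sum>i\<in>{1..d}. \<Sum>C\<in>{C \<in> T. card C = i}. card C)"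
    using finT d by (intro sum.group[symmetric]) auto
  also have "\<dots> = (\<Sum>i\<in>{1..d}. i * card {C \<in> T. card C = i})"
    by (intro sum.cong) auto
  finally show ?thesis .
qed

text \<open>
  A subset amounts to an independent choice of \<open>\<mu> i\<close> elements from each fibre of \<open>c\<close>.
\<close>

lemma card_subsets_with_profile:
  assumes F: "finite F" and c: "\<And>a. a \<in> F \<Longrightarrow> c a \<in> I" and I: "finite I"
  shows "card {T. T \<subseteq> F \<and> (\<forall>i\<in>I. card {a \<in> T. c a = i} = \<mu> i)} =
    (\<Prod>i\<in>I. card {a \<in> F. c a = i} choose \<mu> i)"
proof -
  define K where "K i = {T. T \<subseteq> {a \<in> F. c a = i} \<and> card T = \<mu> i}" for i
  have "bij_betw (\<lambda>T. \<lambda>i\<in>I. {a \<in> T. c a = i}) {T. T \<subseteq> F \<and> (\<forall>i\<in>I. card {a \<in> T. c a = i} = \<mu> i)} (PiE I K)"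
  proof (rule bij_betw_byWitness[where f' = "\<lambda>\<kappa>. \<Union>i\<in>I. \<kappa> i"])
    show "\<forall>T\<in>{T. T \<subseteq> F \<and> (\<forall>i\<in>I. card {a \<in> T. c a = i} = \<mu> i)}. (\<Union>i\<in>I. (\<lambda>i\<in>I. {a \<in> T. c a = i}) i) = T"
      using c by auto
    have *: "{a \<in> (\<Union>j\<in>I. \<kappa> j). c a = i} = \<kappa> i" if "\<kappa> \<in> PiE I K" "i \<in> I" for \<kappa> i
      using that by (fastforce simp: K_def PiE_iff)
    show "\<forall>\<kappa>\<in>PiE I K. (\<lambda>i\<in>I. {a \<in> (\<Union>j\<in>I. \<kappa> j). c a = i}) = \<kappa>"
    proof
      fix \<kappa> assume \<kappa>: "\<kappa> \<in> PiE I K"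
      show "(\<lambda>i\<in>I. {a \<in> (\<Union>j\<in>I. \<kappa> j). c a = i}) = \<kappa>"
      proof (rule extensionalityI[of _ I])
        show "\<kappa> \<in> extensional I" using \<kappa> by (simp add: PiE_iff)
        show "(\<lambda>i\<in>I. {a \<in> (\<Union>j\<in>I. \<kappa> j). c a = i}) x = \<kappa> x" if "x \<in> I" for x
          using *[OF \<kappa> that] that by simp
      qed simp
    qed
    show "(\<lambda>T. \<lambda>i\<in>I. {a \<in> T. c a = i}) ` {T. T \<subseteq> F \<and> (\<forall>i\<in>I. card {a \<in> T. c a = i} = \<mu> i)} \<subseteq> PiE I K"
      by (auto simp: K_def)
    show "(\<lambda>\<kappa>. \<Union>i\<in>I. \<kappa> i) ` PiE I K \<subseteq> {T. T \<subseteq> F \<and> (\<forall>i\<in>I. card {a \<in> T. c a = i} = \<mu> i)}"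
    proof clarify
      fix \<kappa> assume \<kappa>: "\<kappa> \<in> PiE I K"
      have "(\<Union>i\<in>I. \<kappa> i) \<subseteq> F" using \<kappa> by (fastforce simp: K_def PiE_iff)
      moreover have "card {a \<in> (\<Union>j\<in>I. \<kappa> j). c a = i} = \<mu> i" if "i \<in> I" for i
        using *[OF \<kappa> that] \<kappa> that by (auto simp: K_def PiE_iff)
      ultimately show "(\<Union>i\<in>I. \<kappa> i) \<subseteq> F \<and> (\<forall>i\<in>I. card {a \<in> (\<Union>i\<in>I. \<kappa> i). c a = i} = \<mu> i)" by blast
    qed
  qed
  then have "card {T. T \<subseteq> F \<and> (\<forall>i\<in>I. card {a \<in> T. c a = i} = \<mu> i)} = card (PiE I K)"
    by (rule bij_betw_same_card)
  also have "\<dots> = (\<Prod>i\<in>I. card (K i))" using I by (rule card_PiE)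
  also have "\<dots> = (\<Prod>i\<in>I. card {a \<in> F. c a = i} choose \<mu> i)"
    unfolding K_def using F by (intro prod.cong refl n_subsets) auto
  finally show ?thesis .
qed

section \<open>Character polynomials as functions\<close>

definition monom_eval :: "(nat \<Rightarrow>\<^sub>0 nat) \<Rightarrow> (nat \<Rightarrow> rat) \<Rightarrow> rat" where
  "monom_eval m x = (\<Prod>i\<in>Poly_Mapping.keys m. x i ^ Poly_Mapping.lookup m i)"

definition poly_eval :: "char_poly \<Rightarrow> (nat \<Rightarrow> rat) \<Rightarrow> rat" where
  "poly_eval P x = (\<Sum>m\<in>Poly_Mapping.keys P. Poly_Mapping.lookup P m * monom_eval m x)"

text \<open>
  The functions of the variables \<open>x i\<close> with \<open>i \<in> I\<close> that are given by polynomials with rational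
  coefficients.
\<close>

definition poly_fun :: "nat set \<Rightarrow> ((nat \<Rightarrow> rat) \<Rightarrow> rat) \<Rightarrow> bool" where
  "poly_fun I f \<longleftrightarrow> (\<exists>P. char_poly_vars P \<subseteq> I \<and> (\<forall>x. poly_eval P x = f x))"

lemma char_poly_eval_poly_eval:
  "char_poly_eval P n \<sigma> = poly_eval P (\<lambda>i. of_nat (cycle_count i n \<sigma>))"
  by (simp add: char_poly_eval_def poly_eval_def monom_eval_def)

lemma monom_eval_superset:
  assumes "finite I" "Poly_Mapping.keys m \<subseteq> I"
  shows "monom_eval m x = (\<Prod>i\<in>I. x i ^ Poly_Mapping.lookup m i)"
  unfolding monom_eval_def using assms
  by (intro prod.mono_neutral_left) (auto simp: in_keys_iff)

lemma monom_eval_add: "monom_eval (m + m') x = monom_eval m x * monom_eval m' x"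
proof -
  let ?I = "Poly_Mapping.keys m \<union> Poly_Mapping.keys m'"
  have "Poly_Mapping.keys (m + m') \<subseteq> ?I" by (rule Poly_Mapping.keys_add)
  then show ?thesis
    by (simp add: monom_eval_superset[of ?I] lookup_add power_add prod.distrib)
qed

lemma poly_eval_superset:
  assumes "finite M" "Poly_Mapping.keys P \<subseteq> M"
  shows "poly_eval P x = (\<Sum>m\<in>M. Poly_Mapping.lookup P m * monom_eval m x)"
  unfolding poly_eval_def using assms
  by (intro sum.mono_neutral_left) (auto simp: in_keys_iff)

lemma poly_eval_add: "poly_eval (P + Q) x = poly_eval P x + poly_eval Q x"
proof -
  let ?M = "Poly_Mapping.keys P \<union> Poly_Mapping.keys Q"
  have "Poly_Mapping.keys (P + Q) \<subseteq> ?M" by (rule Poly_Mapping.keys_add)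
  then show ?thesis
    by (simp add: poly_eval_superset[of ?M] lookup_add algebra_simps sum.distrib)
qed

lemma poly_fun_monom:
  assumes "Poly_Mapping.keys m \<subseteq> I"
  shows "poly_fun I (\<lambda>x. q * monom_eval m x)"
  unfolding poly_fun_def
  using assms by (intro exI[of _ "Poly_Mapping.single m q"]) (auto simp: char_poly_vars_def poly_eval_def)

lemma poly_fun_const: "poly_fun I (\<lambda>x. q)"
  using poly_fun_monom[of 0 I q] by (simp add: monom_eval_def)

lemma poly_fun_var: "i \<in> I \<Longrightarrow> poly_fun I (\<lambda>x. x i)"
  using poly_fun_monom[of "Poly_Mapping.single i 1" I 1] by (simp add: monom_eval_def)

lemma poly_fun_add:
  assumes "poly_fun I f" "poly_fun I g"
  shows "poly_fun I (\<lambda>x. f x + g x)"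
proof -
  obtain P Q where PQ: "char_poly_vars P \<subseteq> I" "\<And>x. poly_eval P x = f x"
    "char_poly_vars Q \<subseteq> I" "\<And>x. poly_eval Q x = g x" using assms unfolding poly_fun_def by blast
  have "char_poly_vars (P + Q) \<subseteq> char_poly_vars P \<union> char_poly_vars Q"
    unfolding char_poly_vars_def using Poly_Mapping.keys_add[of P Q] by blast
  then show ?thesis
    unfolding poly_fun_def using PQ by (intro exI[of _ "P + Q"]) (auto simp: poly_eval_add)
qed

lemma poly_fun_sum:
  assumes "\<And>s. s \<in> S \<Longrightarrow> poly_fun I (f s)"
  shows "poly_fun I (\<lambda>x. \<Sum>s\<in>S. f s x)"
  using assms by (induction S rule: infinite_finite_induct) (auto intro: poly_fun_const poly_fun_add)

lemma poly_fun_mult: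
  assumes "poly_fun I f" "poly_fun I g"
  shows "poly_fun I (\<lambda>x. f x * g x)"
proof -
  obtain P Q where P: "char_poly_vars P \<subseteq> I" "\<And>x. poly_eval P x = f x"
    and Q: "char_poly_vars Q \<subseteq> I" "\<And>x. poly_eval Q x = g x" using assms unfolding poly_fun_def by blast
  have "f x * g x = (\<Sum>m\<in>Poly_Mapping.keys P. \<Sum>m'\<in>Poly_Mapping.keys Q.
      (Poly_Mapping.lookup P m * Poly_Mapping.lookup Q m') * monom_eval (m + m') x)" for x
    unfolding P(2)[symmetric] Q(2)[symmetric] poly_eval_def sum_product monom_eval_add
    by (intro sum.cong refl) (simp add: mult_ac)
  moreover have "poly_fun I (\<lambda>x. \<Sum>m\<in>Poly_Mapping.keys P. \<Sum>m'\<in>Poly_Mapping.keys Q.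
      (Poly_Mapping.lookup P m * Poly_Mapping.lookup Q m') * monom_eval (m + m') x)"
  proof (intro poly_fun_sum poly_fun_monom)
    fix m m' assume "m \<in> Poly_Mapping.keys P" "m' \<in> Poly_Mapping.keys Q"
    then show "Poly_Mapping.keys (m + m') \<subseteq> I"
      using Poly_Mapping.keys_add[of m m'] P(1) Q(1) unfolding char_poly_vars_def by blast
  qed
  ultimately show ?thesis by simp
qed

lemma poly_fun_prod:
  assumes "\<And>s. s \<in> S \<Longrightarrow> poly_fun I (f s)"
  shows "poly_fun I (\<lambda>x. \<Prod>s\<in>S. f s x)"
  using assms by (induction S rule: infinite_finite_induct) (auto intro: poly_fun_const poly_fun_mult)

lemma poly_fun_gbinomial:
  assumes "i \<in> I"
  shows "poly_fun I (\<lambda>x. x i gchoose k)"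
proof -
  have "poly_fun I (\<lambda>x. inverse (fact k) * (\<Prod>j = 0..<k. x i + (- of_nat j)))"
    using assms by (intro poly_fun_mult poly_fun_prod poly_fun_add poly_fun_const poly_fun_var)
  then show ?thesis by (simp add: gbinomial_prod_rev field_simps)
qed

section \<open>Sums over invariant subsets\<close>

lemma perm_restrict_on_permutes:
  assumes "\<sigma> permutes S" "\<sigma> ` B = B"
  shows "perm_restrict \<sigma> B permutes B"
proof (rule bij_imp_permutes)
  have "inj_on \<sigma> B" using permutes_inj_on[OF assms(1)] .
  then have "bij_betw \<sigma> B B" using assms(2) by (simp add: bij_betw_def)
  then show "bij_betw (perm_restrict \<sigma> B) B B"
    by (subst bij_betw_cong[of _ _ \<sigma>]) (simp_all add: perm_restrict_def)
qed (simp add: perm_restrict_def)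

lemma orbit_perm_restrict_on:
  assumes "\<sigma> ` B = B" "x \<in> B"
  shows "orbit (perm_restrict \<sigma> B) x = orbit \<sigma> x"
  using assms by (intro orbit_cong0[of x B]) (auto simp: perm_restrict_def)

lemma orbit_invariant_subset:
  assumes "\<sigma> ` B \<subseteq> B" "x \<in> B"
  shows "orbit \<sigma> x \<subseteq> B"
proof
  fix y assume "y \<in> orbit \<sigma> x"
  then show "y \<in> B" by induct (use assms in auto)
qed

lemma orbits_of_Union_orbits:
  assumes \<sigma>: "\<sigma> permutes S" "finite S" and T: "T \<subseteq> orbit \<sigma> ` S"
  shows "orbit \<sigma> ` \<Union>T = T"
proof
  show "orbit \<sigma> ` \<Union>T \<subseteq> T"
  proof clarify
    fix y C assume y: "y \<in> C" "C \<in> T"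
    then obtain x where "C = orbit \<sigma> x" using T by blast
    then show "orbit \<sigma> y \<in> T" using orbit_eq[OF \<sigma>] y by metis
  qed
  show "T \<subseteq> orbit \<sigma> ` \<Union>T"
  proof
    fix C assume C: "C \<in> T"
    then obtain x where x: "C = orbit \<sigma> x" using T by blast
    then have "x \<in> \<Union>T" using C orbit_self_in[OF \<sigma>] by blast
    then show "C \<in> orbit \<sigma> ` \<Union>T" using x by blast
  qed
qed

text \<open>
  Invariant subsets are the unions of sets of orbits.
\<close>

lemma Union_orbits_bij:
  assumes \<sigma>: "\<sigma> permutes S" "finite S"
  shows "bij_betw Union (Pow (orbit \<sigma> ` S)) {B \<in> Pow S. \<sigma> ` B = B}"
proof (rule bij_betw_byWitness[where f' = "\<lambda>B. orbit \<sigma> ` B"])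
  show "\<forall>T\<in>Pow (orbit \<sigma> ` S). orbit \<sigma> ` \<Union>T = T" using orbits_of_Union_orbits[OF \<sigma>] by blast
  show "\<forall>B\<in>{B \<in> Pow S. \<sigma> ` B = B}. \<Union>(orbit \<sigma> ` B) = B"
  proof
    fix B assume B: "B \<in> {B \<in> Pow S. \<sigma> ` B = B}"
    show "\<Union>(orbit \<sigma> ` B) = B"
      using orbit_invariant_subset[of \<sigma> B] orbit_self_in[OF \<sigma>] B by blast
  qed
  show "Union ` Pow (orbit \<sigma> ` S) \<subseteq> {B \<in> Pow S. \<sigma> ` B = B}"
  proof clarify
    fix T assume T: "T \<subseteq> orbit \<sigma> ` S"
    have sub: "\<Union>T \<subseteq> S" using T permutes_orbit_subset[OF \<sigma>(1)] by blast
    have "\<sigma> ` \<Union>T \<subseteq> \<Union>T"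
    proof clarify
      fix y C assume y: "y \<in> C" "C \<in> T"
      then obtain x where "C = orbit \<sigma> x" using T by blast
      then have "\<sigma> y \<in> C" using y(1) by (simp add: orbit.step)
      then show "\<sigma> y \<in> \<Union>T" using y(2) by blast
    qed
    then have "\<sigma> ` \<Union>T = \<Union>T"
      using finite_subset[OF sub \<sigma>(2)] permutes_inj_on[OF \<sigma>(1)] by (intro endo_inj_surj)
    then show "\<Union>T \<in> Pow S \<and> \<sigma> ` \<Union>T = \<Union>T" using sub by blast
  qed
  show "(\<lambda>B. orbit \<sigma> ` B) ` {B \<in> Pow S. \<sigma> ` B = B} \<subseteq> Pow (orbit \<sigma> ` S)" by blast
qed

lemma card_orbit_bounds:
  assumes "\<tau> permutes B" "finite B" "C \<in> orbit \<tau> ` B"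
  shows "card C \<in> {1..card B}"
proof -
  obtain x where x: "x \<in> B" "C = orbit \<tau> x" using assms(3) by blast
  have "C \<subseteq> B" using permutes_orbit_subset[OF assms(1) x(1)] x(2) by simp
  then have "card C \<le> card B" using assms(2) by (intro card_mono)
  moreover have "C \<noteq> {}" "finite C"
    using orbit_self_in[OF assms(1,2), of x] finite_orbit_permutes[OF assms(1,2), of x] x by auto
  ultimately show ?thesis by (simp add: Suc_leI card_gt_0_iff)
qed

text \<open>
  The value of \<open>\<theta>\<close> on an invariant subset \<open>B\<close> with at most \<open>d\<close> elements depends only on the number of
  cycles of each length \<open>i \<in> {1..d}\<close> in \<open>B\<close>, the profile of \<open>B\<close>. Since \<open>B\<close> is a union of orbits, the
  number of \<open>B\<close> with profile \<open>\<mu>\<close> is the product of the binomial coefficients of \<open>X\<^sub>i\<close> over \<open>\<mu> i\<close>.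
\<close>

lemma class_function_sum_poly:
  fixes \<theta> :: "nat set \<Rightarrow> (nat \<Rightarrow> nat) \<Rightarrow> 'k::field_char_0"
  assumes conj: "\<And>B B' \<tau> \<tau>' h. finite B \<Longrightarrow> \<tau> permutes B \<Longrightarrow> finite B' \<Longrightarrow> \<tau>' permutes B' \<Longrightarrow>
        bij_betw h B B' \<Longrightarrow> (\<And>x. x \<in> B \<Longrightarrow> h (\<tau> x) = \<tau>' (h x)) \<Longrightarrow> \<theta> B \<tau> = \<theta> B' \<tau>'"
    and zero: "\<And>B \<tau>. finite B \<Longrightarrow> \<tau> permutes B \<Longrightarrow> d < card B \<Longrightarrow> \<theta> B \<tau> = 0"
    and rat: "\<And>B \<tau>. finite B \<Longrightarrow> \<tau> permutes B \<Longrightarrow> \<theta> B \<tau> \<in> \<rat>"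
  shows "\<exists>f. poly_fun {1..d} f \<and> (\<forall>S \<sigma>. finite S \<longrightarrow> \<sigma> permutes S \<longrightarrow>
     (\<Sum>B\<in>{B \<in> Pow S. \<sigma> ` B = B}. \<theta> B (perm_restrict \<sigma> B)) =
       of_rat (f (\<lambda>i. of_nat (cycles_of_length \<sigma> S i))))"
proof -
  define I where "I = {1..d}"
  define prof where "prof T = (\<lambda>i\<in>I. card {C \<in> T. card C = i})" for T :: "nat set set"
  \<comment> \<open>The profiles of the subsets with at most \<open>d\<close> elements: the sum is the number of elements.\<close>
  define Mu where "Mu = {\<mu> \<in> PiE I (\<lambda>_. {0..d}). (\<Sum>i\<in>I. i * \<mu> i) \<le> d}"
  have finMu: "finite Mu" unfolding Mu_def by (auto simp: I_def intro!: finite_PiE)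
  define Q where "Q \<mu> r \<longleftrightarrow> (\<exists>B \<tau>. finite B \<and> \<tau> permutes B \<and> card B \<le> d \<and>
      prof (orbit \<tau> ` B) = \<mu> \<and> \<theta> B \<tau> = of_rat r)" for \<mu> r
  define \<Theta> where "\<Theta> \<mu> = (SOME r. Q \<mu> r)" for \<mu>
  have \<Theta>: "\<theta> B \<tau> = of_rat (\<Theta> (prof (orbit \<tau> ` B)))"
    if B: "finite B" "\<tau> permutes B" "card B \<le> d" for B \<tau>
  proof -
    obtain r where "\<theta> B \<tau> = of_rat r" using rat[OF B(1,2)] by (rule Rats_cases)
    then have "Q (prof (orbit \<tau> ` B)) r" unfolding Q_def using B by blast
    then have "Q (prof (orbit \<tau> ` B)) (\<Theta> (prof (orbit \<tau> ` B)))" unfolding \<Theta>_def by (rule someI)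
    then obtain B' \<tau>' where B': "finite B'" "\<tau>' permutes B'" "card B' \<le> d"
      "prof (orbit \<tau>' ` B') = prof (orbit \<tau> ` B)" "\<theta> B' \<tau>' = of_rat (\<Theta> (prof (orbit \<tau> ` B)))"
      unfolding Q_def by blast
    have out: "cycles_of_length \<rho> D i = 0" if "finite D" "\<rho> permutes D" "card D \<le> d" "i \<notin> I" for \<rho> D i
    proof -
      have "{C \<in> orbit \<rho> ` D. card C = i} = {}"
        using card_orbit_bounds[OF that(2,1)] that(3,4) by (fastforce simp: I_def)
      then show ?thesis unfolding cycles_of_length_def by (metis card.empty)
    qed
    have "cycles_of_length \<tau> B i = cycles_of_length \<tau>' B' i" for i
    proof (cases "i \<in> I")
      case True
      then show ?thesis using fun_cong[OF B'(4), of i] by (simp add: prof_def cycles_of_length_def)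
    next
      case False
      then show ?thesis using out B B' by simp
    qed
    then obtain h where "bij_betw h B B'" "\<And>x. x \<in> B \<Longrightarrow> h (\<tau> x) = \<tau>' (h x)"
      using equal_cycle_type_conj[OF B(2,1) B'(2,1)] by blast
    then show ?thesis using conj[OF B(1,2) B'(1,2)] B'(5) by simp
  qed
  define f where "f x = (\<Sum>\<mu>\<in>Mu. \<Theta> \<mu> * (\<Prod>i\<in>I. x i gchoose \<mu> i))" for x :: "nat \<Rightarrow> rat"
  have "poly_fun {1..d} f"
    unfolding f_def I_def by (intro poly_fun_sum poly_fun_mult poly_fun_const poly_fun_prod poly_fun_gbinomial)
  moreover have "(\<Sum>B\<in>{B \<in> Pow S. \<sigma> ` B = B}. \<theta> B (perm_restrict \<sigma> B)) =
       of_rat (f (\<lambda>i. of_nat (cycles_of_length \<sigma> S i)))" if S: "finite S" and \<sigma>: "\<sigma> permutes S" for S \<sigma>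
  proof -
    define Orb where "Orb = orbit \<sigma> ` S"
    \<comment> \<open>Larger orbits do not lie in a subset with at most \<open>d\<close> elements.\<close>
    define Orbd where "Orbd = {C \<in> Orb. card C \<le> d}"
    have fin: "finite Orb" "finite Orbd" using S by (auto simp: Orb_def Orbd_def)
    have card_I: "card C \<in> I" if "C \<in> Orbd" for C
      using card_orbit_bounds[OF \<sigma> S, of C] that by (auto simp: Orbd_def Orb_def I_def)
    have card_Un: "card (\<Union>T) = (\<Sum>i\<in>I. i * prof T i)" if "T \<subseteq> Orbd" for T
    proof -
      have "card (\<Union>T) = (\<Sum>i\<in>{1..d}. i * card {C \<in> T. card C = i})"
      proof (rule card_cycles_sum[OF \<sigma> S])
        show "card C \<in> {1..d}" if "C \<in> T" for C using card_I that \<open>T \<subseteq> Orbd\<close> unfolding I_def by blast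
        show "T \<subseteq> orbit \<sigma> ` S" using that unfolding Orbd_def Orb_def by blast
      qed
      then show ?thesis by (simp add: prof_def I_def)
    qed
    have summand: "\<theta> (\<Union>T) (perm_restrict \<sigma> (\<Union>T)) =
        (if T \<subseteq> Orbd \<and> prof T \<in> Mu then of_rat (\<Theta> (prof T)) else 0)" if T: "T \<in> Pow Orb" for T
    proof -
      define B where "B = \<Union>T"
      define \<tau> where "\<tau> = perm_restrict \<sigma> B"
      have "B \<in> {B \<in> Pow S. \<sigma> ` B = B}"
        using bij_betwE[OF Union_orbits_bij[OF \<sigma> S]] T unfolding B_def Orb_def by blast
      then have B: "B \<subseteq> S" "\<sigma> ` B = B" by auto
      have finB: "finite B" using B(1) S finite_subset by blast
      have \<tau>: "\<tau> permutes B" unfolding \<tau>_def by (rule perm_restrict_on_permutes[OF \<sigma> B(2)])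
      have "orbit \<tau> ` B = orbit \<sigma> ` B"
        unfolding \<tau>_def using orbit_perm_restrict_on[OF B(2)] by (intro image_cong) auto
      then have orb: "orbit \<tau> ` B = T"
        using orbits_of_Union_orbits[OF \<sigma> S, of T] T by (simp add: B_def Orb_def)
      show ?thesis
      proof (cases "card B \<le> d")
        case True
        have sub: "T \<subseteq> Orbd"
          using card_orbit_bounds[OF \<tau> finB] True T unfolding orb Orbd_def by fastforce
        have sum: "(\<Sum>i\<in>I. i * prof T i) \<le> d" using card_Un[OF sub] True by (simp add: B_def)
        have "prof T i \<le> d" if i: "i \<in> I" for i
        proof -
          have "prof T i \<le> i * prof T i" using i by (simp add: I_def)
          also have "\<dots> \<le> (\<Sum>i\<in>I. i * prof T i)" using i by (intro member_le_sum) (auto simp: I_def)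
          finally show ?thesis using sum by simp
        qed
        then have "prof T \<in> Mu" using sum unfolding Mu_def by (auto simp: prof_def)
        moreover have "\<theta> B \<tau> = of_rat (\<Theta> (prof T))" using \<Theta>[OF finB \<tau> True] by (simp only: orb)
        ultimately show ?thesis using sub unfolding \<tau>_def B_def by simp
      next
        case False
        then have "\<not> (T \<subseteq> Orbd \<and> prof T \<in> Mu)" using card_Un[of T] by (auto simp: B_def Mu_def)
        moreover have "\<theta> B \<tau> = 0" using zero[OF finB \<tau>] False by simp
        ultimately show ?thesis unfolding \<tau>_def B_def by auto
      qed
    qed
    have "(\<Sum>B\<in>{B \<in> Pow S. \<sigma> ` B = B}. \<theta> B (perm_restrict \<sigma> B)) =
        (\<Sum>T\<in>Pow Orb. \<theta> (\<Union>T) (perm_restrict \<sigma> (\<Union>T)))"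
      unfolding Orb_def by (rule sum.reindex_bij_betw[OF Union_orbits_bij[OF \<sigma> S], symmetric])
    also have "\<dots> = (\<Sum>T\<in>Pow Orb. if T \<subseteq> Orbd \<and> prof T \<in> Mu then of_rat (\<Theta> (prof T)) else 0)"
      using summand by (intro sum.cong) auto
    also have "\<dots> = (\<Sum>T\<in>{T \<in> Pow Orb. T \<subseteq> Orbd \<and> prof T \<in> Mu}. of_rat (\<Theta> (prof T)))"
      using fin by (intro sum.inter_filter[symmetric]) simp
    also have "{T \<in> Pow Orb. T \<subseteq> Orbd \<and> prof T \<in> Mu} = {T. T \<subseteq> Orbd \<and> prof T \<in> Mu}"
      by (auto simp: Orbd_def)
    also have "(\<Sum>T\<in>{T. T \<subseteq> Orbd \<and> prof T \<in> Mu}. of_rat (\<Theta> (prof T)) :: 'k) =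
        (\<Sum>\<mu>\<in>Mu. \<Sum>T\<in>{T \<in> {T. T \<subseteq> Orbd \<and> prof T \<in> Mu}. prof T = \<mu>}. of_rat (\<Theta> (prof T)))"
      using fin finMu by (intro sum.group[symmetric]) auto
    also have "\<dots> = (\<Sum>\<mu>\<in>Mu. of_rat (\<Theta> \<mu> * (\<Prod>i\<in>I. of_nat (cycles_of_length \<sigma> S i) gchoose \<mu> i)))"
    proof (rule sum.cong[OF refl])
      fix \<mu> assume \<mu>: "\<mu> \<in> Mu"
      have ext: "\<mu> \<in> extensional I" using \<mu> by (simp add: Mu_def PiE_iff)
      have prof_eq: "prof T = \<mu> \<longleftrightarrow> (\<forall>i\<in>I. card {C \<in> T. card C = i} = \<mu> i)" for T
      proof
        assume "\<forall>i\<in>I. card {C \<in> T. card C = i} = \<mu> i"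
        then show "prof T = \<mu>" using ext by (intro extensionalityI[of _ I]) (auto simp: prof_def)
      qed (auto simp: prof_def)
      have "{T \<in> {T. T \<subseteq> Orbd \<and> prof T \<in> Mu}. prof T = \<mu>} = {T. T \<subseteq> Orbd \<and> prof T = \<mu>}"
        using \<mu> by auto
      then have set_eq: "{T \<in> {T. T \<subseteq> Orbd \<and> prof T \<in> Mu}. prof T = \<mu>} =
          {T. T \<subseteq> Orbd \<and> (\<forall>i\<in>I. card {C \<in> T. card C = i} = \<mu> i)}" by (simp only: prof_eq)
      have "card {T. T \<subseteq> Orbd \<and> (\<forall>i\<in>I. card {C \<in> T. card C = i} = \<mu> i)} =
          (\<Prod>i\<in>I. card {C \<in> Orbd. card C = i} choose \<mu> i)"
        using fin(2) card_I by (rule card_subsets_with_profile) (simp_all add: I_def)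
      also have "\<dots> = (\<Prod>i\<in>I. cycles_of_length \<sigma> S i choose \<mu> i)"
      proof (rule prod.cong[OF refl])
        fix i assume "i \<in> I"
        then have "{C \<in> Orbd. card C = i} = {C \<in> orbit \<sigma> ` S. card C = i}"
          by (auto simp: Orbd_def Orb_def I_def)
        then show "(card {C \<in> Orbd. card C = i} choose \<mu> i) = (cycles_of_length \<sigma> S i choose \<mu> i)"
          by (simp add: cycles_of_length_def)
      qed
      finally have card: "card {T. T \<subseteq> Orbd \<and> (\<forall>i\<in>I. card {C \<in> T. card C = i} = \<mu> i)} =
          (\<Prod>i\<in>I. cycles_of_length \<sigma> S i choose \<mu> i)" .
      have "(\<Sum>T\<in>{T \<in> {T. T \<subseteq> Orbd \<and> prof T \<in> Mu}. prof T = \<mu>}. of_rat (\<Theta> (prof T)) :: 'k) =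
          (\<Sum>T\<in>{T \<in> {T. T \<subseteq> Orbd \<and> prof T \<in> Mu}. prof T = \<mu>}. of_rat (\<Theta> \<mu>))"
        by (intro sum.cong) auto
      also have "\<dots> = of_nat (\<Prod>i\<in>I. cycles_of_length \<sigma> S i choose \<mu> i) * of_rat (\<Theta> \<mu>)"
        unfolding set_eq by (simp add: card)
      also have "\<dots> = of_rat (\<Theta> \<mu> * of_nat (\<Prod>i\<in>I. cycles_of_length \<sigma> S i choose \<mu> i))"
        by (simp only: of_rat_mult of_rat_of_nat_eq mult.commute)
      also have "of_nat (\<Prod>i\<in>I. cycles_of_length \<sigma> S i choose \<mu> i) =
          (\<Prod>i\<in>I. of_nat (cycles_of_length \<sigma> S i) gchoose \<mu> i :: rat)"
        by (simp add: binomial_gbinomial)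
      finally show "(\<Sum>T\<in>{T \<in> {T. T \<subseteq> Orbd \<and> prof T \<in> Mu}. prof T = \<mu>}. of_rat (\<Theta> (prof T)) :: 'k) =
          of_rat (\<Theta> \<mu> * (\<Prod>i\<in>I. of_nat (cycles_of_length \<sigma> S i) gchoose \<mu> i))" .
    qed
    also have "\<dots> = of_rat (f (\<lambda>i. of_nat (cycles_of_length \<sigma> S i)))"
      unfolding f_def by (simp add: of_rat_sum)
    finally show ?thesis .
  qed
  ultimately show ?thesis by blast
qed

section \<open>Rationality of traces\<close>

lemma bij_betw_fixed_points: "(\<And>x. x \<in> A \<Longrightarrow> f x = x) \<Longrightarrow> bij_betw f A A"
  by (simp add: bij_betw_def inj_on_def)

lemma orbit_funpow_subset:
  assumes "x \<in> orbit \<sigma> x"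
  shows "orbit (\<sigma> ^^ k) x \<subseteq> orbit \<sigma> x"
proof (rule orbit_invariant_subset[OF _ assms])
  have "(\<sigma> ^^ k) y \<in> orbit \<sigma> x" if "y \<in> orbit \<sigma> x" for y
    using that by (induction k) (auto intro: orbit.step)
  then show "(\<sigma> ^^ k) ` orbit \<sigma> x \<subseteq> orbit \<sigma> x" by blast
qed

text \<open>
  As \<open>k\<close> is invertible modulo \<open>m\<close>, the permutation \<open>\<sigma>\<close> is a power of \<open>\<sigma> ^^ k\<close>, so that the two have the same
  orbits.
\<close>

lemma coprime_power_conj:
  fixes \<sigma> :: "nat \<Rightarrow> nat"
  assumes \<sigma>: "\<sigma> permutes B" "finite B" and m: "\<sigma> ^^ m = id" "coprime k m"
  shows "\<exists>h. h permutes B \<and> h \<circ> \<sigma> = (\<sigma> ^^ k) \<circ> h"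
proof -
  define \<tau> where "\<tau> = \<sigma> ^^ k"
  have \<tau>: "\<tau> permutes B" unfolding \<tau>_def using \<sigma>(1) by (rule permutes_funpow)
  have "\<exists>l. \<tau> ^^ l = \<sigma>"
  proof (cases "k = 0")
    case True
    then have "m = 1" using m(2) by simp
    then have "\<sigma> = id" using m(1) by simp
    then show ?thesis by (intro exI[of _ 1]) (simp add: \<tau>_def True)
  next
    case False
    then obtain x y where "k * x = m * y + 1" using bezout_nat[of k m] m(2) by (auto simp: coprime_iff_gcd_eq_1)
    then have "\<tau> ^^ x = \<sigma> ^^ (m * y + 1)" unfolding \<tau>_def by (simp add: funpow_mult mult.commute)
    also have "\<dots> = \<sigma>" unfolding funpow_add using m(1) by (simp flip: funpow_mult)
    finally show ?thesis by blast
  qed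
  then obtain l where l: "\<tau> ^^ l = \<sigma>" by blast
  have "orbit \<tau> x = orbit \<sigma> x" for x
    using orbit_funpow_subset[OF orbit_self_in[OF \<sigma>, of x], of k]
      orbit_funpow_subset[OF orbit_self_in[OF \<tau> \<sigma>(2), of x], of l]
    unfolding l \<tau>_def[symmetric] by (rule subset_antisym)
  then have "cycles_of_length \<sigma> B i = cycles_of_length \<tau> B i" for i by (simp add: cycles_of_length_def)
  then obtain h where h: "bij_betw h B B" "\<And>x. x \<in> B \<Longrightarrow> h (\<sigma> x) = \<tau> (h x)"
    using equal_cycle_type_conj[OF \<sigma> \<tau> \<sigma>(2)] by blast
  define h' where "h' x = (if x \<in> B then h x else x)" for x
  have "bij_betw h' B B" using h(1) by (subst bij_betw_cong[of _ _ h]) (simp_all add: h'_def)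
  then have h': "h' permutes B" by (rule bij_imp_permutes) (simp add: h'_def)
  have "h' (\<sigma> x) = \<tau> (h' x)" for x
  proof (cases "x \<in> B")
    case True
    then show ?thesis using h(2) permutes_in_image[OF \<sigma>(1)] by (simp add: h'_def)
  next
    case False
    then show ?thesis using permutes_not_in[OF \<sigma>(1)] permutes_not_in[OF \<tau>] by (simp add: h'_def)
  qed
  then show ?thesis using h' unfolding \<tau>_def by (auto simp: fun_eq_iff)
qed

text \<open>
  Induction on an exponent \<open>m\<close> with \<open>\<sigma> ^^ m = id\<close>. The sum \<open>q\<close> of the actions of the powers of \<open>\<sigma>\<close>
  satisfies \<open>q \<circ> q = m q\<close>, so its trace is an integer. The powers with exponent coprime to \<open>m\<close> are
  conjugate to \<open>\<sigma>\<close> and contribute the same trace; the others satisfy the equation for a smaller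
  exponent.
\<close>

lemma trace_permutation_action_rational:
  fixes scale :: "'k::field_char_0 \<Rightarrow> 'v::ab_group_add \<Rightarrow> 'v" and B :: "nat set"
  assumes ls: "lin_space scale" and W: "lin_space.fin_dim scale W" and B: "finite B"
    and lin: "\<And>\<sigma>. \<sigma> permutes B \<Longrightarrow> lin_space.lin_on scale W W (\<rho> \<sigma>)"
    and comp: "\<And>\<sigma> \<tau> w. \<sigma> permutes B \<Longrightarrow> \<tau> permutes B \<Longrightarrow> w \<in> W \<Longrightarrow> \<rho> (\<sigma> \<circ> \<tau>) w = \<rho> \<sigma> (\<rho> \<tau> w)"
    and one: "\<And>w. w \<in> W \<Longrightarrow> \<rho> id w = w"
    and \<sigma>: "\<sigma> permutes B"
  shows "trace_on scale W (\<rho> \<sigma>) \<in> \<rat>"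
proof -
  interpret lin_space scale by (rule ls)
  have sW: "subspace W" using W unfolding fin_dim_def by auto
  have main: "trace_on scale W (\<rho> \<sigma>) \<in> \<rat>" if "m > 0" "\<sigma> permutes B" "\<sigma> ^^ m = id" for m \<sigma>
    using that
  proof (induction m arbitrary: \<sigma> rule: less_induct)
    case (less m)
    note \<sigma> = less.prems(2)
    have pw: "(\<sigma> ^^ k) permutes B" for k using \<sigma> by (rule permutes_funpow)
    define q where "q v = (\<Sum>k<m. \<rho> (\<sigma> ^^ k) v)" for v
    have q_lin: "lin_on W W q"
      unfolding lin_on_def
    proof (intro conjI ballI allI)
      show "q v \<in> W" if "v \<in> W" for v
        unfolding q_def using sW lin_on_in[OF lin[OF pw] that] by (rule subspace_sum)
      show "q (v + w) = q v + q w" if "v \<in> W" "w \<in> W" for v w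
        unfolding q_def using lin_on_add[OF lin[OF pw] that] by (simp add: sum.distrib)
      show "q (scale c v) = scale c (q v)" if "v \<in> W" for c v
        unfolding q_def using lin_on_scale[OF lin[OF pw] that] by (simp add: scale_sum_right)
    qed
    have q_inv: "\<rho> \<sigma> (q v) = q v" if v: "v \<in> W" for v
    proof -
      have "\<rho> \<sigma> (q v) = (\<Sum>k<m. \<rho> \<sigma> (\<rho> (\<sigma> ^^ k) v))"
        unfolding q_def using lin_on_in[OF lin[OF pw] v] by (intro lin_on_sum[OF lin[OF \<sigma>] sW])
      also have "\<dots> = (\<Sum>k<m. \<rho> (\<sigma> ^^ Suc k) v)"
        using comp[OF \<sigma> pw v] by simp
      also have "\<dots> = (\<Sum>k<m. \<rho> (\<sigma> ^^ k) v) + \<rho> (\<sigma> ^^ m) v - \<rho> (\<sigma> ^^ 0) v"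
        using sum.lessThan_Suc_shift[of "\<lambda>k. \<rho> (\<sigma> ^^ k) v" m] sum.lessThan_Suc[of "\<lambda>k. \<rho> (\<sigma> ^^ k) v" m]
        by (simp only: algebra_simps)
      also have "\<dots> = q v" using less.prems(3) by (simp add: q_def id_def)
      finally show ?thesis .
    qed
    have q_inv_pw: "\<rho> (\<sigma> ^^ k) (q v) = q v" if v: "v \<in> W" for v k
    proof (induction k)
      case 0
      then show ?case using one[OF lin_on_in[OF q_lin v]] by (simp add: id_def)
    next
      case (Suc k)
      then show ?case using comp[OF \<sigma> pw[of k] lin_on_in[OF q_lin v]] q_inv[OF v]
        by (simp only: funpow.simps)
    qed
    have "q (q v) = scale (of_nat m) (q v)" if "v \<in> W" for v
      by (subst q_def) (simp add: q_inv_pw[OF that] sum_constant_scale)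
    then obtain d where "trace_on scale W q = of_nat m * of_nat d"
      using trace_on_idempotent[OF W q_lin] by blast
    moreover have "trace_on scale W q = (\<Sum>k<m. trace_on scale W (\<rho> (\<sigma> ^^ k)))"
      unfolding q_def using lin[OF pw] by (rule trace_on_sum[OF W])
    ultimately have total: "(\<Sum>k<m. trace_on scale W (\<rho> (\<sigma> ^^ k))) \<in> \<rat>" by simp
    have non: "trace_on scale W (\<rho> (\<sigma> ^^ k)) \<in> \<rat>" if k: "\<not> coprime k m" for k
    proof -
      define g where "g = gcd k m"
      have g: "g dvd m" "g dvd k" "g \<noteq> 1" "g > 0" using k less.prems(1) by (auto simp: g_def coprime_iff_gcd_eq_1)
      then obtain m' k' where m': "m = g * m'" "k = g * k'" by (meson dvdE)
      have "m' > 0" "m' < m" using m' g less.prems(1) by (auto simp: n_less_m_mult_n)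
      moreover have "(\<sigma> ^^ k) ^^ m' = id"
      proof -
        have "(\<sigma> ^^ k) ^^ m' = \<sigma> ^^ (m * k')" by (simp add: funpow_mult m' mult_ac)
        also have "\<dots> = (\<sigma> ^^ m) ^^ k'" by (simp add: funpow_mult mult_ac)
        finally show ?thesis by (simp only: less.prems(3) id_funpow)
      qed
      ultimately show ?thesis using less.IH pw by blast
    qed
    have cop: "trace_on scale W (\<rho> (\<sigma> ^^ k)) = trace_on scale W (\<rho> \<sigma>)" if k: "coprime k m" for k
    proof -
      obtain h where h: "h permutes B" "h \<circ> \<sigma> = (\<sigma> ^^ k) \<circ> h"
        using coprime_power_conj[OF \<sigma> B less.prems(3) k] by blast
      have hi: "inv h permutes B" using h(1) by (rule permutes_inv)
      have 1: "\<rho> (inv h) (\<rho> h w) = w" if "w \<in> W" for w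
        using comp[OF hi h(1) that] one[OF that] permutes_inv_o(2)[OF h(1)] by simp
      have 2: "\<rho> h (\<rho> (inv h) w) = w" if "w \<in> W" for w
        using comp[OF h(1) hi that] one[OF that] permutes_inv_o(1)[OF h(1)] by simp
      have "bij_betw (\<rho> h) W W"
        using 1 2 lin_on_in[OF lin[OF h(1)]] lin_on_in[OF lin[OF hi]]
        by (intro bij_betw_byWitness[where f' = "\<rho> (inv h)"]) auto
      then show ?thesis
      proof (rule trace_on_conj[OF W lin[OF h(1)] _ lin[OF \<sigma>] lin[OF pw]])
        show "\<rho> (\<sigma> ^^ k) (\<rho> h w) = \<rho> h (\<rho> \<sigma> w)" if "w \<in> W" for w
          using comp[OF pw h(1) that] comp[OF h(1) \<sigma> that] h(2) by simp
      qed
    qed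
    define c where "c = card {k \<in> {..<m}. coprime k m}"
    have "(\<Sum>k<m. trace_on scale W (\<rho> (\<sigma> ^^ k))) =
        (\<Sum>k\<in>{k \<in> {..<m}. coprime k m}. trace_on scale W (\<rho> (\<sigma> ^^ k))) +
        (\<Sum>k\<in>{k \<in> {..<m}. \<not> coprime k m}. trace_on scale W (\<rho> (\<sigma> ^^ k)))"
      by (subst sum.union_disjoint[symmetric]) (auto intro: sum.cong)
    also have "(\<Sum>k\<in>{k \<in> {..<m}. coprime k m}. trace_on scale W (\<rho> (\<sigma> ^^ k))) =
        of_nat c * trace_on scale W (\<rho> \<sigma>)"
      using cop by (simp add: c_def)
    finally have "of_nat c * trace_on scale W (\<rho> \<sigma>) = (\<Sum>k<m. trace_on scale W (\<rho> (\<sigma> ^^ k))) -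
        (\<Sum>k\<in>{k \<in> {..<m}. \<not> coprime k m}. trace_on scale W (\<rho> (\<sigma> ^^ k)))" by simp
    also have "\<dots> \<in> \<rat>" using non by (intro Rats_diff[OF total] Rats_sum) auto
    finally have rat: "of_nat c * trace_on scale W (\<rho> \<sigma>) \<in> \<rat>" .
    have mem: "(if m = 1 then 0 else 1) \<in> {k \<in> {..<m}. coprime k m}" using less.prems(1) by auto
    have "finite {k \<in> {..<m}. coprime k m}" by simp
    then have "c \<noteq> 0" unfolding c_def using mem card_0_eq by blast
    then have "trace_on scale W (\<rho> \<sigma>) = of_nat c * trace_on scale W (\<rho> \<sigma>) / of_nat c" by simp
    then show ?case using Rats_divide[OF rat Rats_of_nat[of c]] by simp
  qed
  obtain m where "\<sigma> ^^ m = id" "m > 0"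
    using permutation_is_nilpotent[of \<sigma>] \<sigma> B by (metis permutation_permutes)
  then show ?thesis using main \<sigma> by blast
qed

section \<open>The character and the dimension\<close>

locale fi_stable_char_0 = fi_stable scale V act a
  for scale :: "'k::field_char_0 \<Rightarrow> 'v::ab_group_add \<Rightarrow> 'v" and V act a +
  fixes d :: nat
  assumes boundary_eq_V: "finite S \<Longrightarrow> B \<subseteq> S \<Longrightarrow> d < card B \<Longrightarrow> boundary S B = V S"
begin

lemma quot_trace_zero: "finite S \<Longrightarrow> B \<subseteq> S \<Longrightarrow> d < card B \<Longrightarrow> quot_trace S B \<sigma> = 0"
  by (simp add: quot_trace_def boundary_eq_V)

lemma quot_trace_rational:
  assumes S: "finite S" "B \<subseteq> S" and \<sigma>: "\<sigma> permutes B"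
  shows "quot_trace S B \<sigma> \<in> \<rat>"
proof -
  have finB: "finite B" using finite_subset[OF S(2,1)] .
  have p: "inj_on \<tau> S" "\<tau> ` S \<subseteq> S" "\<tau> ` B = B" if "\<tau> permutes B" for \<tau>
    using permutes_inj_on[OF that] permutes_image[OF that] permutes_image[OF permutes_subset[OF that S(2)]]
    by auto
  have comp: "push S S (\<tau> \<circ> \<tau>') w = push S S \<tau> (push S S \<tau>' w)" if "\<tau> permutes B" "\<tau>' permutes B" "w \<in> V S" for \<tau> \<tau>' w
    unfolding comp_def using S p[OF that(1)] p[OF that(2)] that(3) by (intro push_comp[symmetric]) auto
  have one: "push S S id w = w" if "w \<in> V S" for w using S(1) that by (intro push_id) auto
  have "trace_on scale (V S) (push S S \<sigma>) \<in> \<rat>"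
    using S comp one p \<sigma> finB
    by (intro trace_permutation_action_rational[OF lin_space_axioms fin_dim_V, where \<rho> = "push S S"] push_lin) auto
  moreover have "trace_on scale (boundary S B) (push S S \<sigma>) \<in> \<rat>"
  proof (rule trace_permutation_action_rational[OF lin_space_axioms fin_dim_boundary, where \<rho> = "push S S"])
    show "lin_on (boundary S B) (boundary S B) (push S S \<tau>)" if "\<tau> permutes B" for \<tau>
      using S p[OF that] by (intro boundary_lin)
  qed (use S comp[OF _ _ subsetD[OF boundary_sub]] one[OF subsetD[OF boundary_sub]] \<sigma> finB in auto)
  ultimately show ?thesis by (simp add: quot_trace_def)
qed

lemma quot_trace_conj_Un:
  assumes fin: "finite A" "finite B" and disj: "A \<inter> B = {}" and disj': "A' \<inter> B' = {}"
    and g: "bij_betw g A A'" and h: "bij_betw h B B'"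
    and \<sigma>: "bij_betw \<sigma> A A" "bij_betw \<sigma> B B" and \<sigma>': "bij_betw \<sigma>' A' A'" "bij_betw \<sigma>' B' B'"
    and eqA: "\<And>x. x \<in> A \<Longrightarrow> \<sigma>' (g x) = g (\<sigma> x)" and eqB: "\<And>x. x \<in> B \<Longrightarrow> \<sigma>' (h x) = h (\<sigma> x)"
  shows "quot_trace (A' \<union> B') B' \<sigma>' = quot_trace (A \<union> B) B \<sigma>"
proof -
  define k where "k x = (if x \<in> B then h x else g x)" for x
  have kA: "k x = g x" if "x \<in> A" for x using that disj by (auto simp: k_def)
  have kB: "k x = h x" if "x \<in> B" for x using that by (simp add: k_def)
  have k: "bij_betw k A A'" "bij_betw k B B'"
    using g h bij_betw_cong[of A k g] bij_betw_cong[of B k h] kA kB by blast+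
  have kS: "bij_betw k (A \<union> B) (A' \<union> B')" using bij_betw_combine[OF k disj'] .
  have s: "bij_betw \<sigma> (A \<union> B) (A \<union> B)" using bij_betw_combine[OF \<sigma> disj] .
  have s': "bij_betw \<sigma>' (A' \<union> B') (A' \<union> B')" using bij_betw_combine[OF \<sigma>' disj'] .
  have \<sigma>A: "\<sigma> x \<in> A" if "x \<in> A" for x using bij_betwE[OF \<sigma>(1)] that by blast
  have \<sigma>B: "\<sigma> x \<in> B" if "x \<in> B" for x using bij_betwE[OF \<sigma>(2)] that by blast
  show ?thesis
  proof (rule quot_trace_conj[OF _ _ fin_dim_V kS])
    show "\<sigma>' (k x) = k (\<sigma> x)" if "x \<in> A \<union> B" for x
      using that eqA eqB \<sigma>A \<sigma>B by (auto simp: kA kB)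
  qed (use fin k(2) s s' \<sigma>(2) \<sigma>'(2) in \<open>auto simp: bij_betw_def\<close>)
qed

text \<open>
  A set of \<open>t\<close> points outside the finite set \<open>B\<close>, used as the set of fixed points that is
  adjoined to \<open>B\<close>.
\<close>

definition fresh :: "nat \<Rightarrow> nat set \<Rightarrow> nat set" where
  "fresh t B = {Suc (Max (insert 0 B))..<Suc (Max (insert 0 B)) + t}"

lemma fresh: "finite (fresh t B)" "card (fresh t B) = t" "finite B \<Longrightarrow> fresh t B \<inter> B = {}"
proof -
  show "fresh t B \<inter> B = {}" if "finite B"
    using that Max_ge[of "insert 0 B"] by (fastforce simp: fresh_def)
qed (auto simp: fresh_def)

text \<open>
  The trace formula with the new points as base \<open>A\<close>. Since \<open>A\<close> has at least \<open>a\<close> elements, no condition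
  on \<open>n\<close> arises.
\<close>

lemma trace_with_fixed_points_poly:
  assumes t: "a \<le> t"
  shows "\<exists>f. poly_fun {1..d} f \<and> (\<forall>n \<sigma>. \<sigma> permutes {1..n} \<longrightarrow>
     trace_on scale (V {1..n + t}) (push {1..n + t} {1..n + t} \<sigma>) =
       of_rat (f (\<lambda>i. of_nat (cycles_of_length \<sigma> {1..n} i))))"
proof -
  define \<theta> where "\<theta> B \<tau> = quot_trace (fresh t B \<union> B) B \<tau>" for B \<tau>
  have fixes_fresh: "bij_betw \<tau> (fresh t B) (fresh t B)" "\<And>x. x \<in> fresh t B \<Longrightarrow> \<tau> x = x"
    if "\<tau> permutes B" "finite B" for \<tau> :: "nat \<Rightarrow> nat" and B
  proof -
    show *: "\<tau> x = x" if "x \<in> fresh t B" for x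
      using fresh(3)[OF \<open>finite B\<close>, of t] permutes_not_in[OF \<open>\<tau> permutes B\<close>] that by blast
    show "bij_betw \<tau> (fresh t B) (fresh t B)" using * by (rule bij_betw_fixed_points)
  qed
  have "\<exists>f. poly_fun {1..d} f \<and> (\<forall>S \<sigma>. finite S \<longrightarrow> \<sigma> permutes S \<longrightarrow>
     (\<Sum>B\<in>{B \<in> Pow S. \<sigma> ` B = B}. \<theta> B (perm_restrict \<sigma> B)) =
       of_rat (f (\<lambda>i. of_nat (cycles_of_length \<sigma> S i))))"
  proof (rule class_function_sum_poly)
    fix B B' :: "nat set" and \<tau> \<tau>' h :: "nat \<Rightarrow> nat"
    assume B: "finite B" "\<tau> permutes B" and B': "finite B'" "\<tau>' permutes B'"
      and h: "bij_betw h B B'" "\<And>x. x \<in> B \<Longrightarrow> h (\<tau> x) = \<tau>' (h x)"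
    have "\<exists>g. bij_betw g (fresh t B) (fresh t B')"
      using fresh by (intro finite_same_card_bij) auto
    then obtain g where g: "bij_betw g (fresh t B) (fresh t B')" by blast
    have "\<theta> B' \<tau>' = \<theta> B \<tau>"
      unfolding \<theta>_def
    proof (rule quot_trace_conj_Un[OF fresh(1) B(1) fresh(3)[OF B(1)] fresh(3)[OF B'(1)] g h(1)])
      show "\<tau>' (g x) = g (\<tau> x)" if "x \<in> fresh t B" for x
        using fixes_fresh(2)[OF B(2,1) that] fixes_fresh(2)[OF B'(2,1)] bij_betwE[OF g] that by metis
      show "\<tau>' (h x) = h (\<tau> x)" if "x \<in> B" for x using h(2)[OF that] by simp
    qed (use fixes_fresh(1) B B' permutes_imp_bij in auto)
    then show "\<theta> B \<tau> = \<theta> B' \<tau>'" by simp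
  next
    show "\<theta> B \<tau> = 0" if "finite B" "\<tau> permutes B" "d < card B" for B \<tau>
      unfolding \<theta>_def using that fresh by (intro quot_trace_zero) auto
    show "\<theta> B \<tau> \<in> \<rat>" if "finite B" "\<tau> permutes B" for B \<tau>
      unfolding \<theta>_def using that fresh by (intro quot_trace_rational) auto
  qed
  then obtain f where f: "poly_fun {1..d} f" "\<And>S \<sigma>. finite S \<Longrightarrow> \<sigma> permutes S \<Longrightarrow>
     (\<Sum>B\<in>{B \<in> Pow S. \<sigma> ` B = B}. \<theta> B (perm_restrict \<sigma> B)) =
       of_rat (f (\<lambda>i. of_nat (cycles_of_length \<sigma> S i)))" by blast
  have "trace_on scale (V {1..n + t}) (push {1..n + t} {1..n + t} \<sigma>) =
       of_rat (f (\<lambda>i. of_nat (cycles_of_length \<sigma> {1..n} i)))" if \<sigma>: "\<sigma> permutes {1..n}" for n \<sigma>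
  proof -
    define A where "A = {n + 1..n + t}"
    have A: "finite A" "card A = t" "A \<inter> {1..n} = {}" "A \<union> {1..n} = {1..n + t}" by (auto simp: A_def)
    have fixA: "\<sigma> x = x" if "x \<in> A" for x using permutes_not_in[OF \<sigma>] A(3) that by blast
    have "trace_on scale (V (A \<union> {1..n})) (push (A \<union> {1..n}) (A \<union> {1..n}) \<sigma>) =
        (\<Sum>B\<in>{B \<in> Pow {1..n}. \<sigma> ` B = B}. quot_trace (A \<union> B) B \<sigma>)"
      using A t fixA permutes_inj_on[OF \<sigma>] permutes_image[OF \<sigma>] by (intro trace_cube) auto
    also have "\<dots> = (\<Sum>B\<in>{B \<in> Pow {1..n}. \<sigma> ` B = B}. \<theta> B (perm_restrict \<sigma> B))"
    proof (rule sum.cong[OF refl])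
      fix B assume B: "B \<in> {B \<in> Pow {1..n}. \<sigma> ` B = B}"
      have finB: "finite B" using B finite_subset by auto
      have \<tau>: "perm_restrict \<sigma> B permutes B" using perm_restrict_on_permutes[OF \<sigma>] B by blast
      have "\<exists>g. bij_betw g (fresh t B) A" using fresh A by (intro finite_same_card_bij) auto
      then obtain g where g: "bij_betw g (fresh t B) A" by blast
      have AB: "A \<inter> B = {}" using A(3) B by blast
      show "quot_trace (A \<union> B) B \<sigma> = \<theta> B (perm_restrict \<sigma> B)"
        unfolding \<theta>_def
      proof (rule quot_trace_conj_Un[OF fresh(1) finB fresh(3)[OF finB] AB g bij_betw_id])
        show "\<sigma> (g x) = g (perm_restrict \<sigma> B x)" if "x \<in> fresh t B" for x
          using fixA bij_betwE[OF g] fixes_fresh(2)[OF \<tau> finB that] that by auto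
        show "\<sigma> (id x) = id (perm_restrict \<sigma> B x)" if "x \<in> B" for x using that by (simp add: perm_restrict_def)
        show "bij_betw \<sigma> A A" using fixA by (rule bij_betw_fixed_points)
        show "bij_betw \<sigma> B B" using B permutes_inj_on[OF \<sigma>] by (simp add: bij_betw_def)
      qed (use fixes_fresh(1)[OF \<tau> finB] permutes_imp_bij[OF \<tau>] in auto)
    qed
    also have "\<dots> = of_rat (f (\<lambda>i. of_nat (cycles_of_length \<sigma> {1..n} i)))" using \<sigma> by (intro f(2)) auto
    finally show ?thesis by (simp only: A(4))
  qed
  then show ?thesis using f(1) by blast
qed

text \<open>
  The trace formula with \<open>{1..n}\<close> as base. All subsets of the set of new points are invariant, and
  those of the same size \<open>j\<close> contribute equally.
\<close>

lemma trace_polynomial_in_fixed_points: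
  assumes n: "a \<le> n" and \<sigma>: "\<sigma> permutes {1..n}"
  shows "trace_on scale (V {1..n + t}) (push {1..n + t} {1..n + t} \<sigma>) =
    (\<Sum>j<Suc d. of_nat (t choose j) * quot_trace {1..n + j} {n + 1..n + j} \<sigma>)"
proof -
  define Y where "Y = {n + 1..n + t}"
  have Y: "finite Y" "card Y = t" "{1..n} \<inter> Y = {}" "{1..n} \<union> Y = {1..n + t}" by (auto simp: Y_def)
  have fixY: "\<sigma> x = x" if "x \<notin> {1..n}" for x using permutes_not_in[OF \<sigma>] that by blast
  have fix_bij: "bij_betw \<sigma> B B" if "B \<inter> {1..n} = {}" for B
    using fixY that by (intro bij_betw_fixed_points) blast
  have YB: "B \<inter> {1..n} = {}" if "B \<subseteq> Y" for B using that Y(3) by blast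
  have inj: "inj_on \<sigma> X" for X using permutes_inj_on[OF \<sigma>] .
  have "trace_on scale (V ({1..n} \<union> Y)) (push ({1..n} \<union> Y) ({1..n} \<union> Y) \<sigma>) =
      (\<Sum>B\<in>{B \<in> Pow Y. \<sigma> ` B = B}. quot_trace ({1..n} \<union> B) B \<sigma>)"
    using n Y inj permutes_image[OF \<sigma>] fix_bij[of Y] by (intro trace_cube) (auto simp: bij_betw_def)
  also have "{B \<in> Pow Y. \<sigma> ` B = B} = Pow Y" using fix_bij YB by (auto simp: bij_betw_def)
  also have "(\<Sum>B\<in>Pow Y. quot_trace ({1..n} \<union> B) B \<sigma>) = (\<Sum>B\<in>{B \<in> Pow Y. card B < Suc d}. quot_trace ({1..n} \<union> B) B \<sigma>)"
  proof (rule sum.mono_neutral_right)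
    show "\<forall>B\<in>Pow Y - {B \<in> Pow Y. card B < Suc d}. quot_trace ({1..n} \<union> B) B \<sigma> = 0"
      using Y(1) finite_subset by (auto intro!: quot_trace_zero)
  qed (use Y in auto)
  also have "\<dots> = (\<Sum>j\<in>{..<Suc d}. \<Sum>B\<in>{B \<in> {B \<in> Pow Y. card B < Suc d}. card B = j}. quot_trace ({1..n} \<union> B) B \<sigma>)"
    using Y(1) by (intro sum.group[symmetric]) auto
  also have "\<dots> = (\<Sum>j<Suc d. of_nat (t choose j) * quot_trace {1..n + j} {n + 1..n + j} \<sigma>)"
  proof (rule sum.cong[OF refl])
    fix j assume j: "j \<in> {..<Suc d}"
    have eq: "quot_trace ({1..n} \<union> B) B \<sigma> = quot_trace ({1..n} \<union> {n + 1..n + j}) {n + 1..n + j} \<sigma>" if B: "B \<subseteq> Y" "card B = j" for B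
    proof -
      have "\<exists>h. bij_betw h {n + 1..n + j} B" using B Y(1) finite_subset by (intro finite_same_card_bij) auto
      then obtain h where h: "bij_betw h {n + 1..n + j} B" by blast
      show ?thesis
      proof (rule quot_trace_conj_Un[OF _ _ _ _ bij_betw_id h])
        show "\<sigma> (h x) = h (\<sigma> x)" if "x \<in> {n + 1..n + j}" for x
        proof -
          have "h x \<in> B" using bij_betwE[OF h] that by blast
          then have "\<sigma> (h x) = h x" using fixY YB[OF B(1)] by blast
          moreover have "\<sigma> x = x" using that by (intro fixY) auto
          ultimately show ?thesis by simp
        qed
      qed (use YB[OF B(1)] fix_bij permutes_imp_bij[OF \<sigma>] in auto)
    qed
    have set_eq: "{B \<in> {B \<in> Pow Y. card B < Suc d}. card B = j} = {B. B \<subseteq> Y \<and> card B = j}" using j by auto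
    have un: "{1..n} \<union> {n + 1..n + j} = {1..n + j}" by auto
    have "(\<Sum>B\<in>{B. B \<subseteq> Y \<and> card B = j}. quot_trace ({1..n} \<union> B) B \<sigma>) =
        (\<Sum>B\<in>{B. B \<subseteq> Y \<and> card B = j}. quot_trace {1..n + j} {n + 1..n + j} \<sigma>)"
      using eq unfolding un by (intro sum.cong) auto
    then show "(\<Sum>B\<in>{B \<in> {B \<in> Pow Y. card B < Suc d}. card B = j}. quot_trace ({1..n} \<union> B) B \<sigma>) =
        of_nat (t choose j) * quot_trace {1..n + j} {n + 1..n + j} \<sigma>"
      unfolding set_eq by (simp add: n_subsets[OF Y(1)] Y(2))
  qed
  finally show ?thesis by (simp only: Y(4))
qed

end

definition char_poly_from :: "nat \<Rightarrow> (nat \<Rightarrow> (nat \<Rightarrow> nat) \<Rightarrow> 'k::field_char_0) \<Rightarrow> bool" where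
  "char_poly_from N F \<longleftrightarrow> (\<exists>r f. poly_fun {1..r} f \<and> (\<forall>n\<ge>N. \<forall>\<sigma>. \<sigma> permutes {1..n} \<longrightarrow>
     F n \<sigma> = of_rat (f (\<lambda>i. of_nat (cycles_of_length \<sigma> {1..n} i)))))"

lemma poly_fun_mono: "poly_fun I f \<Longrightarrow> I \<subseteq> J \<Longrightarrow> poly_fun J f"
  unfolding poly_fun_def by blast

lemma char_poly_from_diff:
  assumes "char_poly_from N F" "char_poly_from N G"
  shows "char_poly_from N (\<lambda>n \<sigma>. F n \<sigma> - G n \<sigma>)"
proof -
  obtain r f s g where f: "poly_fun {1..r} f" "\<And>n \<sigma>. n \<ge> N \<Longrightarrow> \<sigma> permutes {1..n} \<Longrightarrow>
     F n \<sigma> = of_rat (f (\<lambda>i. of_nat (cycles_of_length \<sigma> {1..n} i)))"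
    and g: "poly_fun {1..s} g" "\<And>n \<sigma>. n \<ge> N \<Longrightarrow> \<sigma> permutes {1..n} \<Longrightarrow>
     G n \<sigma> = of_rat (g (\<lambda>i. of_nat (cycles_of_length \<sigma> {1..n} i)))"
    using assms unfolding char_poly_from_def by metis
  have "poly_fun {1..max r s} (\<lambda>x. f x + (- 1) * g x)"
    using poly_fun_mono[OF f(1), of "{1..max r s}"] poly_fun_mono[OF g(1), of "{1..max r s}"]
    by (intro poly_fun_add poly_fun_mult poly_fun_const) auto
  then show ?thesis
    unfolding char_poly_from_def using f(2) g(2)
    by (intro exI[of _ "max r s"] exI[of _ "\<lambda>x. f x + (- 1) * g x"]) (auto simp: of_rat_diff)
qed

text \<open>
  Induction on \<open>D\<close>. The difference of \<open>G\<close> in the direction of \<open>t\<close> has one term less, so it is a character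
  polynomial for all \<open>t\<close> by induction; hence \<open>G t\<close> is one whenever \<open>G (Suc t)\<close> is,
  and a descent from \<open>a\<close> reaches every \<open>t < a\<close>.
\<close>

lemma char_poly_descent:
  fixes G :: "nat \<Rightarrow> nat \<Rightarrow> (nat \<Rightarrow> nat) \<Rightarrow> 'k::field_char_0"
  assumes "\<And>t n \<sigma>. n \<ge> N \<Longrightarrow> \<sigma> permutes {1..n} \<Longrightarrow> G t n \<sigma> = (\<Sum>j<D. of_nat (t choose j) * \<psi> j n \<sigma>)"
    and "\<And>t. t \<ge> a \<Longrightarrow> char_poly_from N (G t)"
  shows "char_poly_from N (G t)"
  using assms
proof (induction D arbitrary: G \<psi> t)
  case 0
  then show ?case
    unfolding char_poly_from_def
    by (intro exI[of _ 0] exI[of _ "\<lambda>_. 0"]) (auto intro: poly_fun_const)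
next
  case (Suc D)
  define G' where "G' t n \<sigma> = G (Suc t) n \<sigma> - G t n \<sigma>" for t n \<sigma>
  have G': "char_poly_from N (G' t)" for t
  proof (rule Suc.IH)
    show "char_poly_from N (G' t)" if "t \<ge> a" for t
      unfolding G'_def using that Suc.prems(2) by (intro char_poly_from_diff) auto
    fix t n \<sigma> assume n: "n \<ge> N" "\<sigma> permutes {1..n}"
    have "G' t n \<sigma> = (\<Sum>j<Suc D. (of_nat (Suc t choose j) - of_nat (t choose j)) * \<psi> j n \<sigma>)"
      unfolding G'_def Suc.prems(1)[OF n] by (simp only: sum_subtractf[symmetric] left_diff_distrib)
    also have "\<dots> = (\<Sum>j<D. of_nat (t choose j) * \<psi> (Suc j) n \<sigma>)"
      by (subst sum.lessThan_Suc_shift) simp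
    finally show "G' t n \<sigma> = (\<Sum>j<D. of_nat (t choose j) * \<psi> (Suc j) n \<sigma>)" .
  qed
  show ?case
  proof (cases "a \<le> t")
    case True
    then show ?thesis by (rule Suc.prems(2))
  next
    case False
    then have "t \<le> a" by simp
    then show ?thesis
    proof (induction rule: inc_induct)
      case base
      show ?case by (rule Suc.prems(2)) simp
    next
      case (step t)
      have "char_poly_from N (\<lambda>n \<sigma>. G (Suc t) n \<sigma> - G' t n \<sigma>)"
        using step.IH G' by (rule char_poly_from_diff)
      then show ?case by (simp add: G'_def)
    qed
  qed
qed

text \<open>
  The character is the case \<open>t = 0\<close> of the trace of permutations with \<open>t\<close> additional fixed points.
\<close>

lemma (in fi_stable_char_0) character_char_poly:
  "char_poly_from a (fi_character scale V act)"
proof -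
  define G where "G t n \<sigma> = trace_on scale (V {1..n + t}) (push {1..n + t} {1..n + t} \<sigma>)" for t n \<sigma>
  have "char_poly_from a (G 0)"
  proof (rule char_poly_descent[where a = a and D = "Suc d"])
    show "G t n \<sigma> = (\<Sum>j<Suc d. of_nat (t choose j) * (\<lambda>j n \<sigma>. quot_trace {1..n + j} {n + 1..n + j} \<sigma>) j n \<sigma>)"
      if "a \<le> n" "\<sigma> permutes {1..n}" for t n \<sigma>
      unfolding G_def using trace_polynomial_in_fixed_points[OF that] .
    show "char_poly_from a (G t)" if "a \<le> t" for t
      unfolding char_poly_from_def G_def using trace_with_fixed_points_poly[OF that] by blast
  qed
  moreover have "G 0 = fi_character scale V act" by (simp add: G_def fun_eq_iff fi_character_def push_eq_act)
  ultimately show ?thesis by simp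
qed

text \<open>
  The identity has \<open>n\<close> cycles of length \<open>1\<close> and no others.
\<close>

lemma char_poly_eval_id:
  assumes "char_poly_vars P \<subseteq> {1..r}"
  shows "\<exists>p :: rat poly. \<forall>n. char_poly_eval P n id = poly p (of_nat n)"
proof -
  define x where "x i = (if i = 1 then [:0, 1:] else 0 :: rat poly)" for i :: nat
  have orbit_id: "orbit id y = {y}" for y :: nat by (simp add: orbit_eq_singleton_iff)
  have cc: "of_nat (cycle_count i n id) = poly (x i) (of_nat n :: rat)" for i n
  proof -
    have "{C \<in> orbit id ` {1..n}. card C = i} = (if i = 1 then (\<lambda>y. {y}) ` {1..n} else {})"
      by (auto simp: orbit_id)
    then have "cycle_count i n id = (if i = 1 then n else 0)"
      by (simp add: cycle_count_def card_image inj_on_def)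
    then show ?thesis by (simp add: x_def)
  qed
  define p where "p = (\<Sum>m\<in>Poly_Mapping.keys P. [:Poly_Mapping.lookup P m:] *
      (\<Prod>i\<in>Poly_Mapping.keys m. x i ^ Poly_Mapping.lookup m i))"
  have "char_poly_eval P n id = poly p (of_nat n)" for n
    unfolding char_poly_eval_def p_def cc by (simp add: poly_sum poly_prod)
  then show ?thesis by blast
qed

theorem theorem1p5:
  fixes scale :: "'k::field_char_0 \<Rightarrow> 'v::ab_group_add \<Rightarrow> 'v"
    and V :: "nat set \<Rightarrow> 'v set"
    and act :: "nat set \<Rightarrow> nat set \<Rightarrow> (nat \<Rightarrow> nat) \<Rightarrow> 'v \<Rightarrow> 'v"
  assumes "fi_module scale V act"
    and "fi_module.finitely_generated scale V act"
  shows "(\<exists>(r::nat) (N::nat) (P::char_poly). char_poly_vars P \<subseteq> {1..r} \<and>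
            (\<forall>n\<ge>N. \<forall>\<sigma>. \<sigma> permutes {1..n} \<longrightarrow>
               fi_character scale V act n \<sigma> = of_rat (char_poly_eval P n \<sigma>))) \<and>
         (\<exists>(N::nat) (p::rat poly). \<forall>n\<ge>N.
            of_nat (vector_space.dim scale (V {1..n})) = poly p (of_nat n))"
proof -
  interpret fi_module scale V act by (rule assms(1))
  interpret fi_space scale V act
    by (intro fi_space.intro lin_space.intro assms(1)) (simp flip: module_iff_vector_space, unfold_locales)
  obtain gs where "\<And>m g. (m, g) \<in> set gs \<Longrightarrow> g \<in> V {1..m}"
    and "\<And>S. finite S \<Longrightarrow>
      V S = span {push {1..m} S f g |m g f. (m, g) \<in> set gs \<and> inj_on f {1..m} \<and> f ` {1..m} \<subseteq> S}"
    using fin_gen_spanning[OF assms(2)] by blast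
  then interpret fi_gen scale V act gs by unfold_locales
  obtain a where "torsion_free_from a"
    using torsion_vanishes unfolding torsion_free_from_def by blast
  then interpret fi_stable_char_0 scale V act a gen_degree
    using finitely_generated_imp_finite_span[OF assms(2)] boundary_full
    by unfold_locales (auto simp: fin_dim_def)
  obtain r f where f: "poly_fun {1..r} f" "\<And>n \<sigma>. a \<le> n \<Longrightarrow> \<sigma> permutes {1..n} \<Longrightarrow>
      fi_character scale V act n \<sigma> = of_rat (f (\<lambda>i. of_nat (cycles_of_length \<sigma> {1..n} i)))"
    using character_char_poly unfolding char_poly_from_def by blast
  obtain P where P: "char_poly_vars P \<subseteq> {1..r}" "\<And>x. poly_eval P x = f x"
    using f(1) unfolding poly_fun_def by blast
  have char: "fi_character scale V act n \<sigma> = of_rat (char_poly_eval P n \<sigma>)"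
    if "a \<le> n" "\<sigma> permutes {1..n}" for n \<sigma>
    using f(2)[OF that]
    by (simp add: char_poly_eval_poly_eval P(2) cycles_of_length_def cycle_count_def)
  obtain p where p: "\<And>n. char_poly_eval P n id = poly p (of_nat n)" using char_poly_eval_id[OF P(1)] by blast
  have "of_nat (dim (V {1..n})) = poly p (of_nat n)" if n: "a \<le> n" for n
  proof -
    have "fi_character scale V act n id = of_nat (dim (V {1..n}))"
      unfolding fi_character_def push_eq_act[symmetric]
      using fin_dim_V push_id by (intro trace_on_id) auto
    then have "of_nat (dim (V {1..n})) = (of_rat (poly p (of_nat n)) :: 'k)"
      using char[OF n permutes_id] p by simp
    then have "of_rat (of_nat (dim (V {1..n}))) = (of_rat (poly p (of_nat n)) :: 'k)" by simp
    then show ?thesis by (simp only: of_rat_eq_iff)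
  qed
  then show ?thesis using P(1) char by blast
qed

end
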